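(* Let $(\mathscr{C},\mathbb{E},\mathfrak{s})$ be a pre-extriangulated category. If $\mathscr{C}$ satisfies (ET0) and (ET0)$^{\mathrm{op}}$, then the conditions (ET4), (ET4-1), (ET4-2), (ET4-3), (ET4-4) and (ET4-5) (all spelled out in the context) are equivalent and self-dual. That is, any one of these six conditions holds for $\mathscr{C}$ if and only if any other one does, and for each $X$ among these six conditions, $\mathscr{C}$ satisfies $X$ if and only if $\mathscr{C}$ satisfies the dual condition $X^{\mathrm{op}}$.
   Context: **Extensions.** Let $\mathscr{C}$ be an additive category and $\mathbb{E}:\mathscr{C}^{\mathrm{op}}\times\mathscr{C}\to\mathrm{Ab}$ a biadditive functor. An element $\delta\in\mathbb{E}(C,A)$ is an $\mathbb{E}$-extension. For $a:A\to A'$ put $a_*\delta=\mathbb{E}(C,a)(\delta)\in\mathbb{E}(C,A')$; for $c:C'\to C$ put $c^*\delta=\mathbb{E}(c,A)(\delta)\in\mathbb{E}(C',A)$. For $\delta\in\mathbb{E}(C,A)$, $\delta'\in\mathbb{E}(C',A')$, a morphism of $\mathbb{E}$-extensions $(a,c):\delta\to\delta'$ is a pair $a:A\to A'$, $c:C\to C'$ with $a_*\delta=c^*\delta'$. $\delta\oplus\delta'\in\mathbb{E}(C\oplus C',A\oplus A')$ is the element corresponding to $(\delta,0,0,\delta')$ under $\mathbb{E}(C\oplus C',A\oplus A')\cong\mathbb{E}(C,A)\oplus\mathbb{E}(C,A')\oplus\mathbb{E}(C',A)\oplus\mathbb{E}(C',A')$. **Realizations.** Sequences $A\xrightarrow{x}B\xrightarrow{y}C$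 and $A\xrightarrow{x'}B'\xrightarrow{y'}C$ are equivalent if there is an isomorphism $b:B\to B'$ with $bx=x'$, $y'b=y$; $[A\xrightarrow{x}B\xrightarrow{y}C]$ is the equivalence class. A realization $\mathfrak{s}$ of $\mathbb{E}$ assigns to each $\delta\in\mathbb{E}(C,A)$ an equivalence class $\mathfrak{s}(\delta)=[A\xrightarrow{x}B\xrightarrow{y}C]$ such that for every morphism of $\mathbb{E}$-extensions $(a,c):\delta\to\delta'$ with $\mathfrak{s}(\delta)=[A\xrightarrow{x}B\xrightarrow{y}C]$ and $\mathfrak{s}(\delta')=[A'\xrightarrow{x'}B'\xrightarrow{y'}C']$ there is $b:B\to B'$ with $bx=x'a$ and $y'b=cy$. It is additive if $\mathfrak{s}(0)=[A\xrightarrow{\binom{1}{0}}A\oplus C\xrightarrow{(0,1)}C]$ for $0\in\mathbb{E}(C,A)$, and $\mathfrak{s}(\delta\oplus\delta')=\mathfrak{s}(\delta)\oplus\mathfrak{s}(\delta')$ (termwise direct sum) for all $\delta,\delta'$. If $\mathfrak{s}(\delta)=[A\xrightarrow{x}B\xrightarrow{y}C]$, then $A\xrightarrow{x}B\xrightarrow{y}C\overset{\delta}{\dashrightarrow}$ is called an $\mathbb{E}$-triangle (realizing $\delta$), $x$ is called an inflation and $y$ a deflation. A morphism of $\mathbb{E}$-triangles from $A\xrightarrow{x}B\xrightarrow{y}C\overset{\delta}{\dashrightarrow}$ to $A'\xrightarrow{x'}B'\xrightarrow{y'}C'\overset{\delta'}{\dashrightarrow}$ is a triple $(a,b,c)$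 with $bx=x'a$, $y'b=cy$ and $a_*\delta=c^*\delta'$. **Pre-extriangulated category.** A triple $(\mathscr{C},\mathbb{E},\mathfrak{s})$ with $\mathscr{C}$ additive such that: (ET1) $\mathbb{E}:\mathscr{C}^{\mathrm{op}}\times\mathscr{C}\to\mathrm{Ab}$ is a biadditive functor; (ET2) $\mathfrak{s}$ is an additive realization of $\mathbb{E}$; (ET3) for any two $\mathbb{E}$-triangles $A\xrightarrow{x}B\xrightarrow{y}C\overset{\delta}{\dashrightarrow}$ and $A'\xrightarrow{x'}B'\xrightarrow{y'}C'\overset{\delta'}{\dashrightarrow}$ and any $a:A\to A'$, $b:B\to B'$ with $bx=x'a$, there is $c:C\to C'$ such that $(a,b,c)$ is a morphism of $\mathbb{E}$-triangles; (ET3)$^{\mathrm{op}}$ for any two $\mathbb{E}$-triangles $A\xrightarrow{x}B\xrightarrow{y}C\overset{\delta}{\dashrightarrow}$ and $A'\xrightarrow{x'}B'\xrightarrow{y'}C'\overset{\delta'}{\dashrightarrow}$ and any $b:B\to B'$, $c:C\to C'$ with $y'b=cy$, there is $a:A\to A'$ such that $(a,b,c)$ is a morphism of $\mathbb{E}$-triangles. **Conditions.** (ET0) If $f:A\to B$ and $g:B\to C$ are inflations, then $gf$ is an inflation. (ET0)$^{\mathrm{op}}$ If $f:A\to B$ and $g:B\to C$ are deflations, then $gf$ is a deflation. (ET4) For any $\mathbb{E}$-triangles $A\xrightarrow{f}B\xrightarrow{f'}D\overset{\delta}{\dashrightarrow}$ and $B\xrightarrow{g}C\xrightarrow{g'}F\overset{\delta'}{\dashrightarrow}$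 there are an object $E$ and $\mathbb{E}$-triangles $A\xrightarrow{h}C\xrightarrow{h'}E\overset{\delta''}{\dashrightarrow}$ and $D\xrightarrow{d}E\xrightarrow{e}F\overset{f'_*\delta'}{\dashrightarrow}$ such that $h=gf$, $df'=h'g$, $eh'=g'$, $d^*\delta''=\delta$ and $f_*\delta''=e^*\delta'$. (ET4-1) For any $\mathbb{E}$-triangles $A_1\xrightarrow{x_1}B_1\xrightarrow{y_1}C\overset{\delta_1}{\dashrightarrow}$ and $A_2\xrightarrow{x_2}B_2\xrightarrow{y_2}C\overset{\delta_2}{\dashrightarrow}$ there are an object $M$ and $\mathbb{E}$-triangles $A_1\xrightarrow{m_1}M\xrightarrow{e_1}B_2\overset{y_2^*\delta_1}{\dashrightarrow}$ and $A_2\xrightarrow{m_2}M\xrightarrow{e_2}B_1\overset{y_1^*\delta_2}{\dashrightarrow}$ such that $e_2m_1=x_1$, $e_1m_2=x_2$, $y_2e_1=y_1e_2$ and $(m_1)_*\delta_1+(m_2)_*\delta_2=0$. (ET4-2) For any $\mathbb{E}$-triangle $A\xrightarrow{x}B\xrightarrow{y}C\overset{\delta}{\dashrightarrow}$, any morphism $f:A\to D$, and any $\mathbb{E}$-triangle $D\xrightarrow{d}E\xrightarrow{e}C\overset{f_*\delta}{\dashrightarrow}$ realizing $f_*\delta$, there is $g:B\to E$ such that $(f,g,\mathrm{id}_C)$ is a morphism of $\mathbb{E}$-triangles (so $gx=df$, $eg=y$) and $A\xrightarrow{\binom{-f}{x}}D\oplus B\xrightarrow{(d,\,g)}E\overset{e^*\delta}{\dashrightarrow}$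 is an $\mathbb{E}$-triangle. (ET4-3) For any $\mathbb{E}$-triangles $A\xrightarrow{f}B\xrightarrow{f'}D\overset{\delta_f}{\dashrightarrow}$, $B\xrightarrow{g}C\xrightarrow{g'}F\overset{\delta_g}{\dashrightarrow}$ and $A\xrightarrow{h}C\xrightarrow{h_0}E_0\overset{\delta_h}{\dashrightarrow}$ with $h=gf$, there are morphisms $d_0:D\to E_0$ and $e_0:E_0\to F$ such that $d_0f'=h_0g$, $e_0h_0=g'$, $D\xrightarrow{d_0}E_0\xrightarrow{e_0}F\overset{f'_*\delta_g}{\dashrightarrow}$ is an $\mathbb{E}$-triangle, $d_0^*\delta_h=\delta_f$ and $f_*\delta_h=e_0^*\delta_g$. (ET4-4) For any $\mathbb{E}$-triangles $D\xrightarrow{f}A\xrightarrow{f'}C\overset{\delta_f}{\dashrightarrow}$, $A\xrightarrow{g}B\xrightarrow{g'}F\overset{\delta_g}{\dashrightarrow}$ and $E\xrightarrow{h}B\xrightarrow{h'}C\overset{\delta_h}{\dashrightarrow}$ with $h'g=f'$, there is an $\mathbb{E}$-triangle $D\xrightarrow{d}E\xrightarrow{e}F\overset{\theta}{\dashrightarrow}$ such that $hd=gf$, $g'h=e$, $d_*\delta_f=\delta_h$, $f_*\theta=\delta_g$ and $g'^*\theta+h'^*\delta_f=0$. (ET4-5) For any $\mathbb{E}$-triangles $A_1\xrightarrow{x_1}B_1\xrightarrow{y_1}C\overset{\delta}{\dashrightarrow}$ and $A_2\xrightarrow{x_2}B_2\xrightarrow{y_2}C\overset{\delta'}{\dashrightarrow}$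 and any $g:B_1\to B_2$ with $y_2g=y_1$, there is $f:A_1\to A_2$ such that $(f,g,\mathrm{id}_C)$ is a morphism of $\mathbb{E}$-triangles (so $x_2f=gx_1$, $f_*\delta=\delta'$) and $A_1\xrightarrow{\binom{-f}{x_1}}A_2\oplus B_1\xrightarrow{(x_2,\,g)}B_2\overset{y_2^*\delta}{\dashrightarrow}$ is an $\mathbb{E}$-triangle. **Duals.** The opposite category $\mathscr{C}^{\mathrm{op}}$ is pre-extriangulated with $\mathbb{E}^{\mathrm{op}}(C,A)=\mathbb{E}(A,C)$ and with the realization obtained by reversing arrows: if $\mathfrak{s}(\delta)=[C\to B\to A]$ for $\delta\in\mathbb{E}(A,C)$, then $\mathfrak{s}^{\mathrm{op}}(\delta)=[A\to B\to C]$ in $\mathscr{C}^{\mathrm{op}}$. For a condition $X$, $\mathscr{C}$ satisfies $X^{\mathrm{op}}$ means that $(\mathscr{C}^{\mathrm{op}},\mathbb{E}^{\mathrm{op}},\mathfrak{s}^{\mathrm{op}})$ satisfies $X$. *)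

theory Defs
  imports "HOL-Algebra.AbelCoset"
begin

text \<open>
  Hom-groups and extension groups are abelian groups in the sense of \<^locale>\<open>abelian_group\<close>,
  that is, the additive part of a \<open>ring\<close> record; the multiplicative fields play no role.
  \<open>Ext X C A\<close> is $E(C,A)$ (contravariant argument first), \<open>Emap X c a\<close> is the map $E(c,a)$,
  and \<open>Rlz X C A \<delta>\<close> is the class assigned to an extension \<open>\<delta>\<close> in $E(C,A)$, a set of
  pairs \<open>(x, y)\<close> of composable morphisms from \<open>A\<close> via some object to \<open>C\<close>.
\<close>

record ('o, 'm, 'e) ext_cat =
  Obj :: "'o set"
  Hom :: "'o \<Rightarrow> 'o \<Rightarrow> 'm ring"
  Comp :: "'m \<Rightarrow> 'm \<Rightarrow> 'm"  (infixl \<open>\<cdot>\<index>\<close> 75)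
  Ident :: "'o \<Rightarrow> 'm"
  Ext :: "'o \<Rightarrow> 'o \<Rightarrow> 'e ring"
  Emap :: "'m \<Rightarrow> 'm \<Rightarrow> 'e \<Rightarrow> 'e"
  Rlz :: "'o \<Rightarrow> 'o \<Rightarrow> 'e \<Rightarrow> ('m \<times> 'm) set"

context
  fixes X :: "('o, 'm, 'e) ext_cat"  (structure)
begin

definition arr :: "'m \<Rightarrow> 'o \<Rightarrow> 'o \<Rightarrow> bool" where
  "arr f A B \<longleftrightarrow> A \<in> Obj X \<and> B \<in> Obj X \<and> f \<in> carrier (Hom X A B)"

definition iso_arr :: "'m \<Rightarrow> 'o \<Rightarrow> 'o \<Rightarrow> bool" where
  "iso_arr b B B' \<longleftrightarrow> arr b B B' \<and>
     (\<exists>b'. arr b' B' B \<and> b' \<cdot> b = Ident X B \<and> b \<cdot> b' = Ident X B')"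

definition biproduct :: "'o \<Rightarrow> 'o \<Rightarrow> 'o \<Rightarrow> 'm \<Rightarrow> 'm \<Rightarrow> 'm \<Rightarrow> 'm \<Rightarrow> bool" where
  "biproduct A B P i1 i2 p1 p2 \<longleftrightarrow>
     arr i1 A P \<and> arr i2 B P \<and> arr p1 P A \<and> arr p2 P B \<and>
     p1 \<cdot> i1 = Ident X A \<and> p2 \<cdot> i2 = Ident X B \<and>
     p1 \<cdot> i2 = \<zero>\<^bsub>Hom X B A\<^esub> \<and> p2 \<cdot> i1 = \<zero>\<^bsub>Hom X A B\<^esub> \<and>
     i1 \<cdot> p1 \<oplus>\<^bsub>Hom X P P\<^esub> i2 \<cdot> p2 = Ident X P"

definition zero_object :: "'o \<Rightarrow> bool" where
  "zero_object Z \<longleftrightarrow> Z \<in> Obj X \<and>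
     (\<forall>A \<in> Obj X. carrier (Hom X A Z) = {\<zero>\<^bsub>Hom X A Z\<^esub>} \<and> carrier (Hom X Z A) = {\<zero>\<^bsub>Hom X Z A\<^esub>})"

text \<open>The induced maps \<open>a\<^sub>*\<close> $= E(C,a)$ and \<open>c\<^sup>*\<close> $= E(c,A)$.\<close>

definition push :: "'o \<Rightarrow> 'm \<Rightarrow> 'e \<Rightarrow> 'e" where
  "push C a \<delta> = Emap X (Ident X C) a \<delta>"

definition pull :: "'o \<Rightarrow> 'm \<Rightarrow> 'e \<Rightarrow> 'e" where
  "pull A c \<delta> = Emap X c (Ident X A) \<delta>"

definition ext_morphism ::
  "'o \<Rightarrow> 'o \<Rightarrow> 'e \<Rightarrow> 'o \<Rightarrow> 'o \<Rightarrow> 'e \<Rightarrow> 'm \<Rightarrow> 'm \<Rightarrow> bool" where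
  "ext_morphism A C \<delta> A' C' \<delta>' a c \<longleftrightarrow>
     arr a A A' \<and> arr c C C' \<and> push C a \<delta> = pull A' c \<delta>'"

text \<open>
  The sum of \<open>\<delta>\<close> in $E(C,A)$ and \<open>\<delta>'\<close> in $E(C',A')$ as an element of $E(Q,P)$, where
  \<open>P\<close> is a biproduct of \<open>A, A'\<close> with projections \<open>p, p'\<close> and \<open>Q\<close> a biproduct of \<open>C, C'\<close>
  with injections \<open>j, j'\<close>: the element whose four components are \<open>\<delta>, 0, 0, \<delta>'\<close>.
\<close>

definition ext_sum ::
  "'o \<Rightarrow> 'o \<Rightarrow> 'o \<Rightarrow> 'm \<Rightarrow> 'm \<Rightarrow> 'o \<Rightarrow> 'o \<Rightarrow> 'o \<Rightarrow> 'm \<Rightarrow> 'm \<Rightarrow> 'e \<Rightarrow> 'e \<Rightarrow> 'e" where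
  "ext_sum A A' P p p' C C' Q j j' \<delta> \<delta>' =
     (THE \<epsilon>. \<epsilon> \<in> carrier (Ext X Q P) \<and>
        Emap X j p \<epsilon> = \<delta> \<and> Emap X j p' \<epsilon> = \<zero>\<^bsub>Ext X C A'\<^esub> \<and>
        Emap X j' p \<epsilon> = \<zero>\<^bsub>Ext X C' A\<^esub> \<and> Emap X j' p' \<epsilon> = \<delta>')"

definition sequences :: "'o \<Rightarrow> 'o \<Rightarrow> ('m \<times> 'm) set" where
  "sequences A C = {(x, y). \<exists>B. arr x A B \<and> arr y B C}"

definition seq_equiv :: "'o \<Rightarrow> 'o \<Rightarrow> (('m \<times> 'm) \<times> ('m \<times> 'm)) set" where
  "seq_equiv A C = {((x, y), (x', y')). \<exists>B B' b.
     arr x A B \<and> arr y B C \<and> arr x' A B' \<and> arr y' B' C \<and>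
     iso_arr b B B' \<and> b \<cdot> x = x' \<and> y' \<cdot> b = y}"

definition seq_class :: "'o \<Rightarrow> 'o \<Rightarrow> 'm \<Rightarrow> 'm \<Rightarrow> ('m \<times> 'm) set" where
  "seq_class A C x y = seq_equiv A C `` {(x, y)}"

text \<open>\<open>triangle A x B y C \<delta>\<close>: the sequence \<open>A \<rightarrow> B \<rightarrow> C\<close> given by \<open>x, y\<close> realizes \<open>\<delta>\<close>.\<close>

definition triangle :: "'o \<Rightarrow> 'm \<Rightarrow> 'o \<Rightarrow> 'm \<Rightarrow> 'o \<Rightarrow> 'e \<Rightarrow> bool" where
  "triangle A x B y C \<delta> \<longleftrightarrow>
     arr x A B \<and> arr y B C \<and> \<delta> \<in> carrier (Ext X C A) \<and> Rlz X C A \<delta> = seq_class A C x y"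

definition triangle_morphism ::
  "'o \<Rightarrow> 'm \<Rightarrow> 'o \<Rightarrow> 'm \<Rightarrow> 'o \<Rightarrow> 'e \<Rightarrow> 'o \<Rightarrow> 'm \<Rightarrow> 'o \<Rightarrow> 'm \<Rightarrow> 'o \<Rightarrow> 'e \<Rightarrow> 'm \<Rightarrow> 'm \<Rightarrow> 'm \<Rightarrow> bool" where
  "triangle_morphism A x B y C \<delta> A' x' B' y' C' \<delta>' a b c \<longleftrightarrow>
     triangle A x B y C \<delta> \<and> triangle A' x' B' y' C' \<delta>' \<and>
     arr a A A' \<and> arr b B B' \<and> arr c C C' \<and>
     b \<cdot> x = x' \<cdot> a \<and> y' \<cdot> b = c \<cdot> y \<and> push C a \<delta> = pull A' c \<delta>'"

definition inflation :: "'m \<Rightarrow> bool" where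
  "inflation x \<longleftrightarrow> (\<exists>A B y C \<delta>. triangle A x B y C \<delta>)"

definition deflation :: "'m \<Rightarrow> bool" where
  "deflation y \<longleftrightarrow> (\<exists>A x B C \<delta>. triangle A x B y C \<delta>)"

end

locale additive_category =
  fixes X :: "('o, 'm, 'e) ext_cat"  (structure)
  assumes hom_disjoint: "\<lbrakk>arr X f A B; arr X f A' B'\<rbrakk> \<Longrightarrow> A = A' \<and> B = B'"
    and hom_group: "\<lbrakk>A \<in> Obj X; B \<in> Obj X\<rbrakk> \<Longrightarrow> abelian_group (Hom X A B)"
    and comp_arr: "\<lbrakk>arr X f A B; arr X g B C\<rbrakk> \<Longrightarrow> arr X (g \<cdot> f) A C"
    and comp_assoc: "\<lbrakk>arr X f A B; arr X g B C; arr X h C D\<rbrakk> \<Longrightarrow> h \<cdot> (g \<cdot> f) = (h \<cdot> g) \<cdot> f"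
    and ident_arr: "A \<in> Obj X \<Longrightarrow> arr X (Ident X A) A A"
    and ident_left: "arr X f A B \<Longrightarrow> Ident X B \<cdot> f = f"
    and ident_right: "arr X f A B \<Longrightarrow> f \<cdot> Ident X A = f"
    and comp_add_left: "\<lbrakk>arr X f A B; arr X g B C; arr X g' B C\<rbrakk> \<Longrightarrow>
      (g \<oplus>\<^bsub>Hom X B C\<^esub> g') \<cdot> f = g \<cdot> f \<oplus>\<^bsub>Hom X A C\<^esub> g' \<cdot> f"
    and comp_add_right: "\<lbrakk>arr X f A B; arr X f' A B; arr X g B C\<rbrakk> \<Longrightarrow>
      g \<cdot> (f \<oplus>\<^bsub>Hom X A B\<^esub> f') = g \<cdot> f \<oplus>\<^bsub>Hom X A C\<^esub> g \<cdot> f'"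
    and ex_zero_object: "\<exists>Z. zero_object X Z"
    and ex_biproduct: "\<lbrakk>A \<in> Obj X; B \<in> Obj X\<rbrakk> \<Longrightarrow> \<exists>P i1 i2 p1 p2. biproduct X A B P i1 i2 p1 p2"

locale biadditive_functor = additive_category +
  assumes ext_group: "\<lbrakk>C \<in> Obj X; A \<in> Obj X\<rbrakk> \<Longrightarrow> abelian_group (Ext X C A)"
    and emap_hom: "\<lbrakk>arr X c C' C; arr X a A A'\<rbrakk> \<Longrightarrow>
      abelian_group_hom (Ext X C A) (Ext X C' A') (Emap X c a)"
    and emap_ident: "\<lbrakk>C \<in> Obj X; A \<in> Obj X; \<delta> \<in> carrier (Ext X C A)\<rbrakk> \<Longrightarrow>
      Emap X (Ident X C) (Ident X A) \<delta> = \<delta>"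
    and emap_comp: "\<lbrakk>arr X c' C'' C'; arr X c C' C; arr X a A A'; arr X a' A' A'';
        \<delta> \<in> carrier (Ext X C A)\<rbrakk> \<Longrightarrow>
      Emap X (c \<cdot> c') (a' \<cdot> a) \<delta> = Emap X c' a' (Emap X c a \<delta>)"
    and emap_add_left: "\<lbrakk>arr X c C' C; arr X d C' C; arr X a A A'; \<delta> \<in> carrier (Ext X C A)\<rbrakk> \<Longrightarrow>
      Emap X (c \<oplus>\<^bsub>Hom X C' C\<^esub> d) a \<delta> = Emap X c a \<delta> \<oplus>\<^bsub>Ext X C' A'\<^esub> Emap X d a \<delta>"
    and emap_add_right: "\<lbrakk>arr X c C' C; arr X a A A'; arr X b A A'; \<delta> \<in> carrier (Ext X C A)\<rbrakk> \<Longrightarrow>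
      Emap X c (a \<oplus>\<^bsub>Hom X A A'\<^esub> b) \<delta> = Emap X c a \<delta> \<oplus>\<^bsub>Ext X C' A'\<^esub> Emap X c b \<delta>"

text \<open>
  Direct sums are not part of the data: every clause that mentions a direct sum is stated for
  all biproduct diagrams of the objects concerned.  In \<open>realization_sum\<close> the biproducts
  \<open>P, R, Q\<close> are those of the left, middle and right terms.
\<close>

locale additive_realization = biadditive_functor +
  assumes realization_class: "\<lbrakk>C \<in> Obj X; A \<in> Obj X; \<delta> \<in> carrier (Ext X C A)\<rbrakk> \<Longrightarrow>
      Rlz X C A \<delta> \<in> sequences X A C // seq_equiv X A C"
    and realization_lift: "\<lbrakk>triangle X A x B y C \<delta>; triangle X A' x' B' y' C' \<delta>';
        ext_morphism X A C \<delta> A' C' \<delta>' a c\<rbrakk> \<Longrightarrow>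
      \<exists>b. arr X b B B' \<and> b \<cdot> x = x' \<cdot> a \<and> y' \<cdot> b = c \<cdot> y"
    and realization_zero: "biproduct X A C P i1 i2 p1 p2 \<Longrightarrow>
      Rlz X C A \<zero>\<^bsub>Ext X C A\<^esub> = seq_class X A C i1 p2"
    and realization_sum: "\<lbrakk>triangle X A x B y C \<delta>; triangle X A' x' B' y' C' \<delta>';
        biproduct X A A' P i i' p p'; biproduct X B B' R k k' r r'; biproduct X C C' Q j j' q q'\<rbrakk> \<Longrightarrow>
      Rlz X Q P (ext_sum X A A' P p p' C C' Q j j' \<delta> \<delta>') =
        seq_class X P Q (k \<cdot> x \<cdot> p \<oplus>\<^bsub>Hom X P R\<^esub> k' \<cdot> x' \<cdot> p')
                        (j \<cdot> y \<cdot> r \<oplus>\<^bsub>Hom X R Q\<^esub> j' \<cdot> y' \<cdot> r')"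

locale pre_extriangulated = additive_realization +
  assumes ET3: "\<lbrakk>triangle X A x B y C \<delta>; triangle X A' x' B' y' C' \<delta>';
        arr X a A A'; arr X b B B'; b \<cdot> x = x' \<cdot> a\<rbrakk> \<Longrightarrow>
      \<exists>c. triangle_morphism X A x B y C \<delta> A' x' B' y' C' \<delta>' a b c"
    and ET3_op: "\<lbrakk>triangle X A x B y C \<delta>; triangle X A' x' B' y' C' \<delta>';
        arr X b B B'; arr X c C C'; y' \<cdot> b = c \<cdot> y\<rbrakk> \<Longrightarrow>
      \<exists>a. triangle_morphism X A x B y C \<delta> A' x' B' y' C' \<delta>' a b c"

context
  fixes X :: "('o, 'm, 'e) ext_cat"  (structure)
begin

definition ET0 :: bool where
  "ET0 \<longleftrightarrow> (\<forall>A B C f g. arr X f A B \<and> arr X g B C \<and> inflation X f \<and> inflation X g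
     \<longrightarrow> inflation X (g \<cdot> f))"

definition ET0_op :: bool where
  "ET0_op \<longleftrightarrow> (\<forall>A B C f g. arr X f A B \<and> arr X g B C \<and> deflation X f \<and> deflation X g
     \<longrightarrow> deflation X (g \<cdot> f))"

definition ET4 :: bool where
  "ET4 \<longleftrightarrow> (\<forall>A f B f' D \<delta> g C g' F \<delta>'.
     triangle X A f B f' D \<delta> \<and> triangle X B g C g' F \<delta>' \<longrightarrow>
     (\<exists>E h h' \<delta>'' d e.
        triangle X A h C h' E \<delta>'' \<and> triangle X D d E e F (push X F f' \<delta>') \<and>
        h = g \<cdot> f \<and> d \<cdot> f' = h' \<cdot> g \<and> e \<cdot> h' = g' \<and>
        pull X A d \<delta>'' = \<delta> \<and> push X E f \<delta>'' = pull X B e \<delta>'))"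

definition ET4_1 :: bool where
  "ET4_1 \<longleftrightarrow> (\<forall>A1 x1 B1 y1 C \<delta>1 A2 x2 B2 y2 \<delta>2.
     triangle X A1 x1 B1 y1 C \<delta>1 \<and> triangle X A2 x2 B2 y2 C \<delta>2 \<longrightarrow>
     (\<exists>M m1 e1 m2 e2.
        triangle X A1 m1 M e1 B2 (pull X A1 y2 \<delta>1) \<and>
        triangle X A2 m2 M e2 B1 (pull X A2 y1 \<delta>2) \<and>
        e2 \<cdot> m1 = x1 \<and> e1 \<cdot> m2 = x2 \<and> y2 \<cdot> e1 = y1 \<cdot> e2 \<and>
        push X C m1 \<delta>1 \<oplus>\<^bsub>Ext X C M\<^esub> push X C m2 \<delta>2 = \<zero>\<^bsub>Ext X C M\<^esub>))"

definition ET4_2 :: bool where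
  "ET4_2 \<longleftrightarrow> (\<forall>A x B y C \<delta> f D d E e.
     triangle X A x B y C \<delta> \<and> arr X f A D \<and> triangle X D d E e C (push X C f \<delta>) \<longrightarrow>
     (\<exists>g. triangle_morphism X A x B y C \<delta> D d E e C (push X C f \<delta>) f g (Ident X C) \<and>
        (\<forall>P i1 i2 p1 p2. biproduct X D B P i1 i2 p1 p2 \<longrightarrow>
           triangle X A (i1 \<cdot> (\<ominus>\<^bsub>Hom X A D\<^esub> f) \<oplus>\<^bsub>Hom X A P\<^esub> i2 \<cdot> x)
                    P (d \<cdot> p1 \<oplus>\<^bsub>Hom X P E\<^esub> g \<cdot> p2) E (pull X A e \<delta>))))"

definition ET4_3 :: bool where
  "ET4_3 \<longleftrightarrow> (\<forall>A f B f' D \<delta>f g C g' F \<delta>g h h0 E0 \<delta>h.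
     triangle X A f B f' D \<delta>f \<and> triangle X B g C g' F \<delta>g \<and> triangle X A h C h0 E0 \<delta>h \<and>
     h = g \<cdot> f \<longrightarrow>
     (\<exists>d0 e0. arr X d0 D E0 \<and> arr X e0 E0 F \<and> d0 \<cdot> f' = h0 \<cdot> g \<and> e0 \<cdot> h0 = g' \<and>
        triangle X D d0 E0 e0 F (push X F f' \<delta>g) \<and>
        pull X A d0 \<delta>h = \<delta>f \<and> push X E0 f \<delta>h = pull X B e0 \<delta>g))"

definition ET4_4 :: bool where
  "ET4_4 \<longleftrightarrow> (\<forall>D f A f' C \<delta>f g B g' F \<delta>g E h h' \<delta>h.
     triangle X D f A f' C \<delta>f \<and> triangle X A g B g' F \<delta>g \<and> triangle X E h B h' C \<delta>h \<and>
     h' \<cdot> g = f' \<longrightarrow>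
     (\<exists>d e \<theta>. triangle X D d E e F \<theta> \<and> h \<cdot> d = g \<cdot> f \<and> g' \<cdot> h = e \<and>
        push X C d \<delta>f = \<delta>h \<and> push X F f \<theta> = \<delta>g \<and>
        pull X D g' \<theta> \<oplus>\<^bsub>Ext X B D\<^esub> pull X D h' \<delta>f = \<zero>\<^bsub>Ext X B D\<^esub>))"

definition ET4_5 :: bool where
  "ET4_5 \<longleftrightarrow> (\<forall>A1 x1 B1 y1 C \<delta> A2 x2 B2 y2 \<delta>' g.
     triangle X A1 x1 B1 y1 C \<delta> \<and> triangle X A2 x2 B2 y2 C \<delta>' \<and> arr X g B1 B2 \<and>
     y2 \<cdot> g = y1 \<longrightarrow>
     (\<exists>f. triangle_morphism X A1 x1 B1 y1 C \<delta> A2 x2 B2 y2 C \<delta>' f g (Ident X C) \<and>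
        (\<forall>P i1 i2 p1 p2. biproduct X A2 B1 P i1 i2 p1 p2 \<longrightarrow>
           triangle X A1 (i1 \<cdot> (\<ominus>\<^bsub>Hom X A1 A2\<^esub> f) \<oplus>\<^bsub>Hom X A1 P\<^esub> i2 \<cdot> x1)
                    P (x2 \<cdot> p1 \<oplus>\<^bsub>Hom X P B2\<^esub> g \<cdot> p2) B2 (pull X A1 y2 \<delta>))))"

end

text \<open>In the realization, reversing arrows swaps the two components of each pair.\<close>

definition opposite :: "('o, 'm, 'e) ext_cat \<Rightarrow> ('o, 'm, 'e) ext_cat" where
  "opposite X =
     \<lparr> Obj = Obj X,
       Hom = (\<lambda>A B. Hom X B A),
       Comp = (\<lambda>g f. f \<cdot>\<^bsub>X\<^esub> g),
       Ident = Ident X,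
       Ext = (\<lambda>C A. Ext X A C),
       Emap = (\<lambda>c a. Emap X a c),
       Rlz = (\<lambda>C A \<delta>. (Rlz X A C \<delta>)\<inverse>) \<rparr>"

end

theory Submission
  imports Defs
begin

text \<open>
  The implications close up into a cycle that passes through the opposite category, so that
  equivalence and self-duality come out together.  For every \<open>X\<close> satisfying the hypotheses,
  \<open>ET4 \<Longrightarrow> ET4_1 \<Longrightarrow> ET4_5 \<longleftrightarrow> ET4_2\<close>, and \<open>ET4_5\<close> for \<open>X\<close> implies \<open>ET4\<close> for \<open>opposite X\<close>.  As
  \<open>opposite X\<close> is again pre-extriangulated with \<open>ET0\<close> and \<open>ET0_op\<close> interchanged, going round twice
  leads back to \<open>ET4\<close> for \<open>X\<close>.  \<open>ET4_3\<close> is \<open>ET4\<close> for a given third triangle, and the choice is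
  immaterial because the cone of an inflation is unique (\<open>cone_unique\<close>).  \<open>ET4_4\<close> follows from
  octahedra in \<open>X\<close> and in \<open>opposite X\<close>, and it implies \<open>ET4_2\<close> for \<open>opposite X\<close>.

  The tool throughout is the weak exactness of triangles: (ET3) and its dual, applied to a triangle
  and to one of \<open>A = A \<rightarrow> 0\<close> and \<open>0 \<rightarrow> A = A\<close>, produce factorizations, without uniqueness.
  Isomorphisms therefore do not come from universal properties.  They come from pairs of opposite
  maps \<open>b\<close>, \<open>c\<close> for which \<open>1 - c b\<close> and \<open>1 - b c\<close> have square zero (\<open>iso_if_square_zero\<close>),
  which is the case as soon as both maps are compatible with a weakly exact sequence
  (\<open>triangle_recognition\<close>, \<open>cone_unique\<close>).

  The ideas behind the single implications are as follows.

  \<^item> Octahedra give pullbacks.  Realize \<open>i1\<^sub>* \<delta>1 + i2\<^sub>* \<delta>2\<close> by \<open>A1 \<oplus> A2 \<rightarrow> M \<rightarrow> C\<close>; the octahedra over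
    the two summands exhibit \<open>M\<close> as an extension of \<open>B2\<close> by \<open>A1\<close> and of \<open>B1\<close> by \<open>A2\<close>.

  \<^item> Pullbacks give homotopy cartesian squares.  A map \<open>g: B1 \<rightarrow> B2\<close> over \<open>C\<close> lifts to a section of
    \<open>M \<rightarrow> B1\<close>, so that \<open>M\<close> is a direct sum of \<open>A2\<close> and \<open>B1\<close>, and \<open>A1 \<rightarrow> M \<rightarrow> B2\<close> is the triangle
    sought.  \<open>ET4_2\<close> and \<open>ET4_5\<close> differ only in which of the two sides of the square is given; one
    passes between them by a shear of the biproduct (\<open>triangle_shear\<close>).

  \<^item> Homotopy cartesian squares give octahedra of deflations.  For \<open>g: C \<rightarrow> B\<close> and \<open>f: B \<rightarrow> A\<close>,
    \<open>ET4_5\<close> for \<open>g\<close> over \<open>A\<close> gives a deflation \<open>D \<oplus> C \<rightarrow> B\<close> with kernel \<open>E\<close>, and \<open>ET4_5\<close>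
    for \<open>C \<rightarrow> D \<oplus> C\<close> over \<open>B\<close> gives \<open>F \<rightarrow> E \<oplus> C \<rightarrow> D \<oplus> C\<close>.  After a shear the summand \<open>C\<close> is mapped
    identically and can be cancelled (\<open>triangle_cancel_summand\<close>), which leaves \<open>F \<rightarrow> E \<rightarrow> D\<close>.

  \<^item> Octahedra in \<open>X\<close> and \<open>opposite X\<close> give \<open>ET4_4\<close>.  The cone of \<open>g f\<close> is a direct sum of \<open>C\<close> and
    \<open>F\<close> since \<open>f'\<close> extends along \<open>g\<close>; the dual octahedron for \<open>B \<rightarrow> C \<oplus> F \<rightarrow> C\<close> does the rest.

  \<^item> \<open>ET4_4\<close> gives the dual of \<open>ET4_2\<close>.  For \<open>f: D \<rightarrow> C\<close> and a deflation \<open>y: B \<rightarrow> C\<close>, the map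
    \<open>(-f, y): D \<oplus> B \<rightarrow> C\<close> is a composite of deflations and restricts to \<open>y\<close> on \<open>B\<close>.
\<close>

section \<open>Typed arithmetic of morphisms\<close>

context additive_category
begin

text \<open>
  A morphism determines its ends.  With functions for the two ends, the typing conditions of the
  category axioms contain no objects that would have to be guessed, and rewriting can solve them.
\<close>

definition Arr :: "'m \<Rightarrow> bool" where
  "Arr f \<longleftrightarrow> (\<exists>A B. arr X f A B)"

definition src :: "'m \<Rightarrow> 'o" where
  "src f = (THE A. \<exists>B. arr X f A B)"

definition tgt :: "'m \<Rightarrow> 'o" where
  "tgt f = (THE B. \<exists>A. arr X f A B)"

lemma arr_iff [simp]: "arr X f A B \<longleftrightarrow> Arr f \<and> src f = A \<and> tgt f = B"
proof -
  have "src f = A \<and> tgt f = B" if "arr X f A B" for A B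
    using that hom_disjoint unfolding src_def tgt_def by (blast intro: the_equality)
  then show ?thesis unfolding Arr_def by metis
qed

lemma arrI: "Arr f \<Longrightarrow> arr X f (src f) (tgt f)"
  by simp

lemma obj_src_tgt [simp]: "Arr f \<Longrightarrow> src f \<in> Obj X" "Arr f \<Longrightarrow> tgt f \<in> Obj X"
  using arrI arr_def by metis+

lemma arrD: "arr X f A B \<Longrightarrow> Arr f \<and> src f = A \<and> tgt f = B \<and> A \<in> Obj X \<and> B \<in> Obj X"
  by auto

lemma in_hom_iff: "\<lbrakk>A \<in> Obj X; B \<in> Obj X\<rbrakk> \<Longrightarrow> f \<in> carrier (Hom X A B) \<longleftrightarrow> Arr f \<and> src f = A \<and> tgt f = B"
  using arr_iff unfolding arr_def by blast

lemma in_hom [simp]: "Arr f \<Longrightarrow> src f = A \<Longrightarrow> tgt f = B \<Longrightarrow> f \<in> carrier (Hom X A B)"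
  using in_hom_iff by auto

lemma ident_simps [simp]:
  assumes "A \<in> Obj X"
  shows "Arr (Ident X A)" "src (Ident X A) = A" "tgt (Ident X A) = A"
  using ident_arr[OF assms] by simp_all

lemma comp_simps [simp]:
  assumes "Arr f" "Arr g" "tgt f = src g"
  shows "Arr (g \<cdot> f)" "src (g \<cdot> f) = src f" "tgt (g \<cdot> f) = tgt g"
  using comp_arr[of f "src f" "tgt f" g "tgt g"] assms by simp_all

lemma comp_assoc' [simp]:
  "\<lbrakk>Arr f; Arr g; Arr h; tgt f = src g; tgt g = src h\<rbrakk> \<Longrightarrow> (h \<cdot> g) \<cdot> f = h \<cdot> (g \<cdot> f)"
  using comp_assoc[of f "src f" "tgt f" g "tgt g" h "tgt h"] by simp

lemma comp_reassoc:
  "\<lbrakk>g \<cdot> f = k; Arr f; Arr g; Arr w; tgt f = src g; tgt w = src f\<rbrakk> \<Longrightarrow> g \<cdot> (f \<cdot> w) = k \<cdot> w"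
  using comp_assoc'[of w f g] by simp

lemma ident_comp [simp]:
  "\<lbrakk>Arr f; tgt f = B\<rbrakk> \<Longrightarrow> Ident X B \<cdot> f = f"
  "\<lbrakk>Arr f; src f = A\<rbrakk> \<Longrightarrow> f \<cdot> Ident X A = f"
  using ident_left[of f "src f" "tgt f"] ident_right[of f "src f" "tgt f"] by auto

lemma hom_add_simps [simp]:
  assumes "Arr f" "Arr g" "src f = A" "tgt f = B" "src g = A" "tgt g = B"
  shows "Arr (f \<oplus>\<^bsub>Hom X A B\<^esub> g)" "src (f \<oplus>\<^bsub>Hom X A B\<^esub> g) = A" "tgt (f \<oplus>\<^bsub>Hom X A B\<^esub> g) = B"
proof -
  have ob: "A \<in> Obj X" "B \<in> Obj X" using assms by auto
  interpret abelian_group "Hom X A B" using hom_group ob .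
  show "Arr (f \<oplus>\<^bsub>Hom X A B\<^esub> g)" "src (f \<oplus>\<^bsub>Hom X A B\<^esub> g) = A" "tgt (f \<oplus>\<^bsub>Hom X A B\<^esub> g) = B"
    using a_closed[of f g] assms ob by (simp_all add: in_hom_iff)
qed

lemma hom_zero_simps [simp]:
  assumes "A \<in> Obj X" "B \<in> Obj X"
  shows "Arr \<zero>\<^bsub>Hom X A B\<^esub>" "src \<zero>\<^bsub>Hom X A B\<^esub> = A" "tgt \<zero>\<^bsub>Hom X A B\<^esub> = B"
proof -
  interpret abelian_group "Hom X A B" using hom_group assms .
  show "Arr \<zero>\<^bsub>Hom X A B\<^esub>" "src \<zero>\<^bsub>Hom X A B\<^esub> = A" "tgt \<zero>\<^bsub>Hom X A B\<^esub> = B"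
    using zero_closed assms by (simp_all only: in_hom_iff)
qed

lemma hom_neg_simps [simp]:
  assumes "Arr f" "src f = A" "tgt f = B"
  shows "Arr (\<ominus>\<^bsub>Hom X A B\<^esub> f)" "src (\<ominus>\<^bsub>Hom X A B\<^esub> f) = A" "tgt (\<ominus>\<^bsub>Hom X A B\<^esub> f) = B"
proof -
  have ob: "A \<in> Obj X" "B \<in> Obj X" using assms by auto
  interpret abelian_group "Hom X A B" using hom_group ob .
  show "Arr (\<ominus>\<^bsub>Hom X A B\<^esub> f)" "src (\<ominus>\<^bsub>Hom X A B\<^esub> f) = A" "tgt (\<ominus>\<^bsub>Hom X A B\<^esub> f) = B"
    using a_inv_closed[of f] assms ob by (simp_all add: in_hom_iff)
qed

lemma hom_add_comm:
  assumes "Arr f" "Arr g" "src f = A" "tgt f = B" "src g = A" "tgt g = B"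
  shows "f \<oplus>\<^bsub>Hom X A B\<^esub> g = g \<oplus>\<^bsub>Hom X A B\<^esub> f"
proof -
  have "A \<in> Obj X" "B \<in> Obj X" using assms by auto
  then interpret abelian_group "Hom X A B" using hom_group by blast
  show ?thesis using a_comm[of f g] assms by simp
qed

lemma hom_add_assoc [simp]:
  assumes "Arr f" "Arr g" "Arr h" "src f = A" "tgt f = B" "src g = A" "tgt g = B" "src h = A" "tgt h = B"
  shows "f \<oplus>\<^bsub>Hom X A B\<^esub> g \<oplus>\<^bsub>Hom X A B\<^esub> h = f \<oplus>\<^bsub>Hom X A B\<^esub> (g \<oplus>\<^bsub>Hom X A B\<^esub> h)"
proof -
  have "A \<in> Obj X" "B \<in> Obj X" using assms by auto
  then interpret abelian_group "Hom X A B" using hom_group by blast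
  show ?thesis using a_assoc[of f g h] assms by simp
qed

lemma hom_add_lcomm:
  assumes "Arr f" "Arr g" "Arr h" "src f = A" "tgt f = B" "src g = A" "tgt g = B" "src h = A" "tgt h = B"
  shows "f \<oplus>\<^bsub>Hom X A B\<^esub> (g \<oplus>\<^bsub>Hom X A B\<^esub> h) = g \<oplus>\<^bsub>Hom X A B\<^esub> (f \<oplus>\<^bsub>Hom X A B\<^esub> h)"
proof -
  have "A \<in> Obj X" "B \<in> Obj X" using assms by auto
  then interpret abelian_group "Hom X A B" using hom_group by blast
  show ?thesis using a_lcomm[of f g h] assms by simp
qed

lemmas hom_add_ac = hom_add_comm hom_add_lcomm

lemma hom_group_laws [simp]:
  assumes "Arr f" "src f = A" "tgt f = B"
  shows "f \<oplus>\<^bsub>Hom X A B\<^esub> \<zero>\<^bsub>Hom X A B\<^esub> = f" "\<zero>\<^bsub>Hom X A B\<^esub> \<oplus>\<^bsub>Hom X A B\<^esub> f = f"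
    "f \<oplus>\<^bsub>Hom X A B\<^esub> \<ominus>\<^bsub>Hom X A B\<^esub> f = \<zero>\<^bsub>Hom X A B\<^esub>"
    "\<ominus>\<^bsub>Hom X A B\<^esub> f \<oplus>\<^bsub>Hom X A B\<^esub> f = \<zero>\<^bsub>Hom X A B\<^esub>"
    "\<ominus>\<^bsub>Hom X A B\<^esub> (\<ominus>\<^bsub>Hom X A B\<^esub> f) = f"
proof -
  have ob: "A \<in> Obj X" "B \<in> Obj X" using assms by auto
  interpret abelian_group "Hom X A B" using hom_group ob .
  have f: "f \<in> carrier (Hom X A B)" using assms by simp
  show "f \<oplus>\<^bsub>Hom X A B\<^esub> \<zero>\<^bsub>Hom X A B\<^esub> = f" "\<zero>\<^bsub>Hom X A B\<^esub> \<oplus>\<^bsub>Hom X A B\<^esub> f = f"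
    "f \<oplus>\<^bsub>Hom X A B\<^esub> \<ominus>\<^bsub>Hom X A B\<^esub> f = \<zero>\<^bsub>Hom X A B\<^esub>"
    "\<ominus>\<^bsub>Hom X A B\<^esub> f \<oplus>\<^bsub>Hom X A B\<^esub> f = \<zero>\<^bsub>Hom X A B\<^esub>"
    "\<ominus>\<^bsub>Hom X A B\<^esub> (\<ominus>\<^bsub>Hom X A B\<^esub> f) = f"
    using f r_neg l_neg minus_minus by simp_all
qed

lemma hom_group_laws2 [simp]:
  assumes "Arr f" "src f = A" "tgt f = B" "Arr g" "src g = A" "tgt g = B"
  shows "f \<oplus>\<^bsub>Hom X A B\<^esub> (\<ominus>\<^bsub>Hom X A B\<^esub> f \<oplus>\<^bsub>Hom X A B\<^esub> g) = g"
    "\<ominus>\<^bsub>Hom X A B\<^esub> f \<oplus>\<^bsub>Hom X A B\<^esub> (f \<oplus>\<^bsub>Hom X A B\<^esub> g) = g"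
    "\<ominus>\<^bsub>Hom X A B\<^esub> (f \<oplus>\<^bsub>Hom X A B\<^esub> g) = \<ominus>\<^bsub>Hom X A B\<^esub> f \<oplus>\<^bsub>Hom X A B\<^esub> \<ominus>\<^bsub>Hom X A B\<^esub> g"
proof -
  have ob: "A \<in> Obj X" "B \<in> Obj X" using assms by auto
  interpret abelian_group "Hom X A B" using hom_group ob .
  have f: "f \<in> carrier (Hom X A B)" "g \<in> carrier (Hom X A B)" using assms by simp_all
  show "f \<oplus>\<^bsub>Hom X A B\<^esub> (\<ominus>\<^bsub>Hom X A B\<^esub> f \<oplus>\<^bsub>Hom X A B\<^esub> g) = g"
    "\<ominus>\<^bsub>Hom X A B\<^esub> f \<oplus>\<^bsub>Hom X A B\<^esub> (f \<oplus>\<^bsub>Hom X A B\<^esub> g) = g"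
    "\<ominus>\<^bsub>Hom X A B\<^esub> (f \<oplus>\<^bsub>Hom X A B\<^esub> g) = \<ominus>\<^bsub>Hom X A B\<^esub> f \<oplus>\<^bsub>Hom X A B\<^esub> \<ominus>\<^bsub>Hom X A B\<^esub> g"
    using f r_neg1 r_neg2 minus_add by simp_all
qed

lemma hom_neg_zero [simp]:
  assumes "A \<in> Obj X" "B \<in> Obj X"
  shows "\<ominus>\<^bsub>Hom X A B\<^esub> \<zero>\<^bsub>Hom X A B\<^esub> = \<zero>\<^bsub>Hom X A B\<^esub>"
proof -
  interpret abelian_group "Hom X A B" using hom_group assms by blast
  show ?thesis by simp
qed

lemma hom_add_cancel:
  fixes f g h A B
  assumes "f \<oplus>\<^bsub>Hom X A B\<^esub> h = g \<oplus>\<^bsub>Hom X A B\<^esub> h"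
    "Arr f" "Arr g" "Arr h" "src f = A" "tgt f = B" "src g = A" "tgt g = B" "src h = A" "tgt h = B"
  shows "f = g"
proof -
  have "A \<in> Obj X" "B \<in> Obj X" using assms by auto
  then interpret abelian_group "Hom X A B" using hom_group by blast
  show ?thesis using add.right_cancel[of h f g] assms by simp
qed

lemma hom_diff_zero:
  assumes "f \<oplus>\<^bsub>Hom X A B\<^esub> \<ominus>\<^bsub>Hom X A B\<^esub> g = \<zero>\<^bsub>Hom X A B\<^esub>"
    "Arr f" "Arr g" "src f = A" "tgt f = B" "src g = A" "tgt g = B"
  shows "f = g"
  using hom_add_cancel[where h="\<ominus>\<^bsub>Hom X A B\<^esub> g" and f=f and g=g and A=A and B=B] assms by simp

lemma hom_diff_eq:
  assumes "f \<oplus>\<^bsub>Hom X A B\<^esub> \<ominus>\<^bsub>Hom X A B\<^esub> g = w" "Arr f" "Arr g" "src f = A" "tgt f = B" "src g = A" "tgt g = B"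
  shows "f = g \<oplus>\<^bsub>Hom X A B\<^esub> w"
  unfolding assms(1)[symmetric] using assms(2-) hom_add_lcomm[of g f "\<ominus>\<^bsub>Hom X A B\<^esub> g" A B] by simp

lemma comp_add [simp]:
  "\<lbrakk>Arr f; Arr g; Arr g'; src g = B; src g' = B; tgt g = C; tgt g' = C; tgt f = B\<rbrakk> \<Longrightarrow>
    (g \<oplus>\<^bsub>Hom X B C\<^esub> g') \<cdot> f = g \<cdot> f \<oplus>\<^bsub>Hom X (src f) C\<^esub> g' \<cdot> f"
  "\<lbrakk>Arr g; Arr f; Arr f'; src f = A; src f' = A; tgt f = B; tgt f' = B; src g = B\<rbrakk> \<Longrightarrow>
    g \<cdot> (f \<oplus>\<^bsub>Hom X A B\<^esub> f') = g \<cdot> f \<oplus>\<^bsub>Hom X A (tgt g)\<^esub> g \<cdot> f'"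
  using comp_add_left[of f "src f" B g C g'] comp_add_right[of f A B f' g "tgt g"] by auto

lemma comp_zero [simp]:
  assumes "Arr f" "C \<in> Obj X"
  shows "tgt f = B \<Longrightarrow> \<zero>\<^bsub>Hom X B C\<^esub> \<cdot> f = \<zero>\<^bsub>Hom X (src f) C\<^esub>"
    "src f = B \<Longrightarrow> f \<cdot> \<zero>\<^bsub>Hom X C B\<^esub> = \<zero>\<^bsub>Hom X C (tgt f)\<^esub>"
proof -
  assume B: "tgt f = B"
  then have ob: "B \<in> Obj X" "src f \<in> Obj X" using assms by auto
  let ?z = "\<zero>\<^bsub>Hom X B C\<^esub>"
  have z: "?z \<oplus>\<^bsub>Hom X B C\<^esub> ?z = ?z" using ob assms by simp
  have "?z \<cdot> f \<oplus>\<^bsub>Hom X (src f) C\<^esub> ?z \<cdot> f = ?z \<cdot> f"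
    using comp_add(1)[of f ?z ?z B C] z ob assms B by simp
  then show "?z \<cdot> f = \<zero>\<^bsub>Hom X (src f) C\<^esub>"
    using hom_add_cancel[where A="src f" and B=C and f="?z \<cdot> f" and h="?z \<cdot> f" and g="\<zero>\<^bsub>Hom X (src f) C\<^esub>"] ob assms B by simp
next
  assume B: "src f = B"
  then have ob: "B \<in> Obj X" "tgt f \<in> Obj X" using assms by auto
  let ?z = "\<zero>\<^bsub>Hom X C B\<^esub>"
  have z: "?z \<oplus>\<^bsub>Hom X C B\<^esub> ?z = ?z" using ob assms by simp
  have "f \<cdot> ?z \<oplus>\<^bsub>Hom X C (tgt f)\<^esub> f \<cdot> ?z = f \<cdot> ?z"
    using comp_add(2)[of f ?z ?z C B] z ob assms B by simp
  then show "f \<cdot> ?z = \<zero>\<^bsub>Hom X C (tgt f)\<^esub>"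
    using hom_add_cancel[where A=C and B="tgt f" and f="f \<cdot> ?z" and h="f \<cdot> ?z" and g="\<zero>\<^bsub>Hom X C (tgt f)\<^esub>"] ob assms B by simp
qed

lemma comp_neg [simp]:
  "\<lbrakk>Arr f; Arr g; src g = B; tgt g = C; tgt f = B\<rbrakk> \<Longrightarrow>
    (\<ominus>\<^bsub>Hom X B C\<^esub> g) \<cdot> f = \<ominus>\<^bsub>Hom X (src f) C\<^esub> (g \<cdot> f)"
  "\<lbrakk>Arr g; Arr f; src f = A; tgt f = B; src g = B\<rbrakk> \<Longrightarrow>
    g \<cdot> (\<ominus>\<^bsub>Hom X A B\<^esub> f) = \<ominus>\<^bsub>Hom X A (tgt g)\<^esub> (g \<cdot> f)"
proof -
  assume a: "Arr f" "Arr g" "src g = B" "tgt g = C" "tgt f = B"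
  then have ob: "B \<in> Obj X" "src f \<in> Obj X" "C \<in> Obj X" by auto
  have "(\<ominus>\<^bsub>Hom X B C\<^esub> g) \<cdot> f \<oplus>\<^bsub>Hom X (src f) C\<^esub> g \<cdot> f = \<zero>\<^bsub>Hom X (src f) C\<^esub>"
    using comp_add(1)[of f "\<ominus>\<^bsub>Hom X B C\<^esub> g" g B C] a ob by simp
  then show "(\<ominus>\<^bsub>Hom X B C\<^esub> g) \<cdot> f = \<ominus>\<^bsub>Hom X (src f) C\<^esub> (g \<cdot> f)"
    using hom_diff_zero[where f="(\<ominus>\<^bsub>Hom X B C\<^esub> g) \<cdot> f" and A="src f" and B=C and g="\<ominus>\<^bsub>Hom X (src f) C\<^esub> (g \<cdot> f)"] a ob by simp
next
  assume a: "Arr g" "Arr f" "src f = A" "tgt f = B" "src g = B"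
  then have ob: "B \<in> Obj X" "tgt g \<in> Obj X" "A \<in> Obj X" by auto
  have "g \<cdot> (\<ominus>\<^bsub>Hom X A B\<^esub> f) \<oplus>\<^bsub>Hom X A (tgt g)\<^esub> g \<cdot> f = \<zero>\<^bsub>Hom X A (tgt g)\<^esub>"
    using comp_add(2)[of g "\<ominus>\<^bsub>Hom X A B\<^esub> f" f A B] a ob by simp
  then show "g \<cdot> (\<ominus>\<^bsub>Hom X A B\<^esub> f) = \<ominus>\<^bsub>Hom X A (tgt g)\<^esub> (g \<cdot> f)"
    using hom_diff_zero[where f="g \<cdot> (\<ominus>\<^bsub>Hom X A B\<^esub> f)" and A=A and B="tgt g" and g="\<ominus>\<^bsub>Hom X A (tgt g)\<^esub> (g \<cdot> f)"] a ob by simp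
qed

end

section \<open>Biproducts\<close>

context additive_category
begin

lemma biproductD:
  assumes "biproduct X A B P i1 i2 p1 p2"
  shows "arr X i1 A P" "arr X i2 B P" "arr X p1 P A" "arr X p2 P B"
    "A \<in> Obj X" "B \<in> Obj X" "P \<in> Obj X"
    "p1 \<cdot> i1 = Ident X A" "p2 \<cdot> i2 = Ident X B"
    "p1 \<cdot> i2 = \<zero>\<^bsub>Hom X B A\<^esub>" "p2 \<cdot> i1 = \<zero>\<^bsub>Hom X A B\<^esub>"
    "i1 \<cdot> p1 \<oplus>\<^bsub>Hom X P P\<^esub> i2 \<cdot> p2 = Ident X P"
  using assms unfolding biproduct_def by auto

lemma biproduct_simps:
  assumes "biproduct X A B P i1 i2 p1 p2"
  shows "Arr i1" "src i1 = A" "tgt i1 = P" "Arr i2" "src i2 = B" "tgt i2 = P"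
    "Arr p1" "src p1 = P" "tgt p1 = A" "Arr p2" "src p2 = P" "tgt p2 = B"
    "A \<in> Obj X" "B \<in> Obj X" "P \<in> Obj X"
    "p1 \<cdot> i1 = Ident X A" "p2 \<cdot> i2 = Ident X B"
    "p1 \<cdot> i2 = \<zero>\<^bsub>Hom X B A\<^esub>" "p2 \<cdot> i1 = \<zero>\<^bsub>Hom X A B\<^esub>"
    "i1 \<cdot> p1 \<oplus>\<^bsub>Hom X P P\<^esub> i2 \<cdot> p2 = Ident X P"
    "\<And>w. \<lbrakk>Arr w; tgt w = A\<rbrakk> \<Longrightarrow> p1 \<cdot> (i1 \<cdot> w) = w"
    "\<And>w. \<lbrakk>Arr w; tgt w = B\<rbrakk> \<Longrightarrow> p2 \<cdot> (i2 \<cdot> w) = w"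
    "\<And>w. \<lbrakk>Arr w; tgt w = B\<rbrakk> \<Longrightarrow> p1 \<cdot> (i2 \<cdot> w) = \<zero>\<^bsub>Hom X (src w) A\<^esub>"
    "\<And>w. \<lbrakk>Arr w; tgt w = A\<rbrakk> \<Longrightarrow> p2 \<cdot> (i1 \<cdot> w) = \<zero>\<^bsub>Hom X (src w) B\<^esub>"
proof -
  note b = biproductD[OF assms]
  note [simp] = b(1-4)[THEN arrD] b(5-)
  show "Arr i1" "src i1 = A" "tgt i1 = P" "Arr i2" "src i2 = B" "tgt i2 = P"
    "Arr p1" "src p1 = P" "tgt p1 = A" "Arr p2" "src p2 = P" "tgt p2 = B"
    "A \<in> Obj X" "B \<in> Obj X" "P \<in> Obj X"
    "p1 \<cdot> i1 = Ident X A" "p2 \<cdot> i2 = Ident X B"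
    "p1 \<cdot> i2 = \<zero>\<^bsub>Hom X B A\<^esub>" "p2 \<cdot> i1 = \<zero>\<^bsub>Hom X A B\<^esub>"
    "i1 \<cdot> p1 \<oplus>\<^bsub>Hom X P P\<^esub> i2 \<cdot> p2 = Ident X P" by simp_all
  show "\<And>w. \<lbrakk>Arr w; tgt w = A\<rbrakk> \<Longrightarrow> p1 \<cdot> (i1 \<cdot> w) = w"
    "\<And>w. \<lbrakk>Arr w; tgt w = B\<rbrakk> \<Longrightarrow> p2 \<cdot> (i2 \<cdot> w) = w"
    "\<And>w. \<lbrakk>Arr w; tgt w = B\<rbrakk> \<Longrightarrow> p1 \<cdot> (i2 \<cdot> w) = \<zero>\<^bsub>Hom X (src w) A\<^esub>"
    "\<And>w. \<lbrakk>Arr w; tgt w = A\<rbrakk> \<Longrightarrow> p2 \<cdot> (i1 \<cdot> w) = \<zero>\<^bsub>Hom X (src w) B\<^esub>"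
    by (simp_all add: comp_reassoc[OF b(8)] comp_reassoc[OF b(9)] comp_reassoc[OF b(10)]
        comp_reassoc[OF b(11)])
qed

lemma biproduct_decompose:
  assumes "biproduct X A B P i1 i2 p1 p2"
  shows "\<lbrakk>Arr w; tgt w = P\<rbrakk> \<Longrightarrow> w = i1 \<cdot> (p1 \<cdot> w) \<oplus>\<^bsub>Hom X (src w) P\<^esub> i2 \<cdot> (p2 \<cdot> w)"
    "\<lbrakk>Arr w; src w = P\<rbrakk> \<Longrightarrow> w = (w \<cdot> i1) \<cdot> p1 \<oplus>\<^bsub>Hom X P (tgt w)\<^esub> (w \<cdot> i2) \<cdot> p2"
proof -
  note [simp] = biproduct_simps[OF assms]
  show "w = i1 \<cdot> (p1 \<cdot> w) \<oplus>\<^bsub>Hom X (src w) P\<^esub> i2 \<cdot> (p2 \<cdot> w)" if "Arr w" "tgt w = P"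
    using comp_add(1)[of w "i1 \<cdot> p1" "i2 \<cdot> p2" P P] that by simp
  show "w = (w \<cdot> i1) \<cdot> p1 \<oplus>\<^bsub>Hom X P (tgt w)\<^esub> (w \<cdot> i2) \<cdot> p2" if "Arr w" "src w = P"
    using comp_add(2)[of w "i1 \<cdot> p1" "i2 \<cdot> p2" P P] that by simp
qed

lemma biproduct_eqI_from:
  assumes "biproduct X A B P i1 i2 p1 p2" "Arr f" "Arr g" "src f = P" "src g = P" "tgt f = tgt g"
    "f \<cdot> i1 = g \<cdot> i1" "f \<cdot> i2 = g \<cdot> i2"
  shows "f = g"
  using biproduct_decompose(2)[OF assms(1), of f] biproduct_decompose(2)[OF assms(1), of g] assms by simp

lemma biproduct_swap:
  assumes "biproduct X A B P i1 i2 p1 p2"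
  shows "biproduct X B A P i2 i1 p2 p1"
proof -
  note [simp] = biproduct_simps[OF assms]
  have "i2 \<cdot> p2 \<oplus>\<^bsub>Hom X P P\<^esub> i1 \<cdot> p1 = Ident X P"
    using hom_add_comm[of "i1 \<cdot> p1" "i2 \<cdot> p2" P P] by simp
  then show ?thesis unfolding biproduct_def by simp
qed

text \<open>
  The automorphism \<open>(1, v; 0, 1)\<close> of \<open>P\<close>, seen as a new biproduct structure on the same object: what
  holds for all biproduct structures can thus be transported along shears without new objects.
\<close>

lemma biproduct_shear:
  assumes "biproduct X A B P i1 i2 p1 p2" "arr X v B A"
  shows "biproduct X A B P i1 (i2 \<oplus>\<^bsub>Hom X B P\<^esub> \<ominus>\<^bsub>Hom X B P\<^esub> (i1 \<cdot> v)) (p1 \<oplus>\<^bsub>Hom X P A\<^esub> v \<cdot> p2) p2"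
proof -
  note [simp] = biproduct_simps[OF assms(1)] arrD[OF assms(2)]
  have "i1 \<cdot> (p1 \<oplus>\<^bsub>Hom X P A\<^esub> v \<cdot> p2) \<oplus>\<^bsub>Hom X P P\<^esub> (i2 \<oplus>\<^bsub>Hom X B P\<^esub> \<ominus>\<^bsub>Hom X B P\<^esub> (i1 \<cdot> v)) \<cdot> p2
    = i1 \<cdot> p1 \<oplus>\<^bsub>Hom X P P\<^esub> i2 \<cdot> p2"
    using hom_add_comm[of "i2 \<cdot> p2" "\<ominus>\<^bsub>Hom X P P\<^esub> (i1 \<cdot> (v \<cdot> p2))" P P] by simp
  then show ?thesis unfolding biproduct_def by simp
qed

lemma biproduct_zero:
  assumes "zero_object X Z" "A \<in> Obj X"
  shows "biproduct X A Z A (Ident X A) \<zero>\<^bsub>Hom X Z A\<^esub> (Ident X A) \<zero>\<^bsub>Hom X A Z\<^esub>"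
proof -
  have Z [simp]: "Z \<in> Obj X" and z: "carrier (Hom X Z Z) = {\<zero>\<^bsub>Hom X Z Z\<^esub>}"
    using assms unfolding zero_object_def by auto
  have "Ident X Z \<in> carrier (Hom X Z Z)" by simp
  then have "Ident X Z = \<zero>\<^bsub>Hom X Z Z\<^esub>" using z by simp
  then show ?thesis using assms(2) unfolding biproduct_def by simp
qed

end

section \<open>Arithmetic of extensions\<close>

context biadditive_functor
begin

lemma emap_closed [simp]:
  assumes "Arr c" "Arr a" "\<delta> \<in> carrier (Ext X (tgt c) (src a))" "src c = C'" "tgt a = A'"
  shows "Emap X c a \<delta> \<in> carrier (Ext X C' A')"
proof -
  interpret abelian_group_hom "Ext X (tgt c) (src a)" "Ext X (src c) (tgt a)" "Emap X c a"
    using emap_hom[of c "src c" "tgt c" a "src a" "tgt a"] assms by simp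
  show ?thesis using hom_closed assms by blast
qed

lemma emap_emap [simp]:
  "\<lbrakk>Arr c; Arr c'; Arr a; Arr a'; tgt c' = src c; tgt a = src a'; \<delta> \<in> carrier (Ext X (tgt c) (src a))\<rbrakk> \<Longrightarrow>
    Emap X c' a' (Emap X c a \<delta>) = Emap X (c \<cdot> c') (a' \<cdot> a) \<delta>"
  using emap_comp[of c' "src c'" "tgt c'" c "tgt c" a "src a" "tgt a" a' "tgt a'" \<delta>] by simp

lemma emap_id [simp]:
  "\<lbrakk>C \<in> Obj X; A \<in> Obj X; \<delta> \<in> carrier (Ext X C A)\<rbrakk> \<Longrightarrow> Emap X (Ident X C) (Ident X A) \<delta> = \<delta>"
  by (rule emap_ident)

lemma ext_closed [simp]:
  assumes "C \<in> Obj X" "A \<in> Obj X"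
  shows "\<zero>\<^bsub>Ext X C A\<^esub> \<in> carrier (Ext X C A)"
    "\<lbrakk>\<delta> \<in> carrier (Ext X C A); \<epsilon> \<in> carrier (Ext X C A)\<rbrakk> \<Longrightarrow> \<delta> \<oplus>\<^bsub>Ext X C A\<^esub> \<epsilon> \<in> carrier (Ext X C A)"
    "\<delta> \<in> carrier (Ext X C A) \<Longrightarrow> \<ominus>\<^bsub>Ext X C A\<^esub> \<delta> \<in> carrier (Ext X C A)"
proof -
  interpret abelian_group "Ext X C A" using ext_group assms .
  show "\<zero>\<^bsub>Ext X C A\<^esub> \<in> carrier (Ext X C A)"
    "\<lbrakk>\<delta> \<in> carrier (Ext X C A); \<epsilon> \<in> carrier (Ext X C A)\<rbrakk> \<Longrightarrow> \<delta> \<oplus>\<^bsub>Ext X C A\<^esub> \<epsilon> \<in> carrier (Ext X C A)"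
    "\<delta> \<in> carrier (Ext X C A) \<Longrightarrow> \<ominus>\<^bsub>Ext X C A\<^esub> \<delta> \<in> carrier (Ext X C A)" by simp_all
qed

lemma emap_zero [simp]:
  "\<lbrakk>Arr c; Arr a; tgt c = C; src a = A\<rbrakk> \<Longrightarrow> Emap X c a \<zero>\<^bsub>Ext X C A\<^esub> = \<zero>\<^bsub>Ext X (src c) (tgt a)\<^esub>"
  "\<lbrakk>Arr a; C' \<in> Obj X; \<delta> \<in> carrier (Ext X C (src a)); C \<in> Obj X\<rbrakk> \<Longrightarrow>
    Emap X \<zero>\<^bsub>Hom X C' C\<^esub> a \<delta> = \<zero>\<^bsub>Ext X C' (tgt a)\<^esub>"
  "\<lbrakk>Arr c; A' \<in> Obj X; \<delta> \<in> carrier (Ext X (tgt c) A); A \<in> Obj X\<rbrakk> \<Longrightarrow>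
    Emap X c \<zero>\<^bsub>Hom X A A'\<^esub> \<delta> = \<zero>\<^bsub>Ext X (src c) A'\<^esub>"
proof -
  show "Emap X c a \<zero>\<^bsub>Ext X C A\<^esub> = \<zero>\<^bsub>Ext X (src c) (tgt a)\<^esub>"
    if "Arr c" "Arr a" "tgt c = C" "src a = A"
  proof -
    interpret abelian_group_hom "Ext X (tgt c) (src a)" "Ext X (src c) (tgt a)" "Emap X c a"
      using emap_hom[of c "src c" "tgt c" a "src a" "tgt a"] that by simp
    show ?thesis using hom_zero that by simp
  qed
  show "Emap X \<zero>\<^bsub>Hom X C' C\<^esub> a \<delta> = \<zero>\<^bsub>Ext X C' (tgt a)\<^esub>"
    if h: "Arr a" "C' \<in> Obj X" "\<delta> \<in> carrier (Ext X C (src a))" "C \<in> Obj X"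
  proof -
    interpret abelian_group "Ext X C' (tgt a)" using ext_group h by simp
    show ?thesis
      using emap_add_left[of "\<zero>\<^bsub>Hom X C' C\<^esub>" C' C "\<zero>\<^bsub>Hom X C' C\<^esub>" a "src a" "tgt a" \<delta>] h by simp
  qed
  show "Emap X c \<zero>\<^bsub>Hom X A A'\<^esub> \<delta> = \<zero>\<^bsub>Ext X (src c) A'\<^esub>"
    if h: "Arr c" "A' \<in> Obj X" "\<delta> \<in> carrier (Ext X (tgt c) A)" "A \<in> Obj X"
  proof -
    interpret abelian_group "Ext X (src c) A'" using ext_group h by simp
    show ?thesis
      using emap_add_right[of c "src c" "tgt c" "\<zero>\<^bsub>Hom X A A'\<^esub>" A A' "\<zero>\<^bsub>Hom X A A'\<^esub>" \<delta>] h by simp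
  qed
qed

lemma emap_add [simp]:
  assumes "Arr c" "Arr a"
  shows "\<lbrakk>tgt c = C; src a = A; \<delta> \<in> carrier (Ext X C A); \<epsilon> \<in> carrier (Ext X C A)\<rbrakk> \<Longrightarrow>
      Emap X c a (\<delta> \<oplus>\<^bsub>Ext X C A\<^esub> \<epsilon>) = Emap X c a \<delta> \<oplus>\<^bsub>Ext X (src c) (tgt a)\<^esub> Emap X c a \<epsilon>"
    "\<lbrakk>Arr c'; src c = C'; src c' = C'; tgt c = C; tgt c' = C; \<delta> \<in> carrier (Ext X C (src a))\<rbrakk> \<Longrightarrow>
      Emap X (c \<oplus>\<^bsub>Hom X C' C\<^esub> c') a \<delta> = Emap X c a \<delta> \<oplus>\<^bsub>Ext X C' (tgt a)\<^esub> Emap X c' a \<delta>"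
    "\<lbrakk>Arr a'; src a = A; src a' = A; tgt a = A'; tgt a' = A'; \<delta> \<in> carrier (Ext X (tgt c) A)\<rbrakk> \<Longrightarrow>
      Emap X c (a \<oplus>\<^bsub>Hom X A A'\<^esub> a') \<delta> = Emap X c a \<delta> \<oplus>\<^bsub>Ext X (src c) A'\<^esub> Emap X c a' \<delta>"
proof -
  show "Emap X c a (\<delta> \<oplus>\<^bsub>Ext X C A\<^esub> \<epsilon>) = Emap X c a \<delta> \<oplus>\<^bsub>Ext X (src c) (tgt a)\<^esub> Emap X c a \<epsilon>"
    if "tgt c = C" "src a = A" "\<delta> \<in> carrier (Ext X C A)" "\<epsilon> \<in> carrier (Ext X C A)"
  proof -
    interpret abelian_group_hom "Ext X (tgt c) (src a)" "Ext X (src c) (tgt a)" "Emap X c a"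
      using emap_hom[of c "src c" "tgt c" a "src a" "tgt a"] assms by simp
    show ?thesis using hom_add that by simp
  qed
  show "\<lbrakk>Arr c'; src c = C'; src c' = C'; tgt c = C; tgt c' = C; \<delta> \<in> carrier (Ext X C (src a))\<rbrakk> \<Longrightarrow>
      Emap X (c \<oplus>\<^bsub>Hom X C' C\<^esub> c') a \<delta> = Emap X c a \<delta> \<oplus>\<^bsub>Ext X C' (tgt a)\<^esub> Emap X c' a \<delta>"
    using emap_add_left[of c C' C c' a "src a" "tgt a" \<delta>] assms by simp
  show "\<lbrakk>Arr a'; src a = A; src a' = A; tgt a = A'; tgt a' = A'; \<delta> \<in> carrier (Ext X (tgt c) A)\<rbrakk> \<Longrightarrow>
      Emap X c (a \<oplus>\<^bsub>Hom X A A'\<^esub> a') \<delta> = Emap X c a \<delta> \<oplus>\<^bsub>Ext X (src c) A'\<^esub> Emap X c a' \<delta>"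
    using emap_add_right[of c "src c" "tgt c" a A A' a' \<delta>] assms by simp
qed

lemma ext_zero_laws [simp]:
  assumes "\<delta> \<in> carrier (Ext X C A)" "C \<in> Obj X" "A \<in> Obj X"
  shows "\<delta> \<oplus>\<^bsub>Ext X C A\<^esub> \<zero>\<^bsub>Ext X C A\<^esub> = \<delta>" "\<zero>\<^bsub>Ext X C A\<^esub> \<oplus>\<^bsub>Ext X C A\<^esub> \<delta> = \<delta>"
    "\<ominus>\<^bsub>Ext X C A\<^esub> \<delta> \<oplus>\<^bsub>Ext X C A\<^esub> \<delta> = \<zero>\<^bsub>Ext X C A\<^esub>" "\<delta> \<oplus>\<^bsub>Ext X C A\<^esub> \<ominus>\<^bsub>Ext X C A\<^esub> \<delta> = \<zero>\<^bsub>Ext X C A\<^esub>"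
    "\<ominus>\<^bsub>Ext X C A\<^esub> (\<ominus>\<^bsub>Ext X C A\<^esub> \<delta>) = \<delta>"
proof -
  interpret abelian_group "Ext X C A" using ext_group assms(2,3) .
  show "\<delta> \<oplus>\<^bsub>Ext X C A\<^esub> \<zero>\<^bsub>Ext X C A\<^esub> = \<delta>" "\<zero>\<^bsub>Ext X C A\<^esub> \<oplus>\<^bsub>Ext X C A\<^esub> \<delta> = \<delta>"
    "\<ominus>\<^bsub>Ext X C A\<^esub> \<delta> \<oplus>\<^bsub>Ext X C A\<^esub> \<delta> = \<zero>\<^bsub>Ext X C A\<^esub>" "\<delta> \<oplus>\<^bsub>Ext X C A\<^esub> \<ominus>\<^bsub>Ext X C A\<^esub> \<delta> = \<zero>\<^bsub>Ext X C A\<^esub>"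
    "\<ominus>\<^bsub>Ext X C A\<^esub> (\<ominus>\<^bsub>Ext X C A\<^esub> \<delta>) = \<delta>"
    using assms l_neg r_neg by simp_all
qed

lemma ext_negI:
  assumes "\<delta> \<oplus>\<^bsub>Ext X C A\<^esub> \<epsilon> = \<zero>\<^bsub>Ext X C A\<^esub>" "\<delta> \<in> carrier (Ext X C A)" "\<epsilon> \<in> carrier (Ext X C A)"
    "C \<in> Obj X" "A \<in> Obj X"
  shows "\<delta> = \<ominus>\<^bsub>Ext X C A\<^esub> \<epsilon>"
proof -
  interpret abelian_group "Ext X C A" using ext_group assms(4,5) .
  show ?thesis using minus_equality assms by metis
qed

lemma emap_neg [simp]:
  assumes "Arr c" "Arr a"
  shows "\<lbrakk>src c = C'; tgt c = C; \<delta> \<in> carrier (Ext X C (src a))\<rbrakk> \<Longrightarrow>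
      Emap X (\<ominus>\<^bsub>Hom X C' C\<^esub> c) a \<delta> = \<ominus>\<^bsub>Ext X C' (tgt a)\<^esub> Emap X c a \<delta>"
    "\<lbrakk>src a = A; tgt a = A'; \<delta> \<in> carrier (Ext X (tgt c) A)\<rbrakk> \<Longrightarrow>
      Emap X c (\<ominus>\<^bsub>Hom X A A'\<^esub> a) \<delta> = \<ominus>\<^bsub>Ext X (src c) A'\<^esub> Emap X c a \<delta>"
proof -
  show "Emap X (\<ominus>\<^bsub>Hom X C' C\<^esub> c) a \<delta> = \<ominus>\<^bsub>Ext X C' (tgt a)\<^esub> Emap X c a \<delta>"
    if h: "src c = C'" "tgt c = C" "\<delta> \<in> carrier (Ext X C (src a))"
  proof (rule ext_negI)
    show "Emap X (\<ominus>\<^bsub>Hom X C' C\<^esub> c) a \<delta> \<oplus>\<^bsub>Ext X C' (tgt a)\<^esub> Emap X c a \<delta> = \<zero>\<^bsub>Ext X C' (tgt a)\<^esub>"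
      using emap_add(2)[of "\<ominus>\<^bsub>Hom X C' C\<^esub> c" a c C' C \<delta>] h assms by auto
  qed (use h assms in auto)
  show "Emap X c (\<ominus>\<^bsub>Hom X A A'\<^esub> a) \<delta> = \<ominus>\<^bsub>Ext X (src c) A'\<^esub> Emap X c a \<delta>"
    if h: "src a = A" "tgt a = A'" "\<delta> \<in> carrier (Ext X (tgt c) A)"
  proof (rule ext_negI)
    show "Emap X c (\<ominus>\<^bsub>Hom X A A'\<^esub> a) \<delta> \<oplus>\<^bsub>Ext X (src c) A'\<^esub> Emap X c a \<delta> = \<zero>\<^bsub>Ext X (src c) A'\<^esub>"
      using emap_add(3)[of c "\<ominus>\<^bsub>Hom X A A'\<^esub> a" a A A' \<delta>] h assms by auto
  qed (use h assms in auto)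
qed

lemma emap_neg_ext [simp]:
  assumes "Arr c" "Arr a" "tgt c = C" "src a = A" "\<delta> \<in> carrier (Ext X C A)"
  shows "Emap X c a (\<ominus>\<^bsub>Ext X C A\<^esub> \<delta>) = \<ominus>\<^bsub>Ext X (src c) (tgt a)\<^esub> Emap X c a \<delta>"
proof (rule ext_negI)
  have "C \<in> Obj X" "A \<in> Obj X" using assms by auto
  then show "Emap X c a (\<ominus>\<^bsub>Ext X C A\<^esub> \<delta>) \<oplus>\<^bsub>Ext X (src c) (tgt a)\<^esub> Emap X c a \<delta> = \<zero>\<^bsub>Ext X (src c) (tgt a)\<^esub>"
    using emap_add(1)[of c a C A "\<ominus>\<^bsub>Ext X C A\<^esub> \<delta>" \<delta>] assms by simp
qed (use assms in auto)

end

section \<open>Equivalent sequences and isomorphisms\<close>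

context additive_category
begin

lemma iso_arrE:
  assumes "iso_arr X b B B'"
  obtains b' where "arr X b B B'" "arr X b' B' B" "b' \<cdot> b = Ident X B" "b \<cdot> b' = Ident X B'"
    "iso_arr X b' B' B"
  using assms unfolding iso_arr_def by blast

lemma iso_arrI:
  assumes "arr X b B B'" "arr X c B' B" "arr X d B' B" "c \<cdot> b = Ident X B" "b \<cdot> d = Ident X B'"
  shows "iso_arr X b B B'"
proof -
  note [simp] = assms(1-3)[THEN arrD]
  have "c = c \<cdot> (b \<cdot> d)" by (simp add: assms(5))
  also have "\<dots> = (c \<cdot> b) \<cdot> d" by simp
  also have "\<dots> = d" by (simp only: assms(4)) simp
  finally show ?thesis using assms unfolding iso_arr_def by blast
qed

lemma seq_equiv_equiv: "equiv (sequences X A C) (seq_equiv X A C)"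
proof (rule equivI)
  show "seq_equiv X A C \<subseteq> sequences X A C \<times> sequences X A C"
    unfolding seq_equiv_def sequences_def by blast
  show "refl_on (sequences X A C) (seq_equiv X A C)"
  proof (rule refl_onI)
    fix s assume "s \<in> sequences X A C"
    then obtain x y B where s: "s = (x, y)" and a: "arr X x A B" "arr X y B C"
      unfolding sequences_def by blast
    note [simp] = a[THEN arrD]
    have "iso_arr X (Ident X B) B B" unfolding iso_arr_def by (rule conjI, simp, rule exI[of _ "Ident X B"]) simp
    then show "(s, s) \<in> seq_equiv X A C"
      unfolding s seq_equiv_def by (auto intro!: exI[of _ B] exI[of _ "Ident X B"])
  qed
  show "sym (seq_equiv X A C)"
  proof (rule symI)
    fix s t assume "(s, t) \<in> seq_equiv X A C"
    then obtain x y x' y' B B' b where st: "s = (x, y)" "t = (x', y')"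
      and a: "arr X x A B" "arr X y B C" "arr X x' A B'" "arr X y' B' C"
      and b: "iso_arr X b B B'" "b \<cdot> x = x'" "y' \<cdot> b = y"
      unfolding seq_equiv_def by blast
    obtain b' where b': "arr X b B B'" "arr X b' B' B" "b' \<cdot> b = Ident X B" "b \<cdot> b' = Ident X B'"
      "iso_arr X b' B' B" using iso_arrE[OF b(1)] .
    note [simp] = a[THEN arrD] b'(1,2)[THEN arrD]
    have "b' \<cdot> x' = x" using comp_reassoc[OF b'(3), of x] b(2) by simp
    moreover have "y \<cdot> b' = y'" using comp_assoc'[of b' b y'] b(3) b'(4) by simp
    ultimately show "(t, s) \<in> seq_equiv X A C"
      unfolding st seq_equiv_def using a b'(5) by blast
  qed
  show "trans (seq_equiv X A C)"
  proof (rule transI)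
    fix s t u assume "(s, t) \<in> seq_equiv X A C" "(t, u) \<in> seq_equiv X A C"
    then obtain x y x' y' x'' y'' B B' B1 B'' b c where st: "s = (x, y)" "t = (x', y')" "u = (x'', y'')"
      and a: "arr X x A B" "arr X y B C" "arr X x' A B'" "arr X y' B' C" "arr X x' A B1"
        "arr X x'' A B''" "arr X y'' B'' C"
      and b: "iso_arr X b B B'" "b \<cdot> x = x'" "y' \<cdot> b = y"
      and c: "iso_arr X c B1 B''" "c \<cdot> x' = x''" "y'' \<cdot> c = y'"
      unfolding seq_equiv_def by blast
    have B1: "B1 = B'" using a(3,5) by simp
    obtain b' where b': "arr X b B B'" "arr X b' B' B" "b' \<cdot> b = Ident X B" "b \<cdot> b' = Ident X B'"
      using iso_arrE[OF b(1)] by metis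
    obtain c' where c': "arr X c B' B''" "arr X c' B'' B'" "c' \<cdot> c = Ident X B'" "c \<cdot> c' = Ident X B''"
      using iso_arrE[OF c(1)] B1 by metis
    note [simp] = a[THEN arrD] b'(1,2)[THEN arrD] c'(1,2)[THEN arrD]
    have "iso_arr X (c \<cdot> b) B B''"
      by (rule iso_arrI[of _ _ _ "b' \<cdot> c'" "b' \<cdot> c'"])
        (simp_all add: b' c' comp_reassoc[OF b'(4)] comp_reassoc[OF c'(3)])
    moreover have "(c \<cdot> b) \<cdot> x = x''" by (simp add: b c)
    moreover have "y'' \<cdot> (c \<cdot> b) = y" using comp_reassoc[OF c(3), of b] b by simp
    ultimately show "(s, u) \<in> seq_equiv X A C"
      unfolding st seq_equiv_def using a by blast
  qed
qed

lemma seq_class_eq_iff: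
  assumes "arr X x A B" "arr X y B C" "arr X x' A B'" "arr X y' B' C"
  shows "seq_class X A C x y = seq_class X A C x' y' \<longleftrightarrow>
    (\<exists>b. iso_arr X b B B' \<and> b \<cdot> x = x' \<and> y' \<cdot> b = y)"
proof -
  have "(x, y) \<in> sequences X A C" "(x', y') \<in> sequences X A C"
    using assms unfolding sequences_def by blast+
  then have "seq_class X A C x y = seq_class X A C x' y' \<longleftrightarrow> ((x, y), (x', y')) \<in> seq_equiv X A C"
    unfolding seq_class_def using eq_equiv_class_iff[OF seq_equiv_equiv] by blast
  also have "\<dots> \<longleftrightarrow> (\<exists>b. iso_arr X b B B' \<and> b \<cdot> x = x' \<and> y' \<cdot> b = y)"
    using assms unfolding seq_equiv_def by auto
  finally show ?thesis .
qed

text \<open>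
  If \<open>n = 1 - c b\<close> has square zero, then \<open>c b = 1 - n\<close> is invertible with inverse \<open>1 + n\<close>.  This
  replaces the five lemma: maps between weakly exact sequences rarely satisfy \<open>c b = 1\<close>, but the
  difference often vanishes after one more composition.
\<close>

lemma iso_if_square_zero:
  assumes "arr X b B B'" "arr X c B' B"
    and "(Ident X B \<oplus>\<^bsub>Hom X B B\<^esub> \<ominus>\<^bsub>Hom X B B\<^esub> (c \<cdot> b)) \<cdot>
      (Ident X B \<oplus>\<^bsub>Hom X B B\<^esub> \<ominus>\<^bsub>Hom X B B\<^esub> (c \<cdot> b)) = \<zero>\<^bsub>Hom X B B\<^esub>"
    and "(Ident X B' \<oplus>\<^bsub>Hom X B' B'\<^esub> \<ominus>\<^bsub>Hom X B' B'\<^esub> (b \<cdot> c)) \<cdot>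
      (Ident X B' \<oplus>\<^bsub>Hom X B' B'\<^esub> \<ominus>\<^bsub>Hom X B' B'\<^esub> (b \<cdot> c)) = \<zero>\<^bsub>Hom X B' B'\<^esub>"
  shows "iso_arr X b B B'"
proof -
  note [simp] = assms(1,2)[THEN arrD]
  have inv: "t \<cdot> (Ident X D \<oplus>\<^bsub>Hom X D D\<^esub> n) = Ident X D" "(Ident X D \<oplus>\<^bsub>Hom X D D\<^esub> n) \<cdot> t = Ident X D"
    if "arr X t D D" "n = Ident X D \<oplus>\<^bsub>Hom X D D\<^esub> \<ominus>\<^bsub>Hom X D D\<^esub> t" "n \<cdot> n = \<zero>\<^bsub>Hom X D D\<^esub>" for t n D
  proof -
    have D [simp]: "D \<in> Obj X" and [simp]: "Arr t" "src t = D" "tgt t = D" using that(1) by auto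
    have [simp]: "Arr n" "src n = D" "tgt n = D" using that(2) by auto
    have "t = \<ominus>\<^bsub>Hom X D D\<^esub> n \<oplus>\<^bsub>Hom X D D\<^esub> Ident X D"
      unfolding that(2) using hom_add_comm[of "\<ominus>\<^bsub>Hom X D D\<^esub> Ident X D" "t" D D] by simp
    then show "t \<cdot> (Ident X D \<oplus>\<^bsub>Hom X D D\<^esub> n) = Ident X D" "(Ident X D \<oplus>\<^bsub>Hom X D D\<^esub> n) \<cdot> t = Ident X D"
      using that(3) hom_add_comm[of "Ident X D" n D D] by simp_all
  qed
  let ?n = "Ident X B \<oplus>\<^bsub>Hom X B B\<^esub> \<ominus>\<^bsub>Hom X B B\<^esub> (c \<cdot> b)"
  let ?m = "Ident X B' \<oplus>\<^bsub>Hom X B' B'\<^esub> \<ominus>\<^bsub>Hom X B' B'\<^esub> (b \<cdot> c)"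
  have n: "?n \<cdot> ?n = \<zero>\<^bsub>Hom X B B\<^esub>" and m: "?m \<cdot> ?m = \<zero>\<^bsub>Hom X B' B'\<^esub>"
    using assms(3,4) by (simp_all del: comp_add)
  have "((Ident X B \<oplus>\<^bsub>Hom X B B\<^esub> ?n) \<cdot> c) \<cdot> b = Ident X B"
    using inv(2)[of "c \<cdot> b" B ?n] n by (simp del: comp_add hom_add_assoc)
  moreover have "b \<cdot> (c \<cdot> (Ident X B' \<oplus>\<^bsub>Hom X B' B'\<^esub> ?m)) = Ident X B'"
    using inv(1)[of "b \<cdot> c" B' ?m] m by (simp del: comp_add hom_add_assoc)
  ultimately show ?thesis
    by (intro iso_arrI[of b B B' "(Ident X B \<oplus>\<^bsub>Hom X B B\<^esub> ?n) \<cdot> c" "c \<cdot> (Ident X B' \<oplus>\<^bsub>Hom X B' B'\<^esub> ?m)"])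
      (simp_all del: comp_add hom_add_assoc)
qed

end

section \<open>Weak exactness of triangles\<close>

context additive_realization
begin

lemma triangleD:
  assumes "triangle X A x B y C \<delta>"
  shows "arr X x A B" "arr X y B C" "\<delta> \<in> carrier (Ext X C A)"
  using assms unfolding triangle_def by auto

lemma triangle_simps:
  assumes "triangle X A x B y C \<delta>"
  shows "Arr x" "src x = A" "tgt x = B" "Arr y" "src y = B" "tgt y = C" "\<delta> \<in> carrier (Ext X C A)"
    "A \<in> Obj X" "B \<in> Obj X" "C \<in> Obj X"
  using triangleD[OF assms] by auto

lemma triangle_unique:
  assumes "triangle X A x B y C \<delta>" "triangle X A x' B' y' C \<delta>"
  obtains b where "iso_arr X b B B'" "b \<cdot> x = x'" "y' \<cdot> b = y"
  using assms seq_class_eq_iff[of x A B y C x' B' y'] unfolding triangle_def by metis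

lemma triangle_iso_middle:
  assumes "triangle X A x B y C \<delta>" "iso_arr X b B B'" "b \<cdot> x = x'" "y' \<cdot> b = y"
    "arr X x' A B'" "arr X y' B' C"
  shows "triangle X A x' B' y' C \<delta>"
  using assms seq_class_eq_iff[of x A B y C x' B' y'] unfolding triangle_def by metis

lemma ex_triangle:
  assumes "C \<in> Obj X" "A \<in> Obj X" "\<delta> \<in> carrier (Ext X C A)"
  obtains x B y where "triangle X A x B y C \<delta>"
proof -
  obtain x y where "Rlz X C A \<delta> = seq_class X A C x y" "(x, y) \<in> sequences X A C"
    using realization_class[OF assms] unfolding quotient_def seq_class_def by auto
  then show thesis using that assms unfolding triangle_def sequences_def by blast
qed

lemma triangle_biproduct:
  assumes "biproduct X A C P i1 i2 p1 p2"
  shows "triangle X A i1 P p2 C \<zero>\<^bsub>Ext X C A\<^esub>"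
  using realization_zero[OF assms] biproduct_simps[OF assms] unfolding triangle_def by simp

lemma triangle_lift:
  assumes "triangle X A x B y C \<delta>" "triangle X A' x' B' y' C' \<delta>'" "arr X a A A'" "arr X c C C'"
    "Emap X (Ident X C) a \<delta> = Emap X c (Ident X A') \<delta>'"
  obtains b where "arr X b B B'" "b \<cdot> x = x' \<cdot> a" "y' \<cdot> b = c \<cdot> y"
  using realization_lift[OF assms(1,2), of a c] assms
  unfolding ext_morphism_def push_def pull_def by blast

end

context pre_extriangulated
begin

lemma ET3_E:
  assumes "triangle X A x B y C \<delta>" "triangle X A' x' B' y' C' \<delta>'"
    "arr X a A A'" "arr X b B B'" "b \<cdot> x = x' \<cdot> a"
  obtains c where "arr X c C C'" "y' \<cdot> b = c \<cdot> y"
    "Emap X (Ident X C) a \<delta> = Emap X c (Ident X A') \<delta>'"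
  using ET3[OF assms] unfolding triangle_morphism_def push_def pull_def by blast

lemma ET3_op_E:
  assumes "triangle X A x B y C \<delta>" "triangle X A' x' B' y' C' \<delta>'"
    "arr X b B B'" "arr X c C C'" "y' \<cdot> b = c \<cdot> y"
  obtains a where "arr X a A A'" "b \<cdot> x = x' \<cdot> a"
    "Emap X (Ident X C) a \<delta> = Emap X c (Ident X A') \<delta>'"
  using ET3_op[OF assms] unfolding triangle_morphism_def push_def pull_def by blast

text \<open>
  The triangles with which all others are compared.  They realize zero extensions, on the
  biproducts of \<open>A\<close> with a zero object.
\<close>

lemma ex_unit_triangles:
  obtains Z where "zero_object X Z" "Z \<in> Obj X"
    "\<And>A. A \<in> Obj X \<Longrightarrow> triangle X A (Ident X A) A \<zero>\<^bsub>Hom X A Z\<^esub> Z \<zero>\<^bsub>Ext X Z A\<^esub>"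
    "\<And>A. A \<in> Obj X \<Longrightarrow> triangle X Z \<zero>\<^bsub>Hom X Z A\<^esub> A (Ident X A) A \<zero>\<^bsub>Ext X A Z\<^esub>"
proof -
  obtain Z where Z: "zero_object X Z" using ex_zero_object by blast
  show thesis
  proof (rule that[of Z])
    show "zero_object X Z" "Z \<in> Obj X" using Z unfolding zero_object_def by auto
    show "\<And>A. A \<in> Obj X \<Longrightarrow> triangle X A (Ident X A) A \<zero>\<^bsub>Hom X A Z\<^esub> Z \<zero>\<^bsub>Ext X Z A\<^esub>"
      using triangle_biproduct[OF biproduct_zero[OF Z]] .
    show "\<And>A. A \<in> Obj X \<Longrightarrow> triangle X Z \<zero>\<^bsub>Hom X Z A\<^esub> A (Ident X A) A \<zero>\<^bsub>Ext X A Z\<^esub>"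
      using triangle_biproduct[OF biproduct_swap[OF biproduct_zero[OF Z]]] .
  qed
qed

lemma triangle_comp_zero:
  assumes t: "triangle X A x B y C \<delta>"
  shows "y \<cdot> x = \<zero>\<^bsub>Hom X A C\<^esub>"
proof -
  note [simp] = triangle_simps[OF t]
  obtain Z where Z: "zero_object X Z" "Z \<in> Obj X"
    "\<And>A. A \<in> Obj X \<Longrightarrow> triangle X A (Ident X A) A \<zero>\<^bsub>Hom X A Z\<^esub> Z \<zero>\<^bsub>Ext X Z A\<^esub>"
    using ex_unit_triangles by metis
  note [simp] = Z(2)
  obtain c where "arr X c Z C" "y \<cdot> x = c \<cdot> \<zero>\<^bsub>Hom X A Z\<^esub>"
    using ET3_E[OF Z(3) t, of A "Ident X A" x] by auto
  then show ?thesis by simp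
qed

lemma triangle_push_zero:
  assumes t: "triangle X A x B y C \<delta>"
  shows "Emap X (Ident X C) x \<delta> = \<zero>\<^bsub>Ext X C B\<^esub>"
proof -
  note [simp] = triangle_simps[OF t]
  obtain Z where Z: "zero_object X Z" "Z \<in> Obj X"
    "\<And>A. A \<in> Obj X \<Longrightarrow> triangle X A (Ident X A) A \<zero>\<^bsub>Hom X A Z\<^esub> Z \<zero>\<^bsub>Ext X Z A\<^esub>"
    using ex_unit_triangles by metis
  note [simp] = Z(2)
  obtain c where "arr X c C Z" "Emap X (Ident X C) x \<delta> = Emap X c (Ident X B) \<zero>\<^bsub>Ext X Z B\<^esub>"
    using ET3_E[OF t Z(3), of B x "Ident X B"] by auto
  then show ?thesis by simp
qed

lemma triangle_pull_zero:
  assumes t: "triangle X A x B y C \<delta>"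
  shows "Emap X y (Ident X A) \<delta> = \<zero>\<^bsub>Ext X B A\<^esub>"
proof -
  note [simp] = triangle_simps[OF t]
  obtain Z where Z: "zero_object X Z" "Z \<in> Obj X"
    "\<And>A. A \<in> Obj X \<Longrightarrow> triangle X Z \<zero>\<^bsub>Hom X Z A\<^esub> A (Ident X A) A \<zero>\<^bsub>Ext X A Z\<^esub>"
    using ex_unit_triangles by metis
  note [simp] = Z(2)
  obtain a where "arr X a Z A" "Emap X (Ident X B) a \<zero>\<^bsub>Ext X B Z\<^esub> = Emap X y (Ident X A) \<delta>"
    using ET3_op_E[OF Z(3) t, of B "Ident X B" y] by auto
  then show ?thesis by simp
qed

text \<open>
  The cone of \<open>f\<close> as a map to \<open>0 \<rightarrow> T = T\<close>, which exists by (ET3), is the factorization.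
\<close>

lemma factor_through_deflation:
  assumes t: "triangle X A x B y C \<delta>" and "arr X f B T" "f \<cdot> x = \<zero>\<^bsub>Hom X A T\<^esub>"
  obtains h where "arr X h C T" "f = h \<cdot> y"
proof -
  note [simp] = triangle_simps[OF t] arrD[OF assms(2)]
  obtain Z where Z: "zero_object X Z" "Z \<in> Obj X"
    "\<And>A. A \<in> Obj X \<Longrightarrow> triangle X Z \<zero>\<^bsub>Hom X Z A\<^esub> A (Ident X A) A \<zero>\<^bsub>Ext X A Z\<^esub>"
    using ex_unit_triangles by metis
  note [simp] = Z(2)
  show thesis
    using ET3_E[OF t Z(3), of T "\<zero>\<^bsub>Hom X A Z\<^esub>" f] assms(3) that by auto
qed

lemma factor_through_inflation:
  assumes t: "triangle X A x B y C \<delta>" and "arr X f T B" "y \<cdot> f = \<zero>\<^bsub>Hom X T C\<^esub>"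
  obtains h where "arr X h T A" "f = x \<cdot> h"
proof -
  note [simp] = triangle_simps[OF t] arrD[OF assms(2)]
  obtain Z where Z: "zero_object X Z" "Z \<in> Obj X"
    "\<And>A. A \<in> Obj X \<Longrightarrow> triangle X A (Ident X A) A \<zero>\<^bsub>Hom X A Z\<^esub> Z \<zero>\<^bsub>Ext X Z A\<^esub>"
    using ex_unit_triangles by metis
  note [simp] = Z(2)
  show thesis
    using ET3_op_E[OF Z(3) t, of T f "\<zero>\<^bsub>Hom X Z C\<^esub>"] assms(3) that by auto
qed

text \<open>
  A morphism \<open>g\<close> with \<open>g\<^sub>* \<delta> = 0\<close> is a morphism of extensions from \<open>\<delta>\<close> to the zero extension
  realized by \<open>T = T \<rightarrow> 0\<close>; its realization on the middle terms extends \<open>g\<close>.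
\<close>

lemma extend_along_inflation:
  assumes t: "triangle X A x B y C \<delta>" and "arr X g A T"
    and z: "Emap X (Ident X C) g \<delta> = \<zero>\<^bsub>Ext X C T\<^esub>"
  obtains h where "arr X h B T" "g = h \<cdot> x"
proof -
  note [simp] = triangle_simps[OF t] arrD[OF assms(2)]
  obtain Z where Z: "zero_object X Z" "Z \<in> Obj X"
    "\<And>A. A \<in> Obj X \<Longrightarrow> triangle X A (Ident X A) A \<zero>\<^bsub>Hom X A Z\<^esub> Z \<zero>\<^bsub>Ext X Z A\<^esub>"
    using ex_unit_triangles by metis
  note [simp] = Z(2)
  show thesis
    using triangle_lift[OF t Z(3), of T g "\<zero>\<^bsub>Hom X C Z\<^esub>"] z that by auto
qed

lemma lift_along_deflation:
  assumes t: "triangle X A x B y C \<delta>" and "arr X g T C"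
    and z: "Emap X g (Ident X A) \<delta> = \<zero>\<^bsub>Ext X T A\<^esub>"
  obtains h where "arr X h T B" "g = y \<cdot> h"
proof -
  note [simp] = triangle_simps[OF t] arrD[OF assms(2)]
  obtain Z where Z: "zero_object X Z" "Z \<in> Obj X"
    "\<And>A. A \<in> Obj X \<Longrightarrow> triangle X Z \<zero>\<^bsub>Hom X Z A\<^esub> A (Ident X A) A \<zero>\<^bsub>Ext X A Z\<^esub>"
    using ex_unit_triangles by metis
  note [simp] = Z(2)
  show thesis
    using triangle_lift[OF Z(3) t, of T "\<zero>\<^bsub>Hom X Z A\<^esub>" g] z that by auto
qed

end

section \<open>Recognizing triangles\<close>

context pre_extriangulated
begin

text \<open>
  The usual source of square-zero endomorphisms: \<open>n\<close> kills \<open>x\<close> and factors through \<open>x\<close>.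
\<close>

lemma square_zero_if_factors:
  assumes "arr X n B B" "arr X x A B" "arr X w B A" "n \<cdot> x = \<zero>\<^bsub>Hom X A B\<^esub>" "n = x \<cdot> w"
  shows "n \<cdot> n = \<zero>\<^bsub>Hom X B B\<^esub>"
proof -
  note [simp] = assms(1-3)[THEN arrD]
  have "n \<cdot> n = (n \<cdot> x) \<cdot> w" unfolding assms(5) by simp
  then show ?thesis by (simp add: assms(4))
qed

text \<open>
  A sequence that is related to a realization of \<open>\<delta>\<close> by maps in both directions, compatible with the
  end terms, and in which \<open>x\<close> is a weak kernel of \<open>y\<close>, realizes \<open>\<delta>\<close> too.  Both \<open>1 - \<psi> \<phi>\<close> and
  \<open>1 - \<phi> \<psi>\<close> kill the first map and are killed by the second, hence have square zero.
\<close>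

lemma triangle_recognition:
  assumes t: "triangle X A x\<^sub>0 B\<^sub>0 y\<^sub>0 C \<delta>"
    and a: "arr X \<phi> B\<^sub>0 B" "arr X \<psi> B B\<^sub>0" "arr X x A B" "arr X y B C"
    and e: "\<phi> \<cdot> x\<^sub>0 = x" "y \<cdot> \<phi> = y\<^sub>0" "\<psi> \<cdot> x = x\<^sub>0" "y\<^sub>0 \<cdot> \<psi> = y"
    and weak_kernel: "\<And>t. arr X t B B \<Longrightarrow> y \<cdot> t = \<zero>\<^bsub>Hom X B C\<^esub> \<Longrightarrow> \<exists>w. arr X w B A \<and> t = x \<cdot> w"
  shows "triangle X A x B y C \<delta>"
proof -
  note [simp] = triangle_simps[OF t] a[THEN arrD]
  let ?n = "Ident X B\<^sub>0 \<oplus>\<^bsub>Hom X B\<^sub>0 B\<^sub>0\<^esub> \<ominus>\<^bsub>Hom X B\<^sub>0 B\<^sub>0\<^esub> (\<psi> \<cdot> \<phi>)"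
  let ?m = "Ident X B \<oplus>\<^bsub>Hom X B B\<^esub> \<ominus>\<^bsub>Hom X B B\<^esub> (\<phi> \<cdot> \<psi>)"
  have n0: "?n \<cdot> x\<^sub>0 = \<zero>\<^bsub>Hom X A B\<^sub>0\<^esub>" "y\<^sub>0 \<cdot> ?n = \<zero>\<^bsub>Hom X B\<^sub>0 C\<^esub>" "arr X ?n B\<^sub>0 B\<^sub>0"
    by (simp_all add: e comp_reassoc[OF e(4)])
  obtain w where "arr X w B\<^sub>0 A" "?n = x\<^sub>0 \<cdot> w" using factor_through_inflation[OF t n0(3,2)] .
  then have n: "?n \<cdot> ?n = \<zero>\<^bsub>Hom X B\<^sub>0 B\<^sub>0\<^esub>"
    using square_zero_if_factors[OF n0(3) triangleD(1)[OF t] _ n0(1)] by blast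
  have m0: "?m \<cdot> x = \<zero>\<^bsub>Hom X A B\<^esub>" "y \<cdot> ?m = \<zero>\<^bsub>Hom X B C\<^esub>" "arr X ?m B B"
    by (simp_all add: e comp_reassoc[OF e(2)])
  obtain v where "arr X v B A" "?m = x \<cdot> v" using weak_kernel[OF m0(3,2)] by blast
  then have m: "?m \<cdot> ?m = \<zero>\<^bsub>Hom X B B\<^esub>"
    using square_zero_if_factors[OF m0(3) a(3) _ m0(1)] by blast
  have "iso_arr X \<phi> B\<^sub>0 B"
    using iso_if_square_zero[of \<phi> B\<^sub>0 B \<psi>] n m by (simp del: comp_add)
  then show ?thesis
    using triangle_iso_middle[OF t] e a by blast
qed

text \<open>
  Realize \<open>a\<^sub>* \<delta>\<close>, lift \<open>a\<close> and \<open>a'\<close> to the middle terms, and compare.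
\<close>

lemma triangle_iso_left:
  assumes t: "triangle X A x B y C \<delta>"
    and a: "arr X a A A'" "arr X a' A' A" "a' \<cdot> a = Ident X A" "a \<cdot> a' = Ident X A'"
  shows "triangle X A' (x \<cdot> a') B y C (Emap X (Ident X C) a \<delta>)"
proof -
  note [simp] = triangle_simps[OF t] a(1,2)[THEN arrD] a(3,4)
  obtain x1 B1 y1 where t1: "triangle X A' x1 B1 y1 C (Emap X (Ident X C) a \<delta>)"
    using ex_triangle[of C A' "Emap X (Ident X C) a \<delta>"] by auto
  note [simp] = triangle_simps[OF t1]
  obtain \<psi> where \<psi>: "arr X \<psi> B B1" "\<psi> \<cdot> x = x1 \<cdot> a" "y1 \<cdot> \<psi> = y"
    using triangle_lift[OF t t1, of a "Ident X C"] by auto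
  obtain \<phi> where \<phi>: "arr X \<phi> B1 B" "\<phi> \<cdot> x1 = x \<cdot> a'" "y \<cdot> \<phi> = y1"
    using triangle_lift[OF t1 t, of a' "Ident X C"] by auto
  show ?thesis
  proof (rule triangle_recognition[OF t1 \<phi>(1) \<psi>(1)])
    note [simp] = \<phi>(1)[THEN arrD] \<psi>(1)[THEN arrD]
    show "\<psi> \<cdot> (x \<cdot> a') = x1" by (simp add: comp_reassoc[OF \<psi>(2)])
    show "\<exists>w. arr X w B A' \<and> s = x \<cdot> a' \<cdot> w" if s: "arr X s B B" "y \<cdot> s = \<zero>\<^bsub>Hom X B C\<^esub>" for s
    proof -
      obtain w where "arr X w B A" "s = x \<cdot> w" using factor_through_inflation[OF t s] .
      then have "arr X (a \<cdot> w) B A' \<and> s = x \<cdot> a' \<cdot> (a \<cdot> w)" by (simp add: comp_reassoc[OF a(3)])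
      then show ?thesis by blast
    qed
  qed (simp_all add: \<phi>(2,3) \<psi>(2,3) \<phi>(1)[THEN arrD] \<psi>(1)[THEN arrD])
qed

lemma triangle_iso_right:
  assumes t: "triangle X A x B y C \<delta>"
    and c: "arr X c C C'" "arr X c' C' C" "c' \<cdot> c = Ident X C" "c \<cdot> c' = Ident X C'"
  shows "triangle X A x B (c \<cdot> y) C' (Emap X c' (Ident X A) \<delta>)"
proof -
  note [simp] = triangle_simps[OF t] c(1,2)[THEN arrD] c(3,4)
  obtain x1 B1 y1 where t1: "triangle X A x1 B1 y1 C' (Emap X c' (Ident X A) \<delta>)"
    using ex_triangle[of C' A "Emap X c' (Ident X A) \<delta>"] by auto
  note [simp] = triangle_simps[OF t1]
  obtain \<psi> where \<psi>: "arr X \<psi> B B1" "\<psi> \<cdot> x = x1" "y1 \<cdot> \<psi> = c \<cdot> y"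
    using triangle_lift[OF t t1, of "Ident X A" c] by auto
  obtain \<phi> where \<phi>: "arr X \<phi> B1 B" "\<phi> \<cdot> x1 = x" "y \<cdot> \<phi> = c' \<cdot> y1"
    using triangle_lift[OF t1 t, of "Ident X A" c'] by auto
  show ?thesis
  proof (rule triangle_recognition[OF t1 \<phi>(1) \<psi>(1)])
    note [simp] = \<phi>(1)[THEN arrD] \<psi>(1)[THEN arrD]
    show "c \<cdot> y \<cdot> \<phi> = y1" by (simp add: \<phi>(3) comp_reassoc[OF c(4)])
    show "\<exists>w. arr X w B A \<and> s = x \<cdot> w" if s: "arr X s B B" "c \<cdot> y \<cdot> s = \<zero>\<^bsub>Hom X B C'\<^esub>" for s
    proof -
      note [simp] = arrD[OF s(1)]
      have "y \<cdot> s = c' \<cdot> (c \<cdot> y \<cdot> s)" by (simp add: comp_reassoc[OF c(3)])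
      then have "y \<cdot> s = \<zero>\<^bsub>Hom X B C\<^esub>" by (simp only: s(2)) simp
      then show ?thesis using factor_through_inflation[OF t s(1)] by metis
    qed
  qed (simp_all add: \<phi>(2,3) \<psi>(2,3) \<phi>(1)[THEN arrD] \<psi>(1)[THEN arrD])
qed

text \<open>
  (ET3) yields maps \<open>c\<close> and \<open>d\<close> in both directions.  The difference \<open>1 - d c\<close> kills \<open>y\<close> because
  \<open>d c y = y\<close>, and it factors through \<open>y\<close> because it annihilates \<open>\<delta>\<close>; so it has square zero.
\<close>

lemma cone_unique:
  assumes t: "triangle X A x B y C \<delta>" and t': "triangle X A x B y' C' \<delta>'"
  obtains c where "iso_arr X c C C'" "c \<cdot> y = y'" "Emap X c (Ident X A) \<delta>' = \<delta>"
proof -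
  note [simp] = triangle_simps[OF t] triangle_simps[OF t']
  have half: "\<exists>c. arr X c C C' \<and> c \<cdot> y = y' \<and> Emap X c (Ident X A) \<delta>' = \<delta>"
    if t: "triangle X A x B y C \<delta>" and t': "triangle X A x B y' C' \<delta>'" for y C \<delta> y' C' \<delta>'
  proof -
    note [simp] = triangle_simps[OF t] triangle_simps[OF t']
    show ?thesis
      using ET3_E[OF t t', of "Ident X A" "Ident X B"] by auto
  qed
  have nil: "n \<cdot> n = \<zero>\<^bsub>Hom X C C\<^esub>"
    if t: "triangle X A x B y C \<delta>" and f: "arr X f C C" "f \<cdot> y = y" "Emap X f (Ident X A) \<delta> = \<delta>"
      and n: "n = Ident X C \<oplus>\<^bsub>Hom X C C\<^esub> \<ominus>\<^bsub>Hom X C C\<^esub> f" for y C \<delta> f n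
  proof -
    note [simp] = triangle_simps[OF t] arrD[OF f(1)]
    have an: "arr X n C C" unfolding n by simp
    have "Emap X n (Ident X A) \<delta> = \<zero>\<^bsub>Ext X C A\<^esub>" unfolding n by (simp add: f)
    from lift_along_deflation[OF t an this]
    obtain w where w: "arr X w C B" "n = y \<cdot> w" .
    have "n \<cdot> y = \<zero>\<^bsub>Hom X B C\<^esub>" unfolding n by (simp add: f)
    then show ?thesis using square_zero_if_factors[of n C y B w] an w by simp
  qed
  obtain c where c: "arr X c C C'" "c \<cdot> y = y'" "Emap X c (Ident X A) \<delta>' = \<delta>"
    using half[OF t t'] by blast
  obtain d where d: "arr X d C' C" "d \<cdot> y' = y" "Emap X d (Ident X A) \<delta> = \<delta>'"
    using half[OF t' t] by blast
  note [simp] = c(1)[THEN arrD] d(1)[THEN arrD]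
  have cd: "Emap X (d \<cdot> c) (Ident X A) \<delta> = \<delta>" "Emap X (c \<cdot> d) (Ident X A) \<delta>' = \<delta>'"
    using emap_emap[of d c "Ident X A" "Ident X A" \<delta>] emap_emap[of c d "Ident X A" "Ident X A" \<delta>']
    by (simp_all add: c(3) d(3) del: emap_emap)
  have "iso_arr X c C C'"
    using iso_if_square_zero[of c C C' d] nil[OF t, of "d \<cdot> c"] nil[OF t', of "c \<cdot> d"]
    by (simp add: c d cd del: comp_add)
  then show thesis using that c by blast
qed

text \<open>A section of the deflation forces the extension to vanish, so that the inflation is a split
  monomorphism as well and the section is complemented.\<close>

lemma biproduct_if_section:
  assumes t: "triangle X A m M e B \<theta>" and s: "arr X s B M" "e \<cdot> s = Ident X B"
  obtains r where "biproduct X A B M m s r e"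
proof -
  note [simp] = triangle_simps[OF t] arrD[OF s(1)] s(2) triangle_comp_zero[OF t]
  have "\<theta> = Emap X s (Ident X A) (Emap X e (Ident X A) \<theta>)" by simp
  also have "\<dots> = \<zero>\<^bsub>Ext X B A\<^esub>" by (simp only: triangle_pull_zero[OF t]) simp
  finally obtain h where h: "arr X h M A" "Ident X A = h \<cdot> m"
    using extend_along_inflation[OF t, of "Ident X A" A] by auto
  note [simp] = arrD[OF h(1)] h(2)[symmetric]
  \<comment> \<open>The idempotent complementary to \<open>s e\<close> factors through \<open>m\<close>, which gives the projection to \<open>A\<close>.\<close>
  let ?k = "Ident X M \<oplus>\<^bsub>Hom X M M\<^esub> \<ominus>\<^bsub>Hom X M M\<^esub> (s \<cdot> e)"
  have "e \<cdot> ?k = \<zero>\<^bsub>Hom X M B\<^esub>" by (simp add: comp_reassoc[OF s(2)])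
  then obtain r where r: "arr X r M A" "?k = m \<cdot> r"
    using factor_through_inflation[OF t, of ?k M] by auto
  note [simp] = arrD[OF r(1)]
  have r': "r = h \<cdot> ?k" unfolding r(2) using comp_reassoc[OF h(2)[symmetric], of r] by simp
  have "r \<cdot> m = Ident X A" "r \<cdot> s = \<zero>\<^bsub>Hom X B A\<^esub>"
    unfolding r' by simp_all
  moreover have "m \<cdot> r \<oplus>\<^bsub>Hom X M M\<^esub> s \<cdot> e = Ident X M" unfolding r(2)[symmetric] by simp
  ultimately have "biproduct X A B M m s r e" unfolding biproduct_def by simp
  then show thesis by (rule that)
qed

text \<open>
  The extension \<open>\<theta> = r\<^sub>* m\<^sub>* \<theta>\<close> vanishes, so \<open>e\<close> has a section; correcting it by \<open>m r\<close> makes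
  it complementary to the given retraction \<open>r\<close>.
\<close>

lemma biproduct_if_retraction:
  assumes t: "triangle X A m M e B \<theta>" and r: "arr X r M A" "r \<cdot> m = Ident X A"
  obtains s where "biproduct X A B M m s r e"
proof -
  note [simp] = triangle_simps[OF t] arrD[OF r(1)] r(2) triangle_comp_zero[OF t]
  have "\<theta> = Emap X (Ident X B) r (Emap X (Ident X B) m \<theta>)" by simp
  also have "\<dots> = \<zero>\<^bsub>Ext X B A\<^esub>" by (simp only: triangle_push_zero[OF t]) simp
  finally obtain h where h: "arr X h B M" "Ident X B = e \<cdot> h"
    using lift_along_deflation[OF t, of "Ident X B" B] by auto
  note [simp] = arrD[OF h(1)] h(2)[symmetric]
  define s where "s = h \<oplus>\<^bsub>Hom X B M\<^esub> \<ominus>\<^bsub>Hom X B M\<^esub> (m \<cdot> (r \<cdot> h))"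
  have s: "arr X s B M" "e \<cdot> s = Ident X B" "r \<cdot> s = \<zero>\<^bsub>Hom X B A\<^esub>"
    unfolding s_def by (simp_all add: comp_reassoc[OF triangle_comp_zero[OF t]] comp_reassoc[OF r(2)])
  obtain r' where b: "biproduct X A B M m s r' e"
    using biproduct_if_section[OF t s(1,2)] .
  have "r = r'"
    by (rule biproduct_eqI_from[OF b]) (simp_all add: biproduct_simps[OF b] s(3))
  then show thesis using that b by blast
qed

text \<open>
  The direct sum clauses quantify over all biproduct diagrams; this reduces them to a single one.
\<close>

lemma triangle_change_biproduct:
  assumes b: "biproduct X A B P i1 i2 p1 p2" and b': "biproduct X A B P' i1' i2' p1' p2'"
    and a: "arr X u S A" "arr X v S B" "arr X z A T" "arr X w B T"
    and t: "triangle X S (i1 \<cdot> u \<oplus>\<^bsub>Hom X S P\<^esub> i2 \<cdot> v) P (z \<cdot> p1 \<oplus>\<^bsub>Hom X P T\<^esub> w \<cdot> p2) T \<epsilon>"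
  shows "triangle X S (i1' \<cdot> u \<oplus>\<^bsub>Hom X S P'\<^esub> i2' \<cdot> v) P' (z \<cdot> p1' \<oplus>\<^bsub>Hom X P' T\<^esub> w \<cdot> p2') T \<epsilon>"
proof -
  note [simp] = a[THEN arrD] biproduct_simps[OF b] biproduct_simps[OF b']
  let ?f = "i1' \<cdot> p1 \<oplus>\<^bsub>Hom X P P'\<^esub> i2' \<cdot> p2"
  let ?g = "i1 \<cdot> p1' \<oplus>\<^bsub>Hom X P' P\<^esub> i2 \<cdot> p2'"
  have "iso_arr X ?f P P'"
    by (rule iso_arrI[of _ _ _ ?g ?g]) simp_all
  then show ?thesis
    by (rule triangle_iso_middle[OF t]) simp_all
qed

end

section \<open>The opposite category\<close>

lemma opposite_simps [simp]:
  "Obj (opposite X) = Obj X" "Hom (opposite X) A B = Hom X B A" "g \<cdot>\<^bsub>opposite X\<^esub> f = f \<cdot>\<^bsub>X\<^esub> g"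
  "Ident (opposite X) = Ident X" "Ext (opposite X) C A = Ext X A C"
  "Emap (opposite X) c a = Emap X a c" "Rlz (opposite X) C A \<delta> = (Rlz X A C \<delta>)\<inverse>"
  by (simp_all add: opposite_def)

lemma opposite_opposite [simp]: "opposite (opposite X) = X"
  by (simp add: opposite_def)

lemma arr_opposite [simp]: "arr (opposite X) f A B \<longleftrightarrow> arr X f B A"
  unfolding arr_def by auto

lemma push_opposite [simp]: "push (opposite X) C a \<delta> = pull X C a \<delta>"
  and pull_opposite [simp]: "pull (opposite X) A c \<delta> = push X A c \<delta>"
  unfolding push_def pull_def by simp_all

lemma biproduct_opposite [simp]:
  "biproduct (opposite X) A B P i1 i2 p1 p2 \<longleftrightarrow> biproduct X A B P p1 p2 i1 i2"
  unfolding biproduct_def by auto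

lemma iso_arr_opposite [simp]: "iso_arr (opposite X) b B B' \<longleftrightarrow> iso_arr X b B' B"
  unfolding iso_arr_def by auto

context additive_category
begin

text \<open>
  An isomorphism of sequences is turned round in the opposite category, hence the appeal to symmetry.
\<close>

lemma seq_equiv_opposite: "((x, y), (x', y')) \<in> seq_equiv (opposite X) A C \<longleftrightarrow> ((y, x), (y', x')) \<in> seq_equiv X C A"
proof -
  have "((x, y), (x', y')) \<in> seq_equiv (opposite X) A C \<longleftrightarrow> ((y', x'), (y, x)) \<in> seq_equiv X C A"
    unfolding seq_equiv_def by (simp del: arr_iff) blast
  then show ?thesis
    using seq_equiv_equiv unfolding equiv_def sym_def by metis
qed

lemma seq_class_opposite: "seq_class (opposite X) A C x y = (seq_class X C A y x)\<inverse>"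
proof (rule Set.set_eqI)
  fix p
  show "p \<in> seq_class (opposite X) A C x y \<longleftrightarrow> p \<in> (seq_class X C A y x)\<inverse>"
    unfolding seq_class_def by (cases p) (simp add: Image_singleton_iff seq_equiv_opposite)
qed

lemma triangle_opposite: "triangle (opposite X) A x B y C \<delta> \<longleftrightarrow> triangle X C y B x A \<delta>"
  unfolding triangle_def seq_class_opposite by (auto simp del: arr_iff)

end

lemma zero_object_opposite [simp]: "zero_object (opposite X) Z \<longleftrightarrow> zero_object X Z"
  unfolding zero_object_def by auto

text \<open>
  Reversing arrows interchanges the two mixed components of an element of \<open>E(C \<oplus> C', A \<oplus> A')\<close>,
  and both are required to vanish.
\<close>

lemma ext_sum_opposite:
  "ext_sum (opposite X) A A' P p p' C C' Q j j' \<delta> \<delta>' = ext_sum X C C' Q j j' A A' P p p' \<delta> \<delta>'"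
  unfolding ext_sum_def by simp (metis (no_types, lifting))

context additive_category
begin

lemma triangle_morphism_opposite:
  "triangle_morphism (opposite X) A x B y C \<delta> A' x' B' y' C' \<delta>' a b c \<longleftrightarrow>
    triangle_morphism X C' y' B' x' A' \<delta>' C y B x A \<delta> c b a"
  unfolding triangle_morphism_def triangle_opposite by (auto simp del: arr_iff)

lemma additive_category_opposite: "additive_category (opposite X)"
proof (rule additive_category.intro)
  show "A = A' \<and> B = B'" if "arr (opposite X) f A B" "arr (opposite X) f A' B'" for f A B A' B'
    using that by simp
  show "abelian_group (Hom (opposite X) A B)" if "A \<in> Obj (opposite X)" "B \<in> Obj (opposite X)" for A B
    using hom_group that by simp
  show "\<exists>Z. zero_object (opposite X) Z"
    using ex_zero_object by simp
  show "\<exists>P i1 i2 p1 p2. biproduct (opposite X) A B P i1 i2 p1 p2"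
    if "A \<in> Obj (opposite X)" "B \<in> Obj (opposite X)" for A B
    using ex_biproduct[of A B] that by simp blast
qed simp_all

lemma ET0_opposite: "ET0 (opposite X) \<longleftrightarrow> ET0_op X" "ET0_op (opposite X) \<longleftrightarrow> ET0 X"
  unfolding ET0_def ET0_op_def inflation_def deflation_def triangle_opposite
  by (simp_all del: arr_iff) blast+

end

context pre_extriangulated
begin

lemma pre_extriangulated_opposite: "pre_extriangulated (opposite X)"
proof -
  interpret opp: additive_category "opposite X" by (rule additive_category_opposite)
  show ?thesis
  proof (intro pre_extriangulated.intro pre_extriangulated_axioms.intro additive_realization.intro
      additive_realization_axioms.intro biadditive_functor.intro biadditive_functor_axioms.intro)
    show "additive_category (opposite X)" by (rule additive_category_opposite)
    show "abelian_group (Ext (opposite X) C A)" if "C \<in> Obj (opposite X)" "A \<in> Obj (opposite X)" for C A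
      using ext_group that by simp
    show "abelian_group_hom (Ext (opposite X) C A) (Ext (opposite X) C' A') (Emap (opposite X) c a)"
      if "arr (opposite X) c C' C" "arr (opposite X) a A A'" for c C C' a A A'
      using emap_hom[of a A' A c C C'] that by (simp del: arr_iff opp.arr_iff)
    show "Emap (opposite X) (Ident (opposite X) C) (Ident (opposite X) A) \<delta> = \<delta>"
      if "C \<in> Obj (opposite X)" "A \<in> Obj (opposite X)" "\<delta> \<in> carrier (Ext (opposite X) C A)" for C A \<delta>
      using that by simp
    show "Emap (opposite X) (c \<cdot>\<^bsub>opposite X\<^esub> c') (a' \<cdot>\<^bsub>opposite X\<^esub> a) \<delta>
        = Emap (opposite X) c' a' (Emap (opposite X) c a \<delta>)"
      if "arr (opposite X) c' C'' C'" "arr (opposite X) c C' C" "arr (opposite X) a A A'"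
        "arr (opposite X) a' A' A''" "\<delta> \<in> carrier (Ext (opposite X) C A)" for c c' a a' \<delta> C C' C'' A A' A''
      using that by simp
    show "Emap (opposite X) (c \<oplus>\<^bsub>Hom (opposite X) C' C\<^esub> d) a \<delta>
        = Emap (opposite X) c a \<delta> \<oplus>\<^bsub>Ext (opposite X) C' A'\<^esub> Emap (opposite X) d a \<delta>"
      if "arr (opposite X) c C' C" "arr (opposite X) d C' C" "arr (opposite X) a A A'"
        "\<delta> \<in> carrier (Ext (opposite X) C A)" for c d a \<delta> C C' A A'
      using that by simp
    show "Emap (opposite X) c (a \<oplus>\<^bsub>Hom (opposite X) A A'\<^esub> b) \<delta>
        = Emap (opposite X) c a \<delta> \<oplus>\<^bsub>Ext (opposite X) C' A'\<^esub> Emap (opposite X) c b \<delta>"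
      if "arr (opposite X) c C' C" "arr (opposite X) a A A'" "arr (opposite X) b A A'"
        "\<delta> \<in> carrier (Ext (opposite X) C A)" for c a b \<delta> C C' A A'
      using that by simp
    show "Rlz (opposite X) C A \<delta> \<in> sequences (opposite X) A C // seq_equiv (opposite X) A C"
      if h: "C \<in> Obj (opposite X)" "A \<in> Obj (opposite X)" "\<delta> \<in> carrier (Ext (opposite X) C A)" for C A \<delta>
    proof -
      obtain x B y where "triangle X C x B y A \<delta>" using ex_triangle[of A C \<delta>] h by auto
      then have "Rlz (opposite X) C A \<delta> = seq_class (opposite X) A C y x" "(y, x) \<in> sequences (opposite X) A C"
        unfolding triangle_opposite[symmetric] unfolding triangle_def sequences_def
        by (simp_all del: arr_iff opp.arr_iff) blast
      then show ?thesis unfolding seq_class_def quotient_def by blast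
    qed
    show "\<exists>b. arr (opposite X) b B B' \<and> b \<cdot>\<^bsub>opposite X\<^esub> x = x' \<cdot>\<^bsub>opposite X\<^esub> a \<and>
          y' \<cdot>\<^bsub>opposite X\<^esub> b = c \<cdot>\<^bsub>opposite X\<^esub> y"
      if "triangle (opposite X) A x B y C \<delta>" "triangle (opposite X) A' x' B' y' C' \<delta>'"
        "ext_morphism (opposite X) A C \<delta> A' C' \<delta>' a c" for A x B y C \<delta> A' x' B' y' C' \<delta>' a c
    proof -
      have "ext_morphism X C' A' \<delta>' C A \<delta> c a"
        using that(3) unfolding ext_morphism_def by (simp del: arr_iff opp.arr_iff)
      then show ?thesis
        using realization_lift[OF that(2,1)[unfolded triangle_opposite]] by (simp del: arr_iff opp.arr_iff) metis
    qed
    show "Rlz (opposite X) C A \<zero>\<^bsub>Ext (opposite X) C A\<^esub> = seq_class (opposite X) A C i1 p2"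
      if "biproduct (opposite X) A C P i1 i2 p1 p2" for A C P i1 i2 p1 p2
      using realization_zero[OF biproduct_swap[OF that[unfolded biproduct_opposite]]]
      unfolding seq_class_opposite by simp
    show "Rlz (opposite X) Q P (ext_sum (opposite X) A A' P p p' C C' Q j j' \<delta> \<delta>') =
        seq_class (opposite X) P Q
          (k \<cdot>\<^bsub>opposite X\<^esub> x \<cdot>\<^bsub>opposite X\<^esub> p \<oplus>\<^bsub>Hom (opposite X) P R\<^esub> k' \<cdot>\<^bsub>opposite X\<^esub> x' \<cdot>\<^bsub>opposite X\<^esub> p')
          (j \<cdot>\<^bsub>opposite X\<^esub> y \<cdot>\<^bsub>opposite X\<^esub> r \<oplus>\<^bsub>Hom (opposite X) R Q\<^esub> j' \<cdot>\<^bsub>opposite X\<^esub> y' \<cdot>\<^bsub>opposite X\<^esub> r')"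
      if "triangle (opposite X) A x B y C \<delta>" "triangle (opposite X) A' x' B' y' C' \<delta>'"
        "biproduct (opposite X) A A' P i i' p p'" "biproduct (opposite X) B B' R k k' r r'"
        "biproduct (opposite X) C C' Q j j' q q'"
      for A x B y C \<delta> A' x' B' y' C' \<delta>' P i i' p p' R k k' r r' Q j j' q q'
    proof -
      note h = that(1,2)[unfolded triangle_opposite] that(3-5)[unfolded biproduct_opposite]
      note [simp] = triangle_simps[OF h(1)] triangle_simps[OF h(2)]
        biproduct_simps(1-15)[OF h(3)] biproduct_simps(1-15)[OF h(4)] biproduct_simps(1-15)[OF h(5)]
      show ?thesis
        using realization_sum[OF h(1,2) h(5) h(4) h(3)]
        unfolding seq_class_opposite ext_sum_opposite by simp
    qed
    show "\<exists>c. triangle_morphism (opposite X) A x B y C \<delta> A' x' B' y' C' \<delta>' a b c"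
      if "triangle (opposite X) A x B y C \<delta>" "triangle (opposite X) A' x' B' y' C' \<delta>'"
        "arr (opposite X) a A A'" "arr (opposite X) b B B'" "b \<cdot>\<^bsub>opposite X\<^esub> x = x' \<cdot>\<^bsub>opposite X\<^esub> a"
      for A x B y C \<delta> A' x' B' y' C' \<delta>' a b
      using ET3_op[OF that(2,1)[unfolded triangle_opposite], of b a] that(3-5)
      unfolding triangle_morphism_opposite by simp
    show "\<exists>a. triangle_morphism (opposite X) A x B y C \<delta> A' x' B' y' C' \<delta>' a b c"
      if "triangle (opposite X) A x B y C \<delta>" "triangle (opposite X) A' x' B' y' C' \<delta>'"
        "arr (opposite X) b B B'" "arr (opposite X) c C C'" "y' \<cdot>\<^bsub>opposite X\<^esub> b = c \<cdot>\<^bsub>opposite X\<^esub> y"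
      for A x B y C \<delta> A' x' B' y' C' \<delta>' b c
      using ET3[OF that(2,1)[unfolded triangle_opposite], of c b] that(3-5)
      unfolding triangle_morphism_opposite by simp
  qed
qed

end

section \<open>Working forms of the octahedral conditions\<close>

context pre_extriangulated
begin

lemma ET4_E:
  assumes "ET4 X" "triangle X A f B f' D \<delta>" "triangle X B g C g' F \<delta>'"
  obtains E h' \<delta>'' d e where "triangle X A (g \<cdot> f) C h' E \<delta>''"
    "triangle X D d E e F (Emap X (Ident X F) f' \<delta>')"
    "d \<cdot> f' = h' \<cdot> g" "e \<cdot> h' = g'"
    "Emap X d (Ident X A) \<delta>'' = \<delta>" "Emap X (Ident X E) f \<delta>'' = Emap X e (Ident X B) \<delta>'"
  using assms unfolding ET4_def push_def pull_def by metis

lemma ET4_3_E: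
  assumes "ET4_3 X" "triangle X A f B f' D \<delta>f" "triangle X B g C g' F \<delta>g"
    "triangle X A (g \<cdot> f) C h\<^sub>0 E\<^sub>0 \<delta>h"
  obtains d\<^sub>0 e\<^sub>0 where "d\<^sub>0 \<cdot> f' = h\<^sub>0 \<cdot> g" "e\<^sub>0 \<cdot> h\<^sub>0 = g'"
    "triangle X D d\<^sub>0 E\<^sub>0 e\<^sub>0 F (Emap X (Ident X F) f' \<delta>g)"
    "Emap X d\<^sub>0 (Ident X A) \<delta>h = \<delta>f" "Emap X (Ident X E\<^sub>0) f \<delta>h = Emap X e\<^sub>0 (Ident X B) \<delta>g"
  using assms unfolding ET4_3_def push_def pull_def by metis

lemma ET4_1_E:
  assumes "ET4_1 X" "triangle X A\<^sub>1 x\<^sub>1 B\<^sub>1 y\<^sub>1 C \<delta>\<^sub>1" "triangle X A\<^sub>2 x\<^sub>2 B\<^sub>2 y\<^sub>2 C \<delta>\<^sub>2"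
  obtains M m\<^sub>1 e\<^sub>1 m\<^sub>2 e\<^sub>2 where "triangle X A\<^sub>1 m\<^sub>1 M e\<^sub>1 B\<^sub>2 (Emap X y\<^sub>2 (Ident X A\<^sub>1) \<delta>\<^sub>1)"
    "triangle X A\<^sub>2 m\<^sub>2 M e\<^sub>2 B\<^sub>1 (Emap X y\<^sub>1 (Ident X A\<^sub>2) \<delta>\<^sub>2)"
    "e\<^sub>2 \<cdot> m\<^sub>1 = x\<^sub>1" "e\<^sub>1 \<cdot> m\<^sub>2 = x\<^sub>2" "y\<^sub>2 \<cdot> e\<^sub>1 = y\<^sub>1 \<cdot> e\<^sub>2"
    "Emap X (Ident X C) m\<^sub>1 \<delta>\<^sub>1 \<oplus>\<^bsub>Ext X C M\<^esub> Emap X (Ident X C) m\<^sub>2 \<delta>\<^sub>2 = \<zero>\<^bsub>Ext X C M\<^esub>"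
  using assms unfolding ET4_1_def push_def pull_def by metis

lemma ET4_5_E:
  assumes h: "ET4_5 X" and t: "triangle X A\<^sub>1 x\<^sub>1 B\<^sub>1 y\<^sub>1 C \<delta>" "triangle X A\<^sub>2 x\<^sub>2 B\<^sub>2 y\<^sub>2 C \<delta>'"
    and g: "arr X g B\<^sub>1 B\<^sub>2" "y\<^sub>2 \<cdot> g = y\<^sub>1"
  obtains f where "arr X f A\<^sub>1 A\<^sub>2" "g \<cdot> x\<^sub>1 = x\<^sub>2 \<cdot> f" "Emap X (Ident X C) f \<delta> = \<delta>'"
    "\<And>P i1 i2 p1 p2. biproduct X A\<^sub>2 B\<^sub>1 P i1 i2 p1 p2 \<Longrightarrow>
      triangle X A\<^sub>1 (i1 \<cdot> (\<ominus>\<^bsub>Hom X A\<^sub>1 A\<^sub>2\<^esub> f) \<oplus>\<^bsub>Hom X A\<^sub>1 P\<^esub> i2 \<cdot> x\<^sub>1)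
        P (x\<^sub>2 \<cdot> p1 \<oplus>\<^bsub>Hom X P B\<^sub>2\<^esub> g \<cdot> p2) B\<^sub>2 (Emap X y\<^sub>2 (Ident X A\<^sub>1) \<delta>)"
proof -
  note [simp] = triangle_simps[OF t(1)] triangle_simps[OF t(2)]
  obtain f where f: "triangle_morphism X A\<^sub>1 x\<^sub>1 B\<^sub>1 y\<^sub>1 C \<delta> A\<^sub>2 x\<^sub>2 B\<^sub>2 y\<^sub>2 C \<delta>' f g (Ident X C)"
    and all: "\<forall>P i1 i2 p1 p2. biproduct X A\<^sub>2 B\<^sub>1 P i1 i2 p1 p2 \<longrightarrow>
      triangle X A\<^sub>1 (i1 \<cdot> (\<ominus>\<^bsub>Hom X A\<^sub>1 A\<^sub>2\<^esub> f) \<oplus>\<^bsub>Hom X A\<^sub>1 P\<^esub> i2 \<cdot> x\<^sub>1)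
        P (x\<^sub>2 \<cdot> p1 \<oplus>\<^bsub>Hom X P B\<^sub>2\<^esub> g \<cdot> p2) B\<^sub>2 (pull X A\<^sub>1 y\<^sub>2 \<delta>)"
    using h t g unfolding ET4_5_def by blast
  show thesis
  proof (rule that[of f])
    show "arr X f A\<^sub>1 A\<^sub>2" "g \<cdot> x\<^sub>1 = x\<^sub>2 \<cdot> f" "Emap X (Ident X C) f \<delta> = \<delta>'"
      using f unfolding triangle_morphism_def push_def pull_def by simp_all
  qed (use all in \<open>auto simp: pull_def\<close>)
qed

lemma ET4_5_I:
  assumes "\<And>A\<^sub>1 x\<^sub>1 B\<^sub>1 y\<^sub>1 C \<delta> A\<^sub>2 x\<^sub>2 B\<^sub>2 y\<^sub>2 \<delta>' g. \<lbrakk>triangle X A\<^sub>1 x\<^sub>1 B\<^sub>1 y\<^sub>1 C \<delta>; triangle X A\<^sub>2 x\<^sub>2 B\<^sub>2 y\<^sub>2 C \<delta>';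
      arr X g B\<^sub>1 B\<^sub>2; y\<^sub>2 \<cdot> g = y\<^sub>1\<rbrakk> \<Longrightarrow>
    \<exists>f. arr X f A\<^sub>1 A\<^sub>2 \<and> g \<cdot> x\<^sub>1 = x\<^sub>2 \<cdot> f \<and> Emap X (Ident X C) f \<delta> = \<delta>' \<and>
      (\<forall>P i1 i2 p1 p2. biproduct X A\<^sub>2 B\<^sub>1 P i1 i2 p1 p2 \<longrightarrow>
        triangle X A\<^sub>1 (i1 \<cdot> (\<ominus>\<^bsub>Hom X A\<^sub>1 A\<^sub>2\<^esub> f) \<oplus>\<^bsub>Hom X A\<^sub>1 P\<^esub> i2 \<cdot> x\<^sub>1)
          P (x\<^sub>2 \<cdot> p1 \<oplus>\<^bsub>Hom X P B\<^sub>2\<^esub> g \<cdot> p2) B\<^sub>2 (Emap X y\<^sub>2 (Ident X A\<^sub>1) \<delta>))"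
  shows "ET4_5 X"
  unfolding ET4_5_def
proof (intro allI impI, elim conjE)
  fix A1 x1 B1 y1 C \<delta> A2 x2 B2 y2 \<delta>' g
  assume t: "triangle X A1 x1 B1 y1 C \<delta>" "triangle X A2 x2 B2 y2 C \<delta>'" and g: "arr X g B1 B2" "y2 \<cdot> g = y1"
  note [simp] = triangle_simps[OF t(1)] triangle_simps[OF t(2)]
  obtain f where f: "arr X f A1 A2" "g \<cdot> x1 = x2 \<cdot> f" "Emap X (Ident X C) f \<delta> = \<delta>'"
    and all: "\<forall>P i1 i2 p1 p2. biproduct X A2 B1 P i1 i2 p1 p2 \<longrightarrow>
        triangle X A1 (i1 \<cdot> (\<ominus>\<^bsub>Hom X A1 A2\<^esub> f) \<oplus>\<^bsub>Hom X A1 P\<^esub> i2 \<cdot> x1)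
          P (x2 \<cdot> p1 \<oplus>\<^bsub>Hom X P B2\<^esub> g \<cdot> p2) B2 (pull X A1 y2 \<delta>)"
    using assms[OF t g] unfolding pull_def by blast
  have "triangle_morphism X A1 x1 B1 y1 C \<delta> A2 x2 B2 y2 C \<delta>' f g (Ident X C)"
    unfolding triangle_morphism_def push_def pull_def using t g f by simp
  then show "\<exists>f. triangle_morphism X A1 x1 B1 y1 C \<delta> A2 x2 B2 y2 C \<delta>' f g (Ident X C) \<and>
      (\<forall>P i1 i2 p1 p2. biproduct X A2 B1 P i1 i2 p1 p2 \<longrightarrow>
        triangle X A1 (i1 \<cdot> (\<ominus>\<^bsub>Hom X A1 A2\<^esub> f) \<oplus>\<^bsub>Hom X A1 P\<^esub> i2 \<cdot> x1)
          P (x2 \<cdot> p1 \<oplus>\<^bsub>Hom X P B2\<^esub> g \<cdot> p2) B2 (pull X A1 y2 \<delta>))"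
    using all by blast
qed

section \<open>Octahedra on a given third triangle\<close>

text \<open>
  The cone in the octahedron is isomorphic, compatibly with everything, to the given one.
\<close>

lemma ET4_3_if_ET4:
  assumes "ET4 X"
  shows "ET4_3 X"
  unfolding ET4_3_def
proof (intro allI impI, elim conjE)
  fix A f B f' D \<delta>f g C g' F \<delta>g h h\<^sub>0 E\<^sub>0 \<delta>h
  assume tf: "triangle X A f B f' D \<delta>f" and tg: "triangle X B g C g' F \<delta>g"
    and th: "triangle X A h C h\<^sub>0 E\<^sub>0 \<delta>h" and h: "h = g \<cdot> f"
  obtain E h' \<delta>'' d e where
    t: "triangle X A (g \<cdot> f) C h' E \<delta>''" and t': "triangle X D d E e F (Emap X (Ident X F) f' \<delta>g)"
    and o: "d \<cdot> f' = h' \<cdot> g" "e \<cdot> h' = g'" "Emap X d (Ident X A) \<delta>'' = \<delta>f"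
      "Emap X (Ident X E) f \<delta>'' = Emap X e (Ident X B) \<delta>g"
    using ET4_E[OF assms tf tg] .
  obtain c where c: "iso_arr X c E E\<^sub>0" "c \<cdot> h' = h\<^sub>0" "Emap X c (Ident X A) \<delta>h = \<delta>''"
    using cone_unique[OF t th[unfolded h]] .
  obtain c' where c': "arr X c E E\<^sub>0" "arr X c' E\<^sub>0 E" "c' \<cdot> c = Ident X E" "c \<cdot> c' = Ident X E\<^sub>0"
    using iso_arrE[OF c(1)] by metis
  note [simp] = triangle_simps[OF tf] triangle_simps[OF tg] triangle_simps[OF th] triangle_simps[OF t]
    triangle_simps[OF t'] c'(1,2)[THEN arrD] c'(3,4)
  let ?d = "c \<cdot> d" and ?e = "e \<cdot> c'"
  have "?d \<cdot> f' = h\<^sub>0 \<cdot> g" by (simp add: o(1) comp_reassoc[OF c(2)])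
  moreover have "?e \<cdot> h\<^sub>0 = g'" by (simp add: c(2)[symmetric] comp_reassoc[OF c'(3)] o(2))
  moreover have "triangle X D ?d E\<^sub>0 ?e F (push X F f' \<delta>g)"
    unfolding push_def by (rule triangle_iso_middle[OF t' c(1)]) simp_all
  moreover have "Emap X ?d (Ident X A) \<delta>h = Emap X d (Ident X A) (Emap X c (Ident X A) \<delta>h)" by simp
  then have "pull X A ?d \<delta>h = \<delta>f" unfolding pull_def by (simp only: c(3) o(3))
  moreover have "push X E\<^sub>0 f \<delta>h = pull X B ?e \<delta>g"
  proof -
    have "Emap X ?e (Ident X B) \<delta>g = Emap X c' (Ident X B) (Emap X e (Ident X B) \<delta>g)" by simp
    also have "\<dots> = Emap X c' (Ident X B) (Emap X (Ident X E) f (Emap X c (Ident X A) \<delta>h))"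
      by (simp only: o(4) c(3))
    also have "\<dots> = Emap X (Ident X E\<^sub>0) f \<delta>h" by simp
    finally show ?thesis unfolding push_def pull_def by simp
  qed
  ultimately show "\<exists>d\<^sub>0 e\<^sub>0. arr X d\<^sub>0 D E\<^sub>0 \<and> arr X e\<^sub>0 E\<^sub>0 F \<and> d\<^sub>0 \<cdot> f' = h\<^sub>0 \<cdot> g \<and> e\<^sub>0 \<cdot> h\<^sub>0 = g' \<and>
      triangle X D d\<^sub>0 E\<^sub>0 e\<^sub>0 F (push X F f' \<delta>g) \<and> pull X A d\<^sub>0 \<delta>h = \<delta>f \<and> push X E\<^sub>0 f \<delta>h = pull X B e\<^sub>0 \<delta>g"
    by (intro exI[of _ ?d] exI[of _ ?e]) (simp del: comp_assoc')
qed

lemma ET4_if_ET4_3: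
  assumes "ET0 X" "ET4_3 X"
  shows "ET4 X"
  unfolding ET4_def
proof (intro allI impI, elim conjE)
  fix A f B f' D \<delta> g C g' F \<delta>'
  assume tf: "triangle X A f B f' D \<delta>" and tg: "triangle X B g C g' F \<delta>'"
  have "inflation X (g \<cdot> f)"
    using assms(1) tf tg triangleD(1)[OF tf] triangleD(1)[OF tg] unfolding ET0_def inflation_def by blast
  then obtain A' C' h' E \<delta>'' where t: "triangle X A' (g \<cdot> f) C' h' E \<delta>''"
    unfolding inflation_def by blast
  have "A' = A" "C' = C"
    using triangle_simps[OF tf] triangle_simps[OF tg] triangle_simps[OF t] by simp_all
  then have t: "triangle X A (g \<cdot> f) C h' E \<delta>''" using t by simp
  obtain d e where "d \<cdot> f' = h' \<cdot> g" "e \<cdot> h' = g'" "triangle X D d E e F (Emap X (Ident X F) f' \<delta>')"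
    "Emap X d (Ident X A) \<delta>'' = \<delta>" "Emap X (Ident X E) f \<delta>'' = Emap X e (Ident X B) \<delta>'"
    using ET4_3_E[OF assms(2) tf tg t] .
  then show "\<exists>E h h' \<delta>'' d e. triangle X A h C h' E \<delta>'' \<and> triangle X D d E e F (push X F f' \<delta>') \<and>
      h = g \<cdot> f \<and> d \<cdot> f' = h' \<cdot> g \<and> e \<cdot> h' = g' \<and> pull X A d \<delta>'' = \<delta> \<and> push X E f \<delta>'' = pull X B e \<delta>'"
    using t unfolding push_def pull_def by blast
qed

section \<open>From octahedra to pullbacks of deflations\<close>

text \<open>
  The octahedron over \<open>A1 \<rightarrow> P \<rightarrow> M\<close>, whose first triangle is split with cone \<open>A2\<close>.  The triangle from \<open>A2\<close>
  to \<open>C\<close> that it contains realizes \<open>p2\<^sub>* \<nu> = \<delta>2\<close>, so it may be replaced by the given one.  Both summands of \<open>P\<close> are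
  treated alike, by swapping the biproduct.
\<close>

lemma pullback_half_if_ET4:
  assumes ET4: "ET4 X" and b: "biproduct X A\<^sub>1 A\<^sub>2 P i1 i2 p1 p2"
    and n: "triangle X P j M k C \<nu>" and t2: "triangle X A\<^sub>2 x\<^sub>2 B\<^sub>2 y\<^sub>2 C \<delta>\<^sub>2"
    and p: "Emap X (Ident X C) p1 \<nu> = \<delta>\<^sub>1" "Emap X (Ident X C) p2 \<nu> = \<delta>\<^sub>2"
  obtains e where "triangle X A\<^sub>1 (j \<cdot> i1) M e B\<^sub>2 (Emap X y\<^sub>2 (Ident X A\<^sub>1) \<delta>\<^sub>1)" "e \<cdot> j = x\<^sub>2 \<cdot> p2" "y\<^sub>2 \<cdot> e = k"
proof -
  obtain E h' \<delta>'' d e where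
    t: "triangle X A\<^sub>1 (j \<cdot> i1) M h' E \<delta>''" and t': "triangle X A\<^sub>2 d E e C (Emap X (Ident X C) p2 \<nu>)"
    and o: "d \<cdot> p2 = h' \<cdot> j" "e \<cdot> h' = k" "Emap X (Ident X E) i1 \<delta>'' = Emap X e (Ident X P) \<nu>"
    using ET4_E[OF ET4 triangle_biproduct[OF b] n] .
  obtain c where c: "iso_arr X c E B\<^sub>2" "c \<cdot> d = x\<^sub>2" "y\<^sub>2 \<cdot> c = e"
    using triangle_unique[OF t'[unfolded p] t2] .
  obtain c' where c': "arr X c E B\<^sub>2" "arr X c' B\<^sub>2 E" "c' \<cdot> c = Ident X E" "c \<cdot> c' = Ident X B\<^sub>2"
    using iso_arrE[OF c(1)] by metis
  note [simp] = biproduct_simps[OF b] triangle_simps[OF n] triangle_simps[OF t2] triangle_simps[OF t]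
    triangle_simps[OF t'] c'(1,2)[THEN arrD] c'(3,4)
  have "\<delta>'' = Emap X (Ident X E) p1 (Emap X (Ident X E) i1 \<delta>'')" by simp
  also have "\<dots> = Emap X e (Ident X A\<^sub>1) (Emap X (Ident X C) p1 \<nu>)" unfolding o(3) by simp
  finally have "Emap X c' (Ident X A\<^sub>1) \<delta>'' = Emap X c' (Ident X A\<^sub>1) (Emap X e (Ident X A\<^sub>1) \<delta>\<^sub>1)" by (simp only: p)
  also have "\<dots> = Emap X y\<^sub>2 (Ident X A\<^sub>1) \<delta>\<^sub>1" unfolding p(1)[symmetric] c(3)[symmetric] by simp
  finally have "triangle X A\<^sub>1 (j \<cdot> i1) M (c \<cdot> h') B\<^sub>2 (Emap X y\<^sub>2 (Ident X A\<^sub>1) \<delta>\<^sub>1)"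
    using triangle_iso_right[OF t c'] by simp
  moreover have "(c \<cdot> h') \<cdot> j = x\<^sub>2 \<cdot> p2"
    by (simp add: o(1)[symmetric] comp_reassoc[OF c(2)])
  moreover have "y\<^sub>2 \<cdot> (c \<cdot> h') = k"
    by (simp add: comp_reassoc[OF c(3)] o(2))
  ultimately show thesis by (rule that)
qed

text \<open>
  The relation \<open>m1\<^sub>* \<delta>1 + m2\<^sub>* \<delta>2 = 0\<close> says that the inflation \<open>j\<close> annihilates the extension \<open>\<nu>\<close>
  that it belongs to.
\<close>

lemma ET4_1_if_ET4:
  assumes "ET4 X"
  shows "ET4_1 X"
  unfolding ET4_1_def
proof (intro allI impI, elim conjE)
  fix A1 x1 B1 y1 C \<delta>1 A2 x2 B2 y2 \<delta>2
  assume t1: "triangle X A1 x1 B1 y1 C \<delta>1" and t2: "triangle X A2 x2 B2 y2 C \<delta>2"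
  note [simp] = triangle_simps[OF t1] triangle_simps[OF t2]
  obtain P i1 i2 p1 p2 where b: "biproduct X A1 A2 P i1 i2 p1 p2"
    using ex_biproduct[of A1 A2] by auto
  note [simp] = biproduct_simps[OF b]
  \<comment> \<open>The extension of \<open>C\<close> by \<open>A1 \<oplus> A2\<close> with components \<open>\<delta>1\<close> and \<open>\<delta>2\<close>.\<close>
  define \<nu> where "\<nu> = Emap X (Ident X C) i1 \<delta>1 \<oplus>\<^bsub>Ext X C P\<^esub> Emap X (Ident X C) i2 \<delta>2"
  have p: "Emap X (Ident X C) p1 \<nu> = \<delta>1" "Emap X (Ident X C) p2 \<nu> = \<delta>2"
    unfolding \<nu>_def by simp_all
  have \<nu> [simp]: "\<nu> \<in> carrier (Ext X C P)" unfolding \<nu>_def by simp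
  obtain j M k where n: "triangle X P j M k C \<nu>"
    using ex_triangle[of C P \<nu>] by auto
  note [simp] = triangle_simps[OF n]
  obtain e1 where e1: "triangle X A1 (j \<cdot> i1) M e1 B2 (Emap X y2 (Ident X A1) \<delta>1)" "e1 \<cdot> j = x2 \<cdot> p2" "y2 \<cdot> e1 = k"
    using pullback_half_if_ET4[OF assms b n t2 p] .
  obtain e2 where e2: "triangle X A2 (j \<cdot> i2) M e2 B1 (Emap X y1 (Ident X A2) \<delta>2)" "e2 \<cdot> j = x1 \<cdot> p1" "y1 \<cdot> e2 = k"
    using pullback_half_if_ET4[OF assms biproduct_swap[OF b] n t1 p(2,1)] .
  note [simp] = triangle_simps[OF e1(1)] triangle_simps[OF e2(1)]
  have "e2 \<cdot> (j \<cdot> i1) = x1" "e1 \<cdot> (j \<cdot> i2) = x2"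
    by (simp_all add: comp_reassoc[OF e1(2)] comp_reassoc[OF e2(2)])
  moreover have "push X C (j \<cdot> i1) \<delta>1 \<oplus>\<^bsub>Ext X C M\<^esub> push X C (j \<cdot> i2) \<delta>2 = \<zero>\<^bsub>Ext X C M\<^esub>"
  proof -
    have "push X C (j \<cdot> i1) \<delta>1 \<oplus>\<^bsub>Ext X C M\<^esub> push X C (j \<cdot> i2) \<delta>2 = Emap X (Ident X C) j \<nu>"
      unfolding \<nu>_def push_def by simp
    then show ?thesis using triangle_push_zero[OF n] by simp
  qed
  ultimately show "\<exists>M m1 e1 m2 e2. triangle X A1 m1 M e1 B2 (pull X A1 y2 \<delta>1) \<and>
      triangle X A2 m2 M e2 B1 (pull X A2 y1 \<delta>2) \<and>
      e2 \<cdot> m1 = x1 \<and> e1 \<cdot> m2 = x2 \<and> y2 \<cdot> e1 = y1 \<cdot> e2 \<and>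
      push X C m1 \<delta>1 \<oplus>\<^bsub>Ext X C M\<^esub> push X C m2 \<delta>2 = \<zero>\<^bsub>Ext X C M\<^esub>"
    using e1(1,3) e2(1,3) unfolding pull_def by metis
qed

section \<open>From pullbacks to homotopy cartesian squares\<close>

text \<open>
  A section \<open>s\<close> of \<open>e2\<close> with \<open>e1 s = g\<close> identifies \<open>M\<close> with \<open>A2 \<oplus> B1\<close>.  In these coordinates \<open>e1\<close>
  becomes \<open>(x2, g)\<close> and \<open>m1\<close> becomes \<open>(r m1, x1)\<close>, so that \<open>f = - r m1\<close>; applying \<open>r\<close> to
  \<open>m1\<^sub>* \<delta> + m2\<^sub>* \<delta>' = 0\<close> shows \<open>f\<^sub>* \<delta> = \<delta>'\<close>.
\<close>

lemma ET4_5_if_ET4_1: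
  assumes "ET4_1 X"
  shows "ET4_5 X"
proof (rule ET4_5_I)
  fix A\<^sub>1 x\<^sub>1 B\<^sub>1 y\<^sub>1 C \<delta> A\<^sub>2 x\<^sub>2 B\<^sub>2 y\<^sub>2 \<delta>' g
  assume t1: "triangle X A\<^sub>1 x\<^sub>1 B\<^sub>1 y\<^sub>1 C \<delta>" and t2: "triangle X A\<^sub>2 x\<^sub>2 B\<^sub>2 y\<^sub>2 C \<delta>'"
    and g: "arr X g B\<^sub>1 B\<^sub>2" "y\<^sub>2 \<cdot> g = y\<^sub>1"
  note [simp] = triangle_simps[OF t1] triangle_simps[OF t2] arrD[OF g(1)]
  obtain M m\<^sub>1 e\<^sub>1 m\<^sub>2 e\<^sub>2 where m1: "triangle X A\<^sub>1 m\<^sub>1 M e\<^sub>1 B\<^sub>2 (Emap X y\<^sub>2 (Ident X A\<^sub>1) \<delta>)"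
    and m2: "triangle X A\<^sub>2 m\<^sub>2 M e\<^sub>2 B\<^sub>1 (Emap X y\<^sub>1 (Ident X A\<^sub>2) \<delta>')"
    and m: "e\<^sub>2 \<cdot> m\<^sub>1 = x\<^sub>1" "e\<^sub>1 \<cdot> m\<^sub>2 = x\<^sub>2" "y\<^sub>2 \<cdot> e\<^sub>1 = y\<^sub>1 \<cdot> e\<^sub>2"
    and sum: "Emap X (Ident X C) m\<^sub>1 \<delta> \<oplus>\<^bsub>Ext X C M\<^esub> Emap X (Ident X C) m\<^sub>2 \<delta>' = \<zero>\<^bsub>Ext X C M\<^esub>"
    using ET4_1_E[OF assms t1 t2] .
  note [simp] = triangle_simps[OF m1] triangle_simps[OF m2]
  obtain s where s: "arr X s B\<^sub>1 M" "e\<^sub>1 \<cdot> s = g" "e\<^sub>2 \<cdot> s = Ident X B\<^sub>1"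
  proof -
    have "Emap X g (Ident X A\<^sub>1) (Emap X y\<^sub>2 (Ident X A\<^sub>1) \<delta>) = Emap X y\<^sub>1 (Ident X A\<^sub>1) \<delta>"
      using g by simp
    then have "Emap X g (Ident X A\<^sub>1) (Emap X y\<^sub>2 (Ident X A\<^sub>1) \<delta>) = \<zero>\<^bsub>Ext X B\<^sub>1 A\<^sub>1\<^esub>"
      by (simp only: triangle_pull_zero[OF t1])
    from lift_along_deflation[OF m1 g(1) this]
    obtain s' where s': "arr X s' B\<^sub>1 M" "g = e\<^sub>1 \<cdot> s'" .
    note [simp] = arrD[OF s'(1)]
    \<comment> \<open>The lift \<open>s'\<close> of \<open>g\<close> splits \<open>e2\<close> only modulo \<open>x1\<close>; adding \<open>m1 w\<close> corrects this and is invisible to \<open>e1\<close>.\<close>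
    let ?k = "Ident X B\<^sub>1 \<oplus>\<^bsub>Hom X B\<^sub>1 B\<^sub>1\<^esub> \<ominus>\<^bsub>Hom X B\<^sub>1 B\<^sub>1\<^esub> (e\<^sub>2 \<cdot> s')"
    have "y\<^sub>1 \<cdot> (e\<^sub>2 \<cdot> s') = y\<^sub>2 \<cdot> (e\<^sub>1 \<cdot> s')" by (simp add: comp_reassoc[OF m(3)])
    also have "\<dots> = y\<^sub>1" unfolding s'(2)[symmetric] by (rule g(2))
    finally have k: "arr X ?k B\<^sub>1 B\<^sub>1" "y\<^sub>1 \<cdot> ?k = \<zero>\<^bsub>Hom X B\<^sub>1 C\<^esub>" by simp_all
    obtain w where w: "arr X w B\<^sub>1 A\<^sub>1" "?k = x\<^sub>1 \<cdot> w" using factor_through_inflation[OF t1 k] .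
    note [simp] = arrD[OF w(1)]
    show thesis
    proof (rule that[of "s' \<oplus>\<^bsub>Hom X B\<^sub>1 M\<^esub> m\<^sub>1 \<cdot> w"])
      show "e\<^sub>1 \<cdot> (s' \<oplus>\<^bsub>Hom X B\<^sub>1 M\<^esub> m\<^sub>1 \<cdot> w) = g"
        using comp_reassoc[OF triangle_comp_zero[OF m1], of w] s'(2) by simp
      have "Ident X B\<^sub>1 = e\<^sub>2 \<cdot> s' \<oplus>\<^bsub>Hom X B\<^sub>1 B\<^sub>1\<^esub> x\<^sub>1 \<cdot> w"
        by (rule hom_diff_eq[OF w(2)]) simp_all
      then show "e\<^sub>2 \<cdot> (s' \<oplus>\<^bsub>Hom X B\<^sub>1 M\<^esub> m\<^sub>1 \<cdot> w) = Ident X B\<^sub>1"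
        by (simp add: comp_reassoc[OF m(1)])
    qed simp
  qed
  obtain r where b: "biproduct X A\<^sub>2 B\<^sub>1 M m\<^sub>2 s r e\<^sub>2"
    using biproduct_if_section[OF m2 s(1,3)] .
  note [simp] = biproduct_simps[OF b]
  let ?f = "\<ominus>\<^bsub>Hom X A\<^sub>1 A\<^sub>2\<^esub> (r \<cdot> m\<^sub>1)"
  have m1': "m\<^sub>1 = m\<^sub>2 \<cdot> (r \<cdot> m\<^sub>1) \<oplus>\<^bsub>Hom X A\<^sub>1 M\<^esub> s \<cdot> x\<^sub>1"
    using biproduct_decompose(1)[OF b, of m\<^sub>1] m(1) by simp
  have e1': "e\<^sub>1 = x\<^sub>2 \<cdot> r \<oplus>\<^bsub>Hom X M B\<^sub>2\<^esub> g \<cdot> e\<^sub>2"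
    using biproduct_decompose(2)[OF b, of e\<^sub>1] m(2) s(2) by simp
  have "g \<cdot> x\<^sub>1 = x\<^sub>2 \<cdot> ?f"
  proof -
    have "x\<^sub>2 \<cdot> (r \<cdot> m\<^sub>1) \<oplus>\<^bsub>Hom X A\<^sub>1 B\<^sub>2\<^esub> g \<cdot> x\<^sub>1 = e\<^sub>1 \<cdot> m\<^sub>1"
      using comp_add(1)[of m\<^sub>1 "x\<^sub>2 \<cdot> r" "g \<cdot> e\<^sub>2" M B\<^sub>2] e1' m(1) by simp
    then have "x\<^sub>2 \<cdot> (r \<cdot> m\<^sub>1) \<oplus>\<^bsub>Hom X A\<^sub>1 B\<^sub>2\<^esub> g \<cdot> x\<^sub>1 = \<zero>\<^bsub>Hom X A\<^sub>1 B\<^sub>2\<^esub>"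
      using triangle_comp_zero[OF m1] by simp
    then show ?thesis
      using hom_diff_zero[where f="g \<cdot> x\<^sub>1" and g="x\<^sub>2 \<cdot> ?f" and A="A\<^sub>1" and B="B\<^sub>2"]
        hom_add_comm[of "g \<cdot> x\<^sub>1" "x\<^sub>2 \<cdot> (r \<cdot> m\<^sub>1)" A\<^sub>1 B\<^sub>2] by simp
  qed
  moreover have "Emap X (Ident X C) ?f \<delta> = \<delta>'"
  proof -
    have "Emap X (Ident X C) r (Emap X (Ident X C) m\<^sub>1 \<delta> \<oplus>\<^bsub>Ext X C M\<^esub> Emap X (Ident X C) m\<^sub>2 \<delta>') = \<zero>\<^bsub>Ext X C A\<^sub>2\<^esub>"
      unfolding sum by simp
    then have "Emap X (Ident X C) (r \<cdot> m\<^sub>1) \<delta> \<oplus>\<^bsub>Ext X C A\<^sub>2\<^esub> \<delta>' = \<zero>\<^bsub>Ext X C A\<^sub>2\<^esub>" by simp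
    then have "Emap X (Ident X C) (r \<cdot> m\<^sub>1) \<delta> = \<ominus>\<^bsub>Ext X C A\<^sub>2\<^esub> \<delta>'"
      by (rule ext_negI) simp_all
    then show ?thesis by simp
  qed
  moreover have "triangle X A\<^sub>1 (i1 \<cdot> (\<ominus>\<^bsub>Hom X A\<^sub>1 A\<^sub>2\<^esub> ?f) \<oplus>\<^bsub>Hom X A\<^sub>1 P\<^esub> i2 \<cdot> x\<^sub>1)
      P (x\<^sub>2 \<cdot> p1 \<oplus>\<^bsub>Hom X P B\<^sub>2\<^esub> g \<cdot> p2) B\<^sub>2 (Emap X y\<^sub>2 (Ident X A\<^sub>1) \<delta>)"
    if b': "biproduct X A\<^sub>2 B\<^sub>1 P i1 i2 p1 p2" for P i1 i2 p1 p2
    using triangle_change_biproduct[OF b b', of "r \<cdot> m\<^sub>1" A\<^sub>1 x\<^sub>1 x\<^sub>2 B\<^sub>2 g] m1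
    unfolding m1'[symmetric] e1'[symmetric] by simp
  ultimately show "\<exists>f. arr X f A\<^sub>1 A\<^sub>2 \<and> g \<cdot> x\<^sub>1 = x\<^sub>2 \<cdot> f \<and> Emap X (Ident X C) f \<delta> = \<delta>' \<and>
      (\<forall>P i1 i2 p1 p2. biproduct X A\<^sub>2 B\<^sub>1 P i1 i2 p1 p2 \<longrightarrow>
        triangle X A\<^sub>1 (i1 \<cdot> (\<ominus>\<^bsub>Hom X A\<^sub>1 A\<^sub>2\<^esub> f) \<oplus>\<^bsub>Hom X A\<^sub>1 P\<^esub> i2 \<cdot> x\<^sub>1)
          P (x\<^sub>2 \<cdot> p1 \<oplus>\<^bsub>Hom X P B\<^sub>2\<^esub> g \<cdot> p2) B\<^sub>2 (Emap X y\<^sub>2 (Ident X A\<^sub>1) \<delta>))"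
    by (intro exI[of _ ?f]) (simp del: comp_neg)
qed

end

context pre_extriangulated
begin

section \<open>Homotopy cartesian squares with either side given\<close>

text \<open>
  The hypothesis, applied to the biproduct \<open>P\<close> sheared by \<open>v\<close>, is the claim for \<open>P\<close> itself.
\<close>

lemma triangle_shear:
  assumes all: "\<And>P i1 i2 p1 p2. biproduct X D B P i1 i2 p1 p2 \<Longrightarrow>
      triangle X A (i1 \<cdot> (\<ominus>\<^bsub>Hom X A D\<^esub> f) \<oplus>\<^bsub>Hom X A P\<^esub> i2 \<cdot> x) P (d \<cdot> p1 \<oplus>\<^bsub>Hom X P E\<^esub> g \<cdot> p2) E \<epsilon>"
    and a: "arr X x A B" "arr X d D E" "arr X f A D" "arr X g B E" "arr X v B D"
    and b: "biproduct X D B P i1 i2 p1 p2"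
  shows "triangle X A (i1 \<cdot> (\<ominus>\<^bsub>Hom X A D\<^esub> (f \<oplus>\<^bsub>Hom X A D\<^esub> v \<cdot> x)) \<oplus>\<^bsub>Hom X A P\<^esub> i2 \<cdot> x)
    P (d \<cdot> p1 \<oplus>\<^bsub>Hom X P E\<^esub> (g \<oplus>\<^bsub>Hom X B E\<^esub> d \<cdot> v) \<cdot> p2) E \<epsilon>"
proof -
  note [simp] = a[THEN arrD] biproduct_simps[OF b]
  have "i1 \<cdot> (\<ominus>\<^bsub>Hom X A D\<^esub> f) \<oplus>\<^bsub>Hom X A P\<^esub> (i2 \<oplus>\<^bsub>Hom X B P\<^esub> \<ominus>\<^bsub>Hom X B P\<^esub> (i1 \<cdot> v)) \<cdot> x
      = i1 \<cdot> (\<ominus>\<^bsub>Hom X A D\<^esub> (f \<oplus>\<^bsub>Hom X A D\<^esub> v \<cdot> x)) \<oplus>\<^bsub>Hom X A P\<^esub> i2 \<cdot> x"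
    by (simp add: hom_add_ac)
  moreover have "d \<cdot> (p1 \<oplus>\<^bsub>Hom X P D\<^esub> v \<cdot> p2) \<oplus>\<^bsub>Hom X P E\<^esub> g \<cdot> p2
      = d \<cdot> p1 \<oplus>\<^bsub>Hom X P E\<^esub> (g \<oplus>\<^bsub>Hom X B E\<^esub> d \<cdot> v) \<cdot> p2"
    by (simp add: hom_add_ac)
  ultimately show ?thesis
    using all[OF biproduct_shear[OF b a(5)]] by (simp del: comp_add comp_neg hom_add_assoc)
qed

text \<open>
  \<open>ET4_2\<close> supplies a homotopy cartesian square for some \<open>g'\<close> in place of \<open>g\<close>.  The two differ by
  \<open>x2 v\<close> since both lie over \<open>C\<close>, and the shear by \<open>v\<close> corrects this; \<open>f\<close> changes by \<open>v x1\<close>, which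
  does not affect \<open>f\<^sub>* \<delta>\<close>.
\<close>

lemma ET4_5_if_ET4_2:
  assumes "ET4_2 X"
  shows "ET4_5 X"
proof (rule ET4_5_I)
  fix A\<^sub>1 x\<^sub>1 B\<^sub>1 y\<^sub>1 C \<delta> A\<^sub>2 x\<^sub>2 B\<^sub>2 y\<^sub>2 \<delta>' g
  assume t1: "triangle X A\<^sub>1 x\<^sub>1 B\<^sub>1 y\<^sub>1 C \<delta>" and t2: "triangle X A\<^sub>2 x\<^sub>2 B\<^sub>2 y\<^sub>2 C \<delta>'"
    and g: "arr X g B\<^sub>1 B\<^sub>2" "y\<^sub>2 \<cdot> g = y\<^sub>1"
  note [simp] = triangle_simps[OF t1] triangle_simps[OF t2] arrD[OF g(1)]
  obtain f where f: "arr X f A\<^sub>1 A\<^sub>2" "g \<cdot> x\<^sub>1 = x\<^sub>2 \<cdot> f" "Emap X (Ident X C) f \<delta> = \<delta>'"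
    using ET3_op_E[OF t1 t2 g(1), of "Ident X C"] g(2) by auto
  note [simp] = arrD[OF f(1)]
  have p: "push X C f \<delta> = \<delta>'" unfolding push_def by (rule f(3))
  obtain g' where tm: "triangle_morphism X A\<^sub>1 x\<^sub>1 B\<^sub>1 y\<^sub>1 C \<delta> A\<^sub>2 x\<^sub>2 B\<^sub>2 y\<^sub>2 C (push X C f \<delta>) f g' (Ident X C)"
    and all: "\<forall>P i1 i2 p1 p2. biproduct X A\<^sub>2 B\<^sub>1 P i1 i2 p1 p2 \<longrightarrow>
        triangle X A\<^sub>1 (i1 \<cdot> (\<ominus>\<^bsub>Hom X A\<^sub>1 A\<^sub>2\<^esub> f) \<oplus>\<^bsub>Hom X A\<^sub>1 P\<^esub> i2 \<cdot> x\<^sub>1)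
          P (x\<^sub>2 \<cdot> p1 \<oplus>\<^bsub>Hom X P B\<^sub>2\<^esub> g' \<cdot> p2) B\<^sub>2 (pull X A\<^sub>1 y\<^sub>2 \<delta>)"
    using assms[unfolded ET4_2_def] t1 f(1) t2[folded p] by metis
  have g': "arr X g' B\<^sub>1 B\<^sub>2" "y\<^sub>2 \<cdot> g' = y\<^sub>1" "g' \<cdot> x\<^sub>1 = x\<^sub>2 \<cdot> f"
    using tm unfolding triangle_morphism_def by simp_all
  note [simp] = arrD[OF g'(1)]
  have k: "arr X (g \<oplus>\<^bsub>Hom X B\<^sub>1 B\<^sub>2\<^esub> \<ominus>\<^bsub>Hom X B\<^sub>1 B\<^sub>2\<^esub> g') B\<^sub>1 B\<^sub>2"
    "y\<^sub>2 \<cdot> (g \<oplus>\<^bsub>Hom X B\<^sub>1 B\<^sub>2\<^esub> \<ominus>\<^bsub>Hom X B\<^sub>1 B\<^sub>2\<^esub> g') = \<zero>\<^bsub>Hom X B\<^sub>1 C\<^esub>"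
    using g g' by simp_all
  obtain v where v: "arr X v B\<^sub>1 A\<^sub>2" "g \<oplus>\<^bsub>Hom X B\<^sub>1 B\<^sub>2\<^esub> \<ominus>\<^bsub>Hom X B\<^sub>1 B\<^sub>2\<^esub> g' = x\<^sub>2 \<cdot> v"
    using factor_through_inflation[OF t2 k] .
  note [simp] = arrD[OF v(1)]
  have gv: "g = g' \<oplus>\<^bsub>Hom X B\<^sub>1 B\<^sub>2\<^esub> x\<^sub>2 \<cdot> v"
    by (rule hom_diff_eq[OF v(2)]) simp_all
  let ?f = "f \<oplus>\<^bsub>Hom X A\<^sub>1 A\<^sub>2\<^esub> v \<cdot> x\<^sub>1"
  have "g \<cdot> x\<^sub>1 = x\<^sub>2 \<cdot> ?f"
    unfolding gv by (simp add: g'(3))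
  moreover have "Emap X (Ident X C) ?f \<delta> = \<delta>'"
  proof -
    have "Emap X (Ident X C) (v \<cdot> x\<^sub>1) \<delta> = Emap X (Ident X C) v (Emap X (Ident X C) x\<^sub>1 \<delta>)" by simp
    also have "\<dots> = \<zero>\<^bsub>Ext X C A\<^sub>2\<^esub>" by (simp only: triangle_push_zero[OF t1]) simp
    finally show ?thesis by (simp add: f(3))
  qed
  moreover have "triangle X A\<^sub>1 (i1 \<cdot> (\<ominus>\<^bsub>Hom X A\<^sub>1 A\<^sub>2\<^esub> ?f) \<oplus>\<^bsub>Hom X A\<^sub>1 P\<^esub> i2 \<cdot> x\<^sub>1)
      P (x\<^sub>2 \<cdot> p1 \<oplus>\<^bsub>Hom X P B\<^sub>2\<^esub> g \<cdot> p2) B\<^sub>2 (Emap X y\<^sub>2 (Ident X A\<^sub>1) \<delta>)"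
    if "biproduct X A\<^sub>2 B\<^sub>1 P i1 i2 p1 p2" for P i1 i2 p1 p2
    using triangle_shear[OF _ triangleD(1)[OF t1] triangleD(1)[OF t2] f(1) g'(1) v(1) that] all
    unfolding gv[symmetric] pull_def by blast
  ultimately show "\<exists>f. arr X f A\<^sub>1 A\<^sub>2 \<and> g \<cdot> x\<^sub>1 = x\<^sub>2 \<cdot> f \<and> Emap X (Ident X C) f \<delta> = \<delta>' \<and>
      (\<forall>P i1 i2 p1 p2. biproduct X A\<^sub>2 B\<^sub>1 P i1 i2 p1 p2 \<longrightarrow>
        triangle X A\<^sub>1 (i1 \<cdot> (\<ominus>\<^bsub>Hom X A\<^sub>1 A\<^sub>2\<^esub> f) \<oplus>\<^bsub>Hom X A\<^sub>1 P\<^esub> i2 \<cdot> x\<^sub>1)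
          P (x\<^sub>2 \<cdot> p1 \<oplus>\<^bsub>Hom X P B\<^sub>2\<^esub> g \<cdot> p2) B\<^sub>2 (Emap X y\<^sub>2 (Ident X A\<^sub>1) \<delta>))"
    by (intro exI[of _ ?f]) (simp del: comp_neg comp_add hom_group_laws2)
qed

text \<open>
  Now \<open>f\<close> is given and \<open>ET4_5\<close> supplies an \<open>f'\<close> with \<open>f'\<^sub>* \<delta> = f\<^sub>* \<delta>\<close>.  So \<open>f - f'\<close> extends to a
  map \<open>v\<close> along \<open>x\<close>, and the shear by \<open>v\<close> corrects it at the expense of changing \<open>g\<close> by \<open>d v\<close>.
\<close>

lemma ET4_2_if_ET4_5:
  assumes "ET4_5 X"
  shows "ET4_2 X"
  unfolding ET4_2_def
proof (intro allI impI, elim conjE)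
  fix A x B y C \<delta> f D d E e
  assume t: "triangle X A x B y C \<delta>" and f: "arr X f A D" and t': "triangle X D d E e C (push X C f \<delta>)"
  note t'' = t'[unfolded push_def]
  note [simp] = triangle_simps[OF t] triangle_simps[OF t''] arrD[OF f]
  obtain g\<^sub>0 where g0: "arr X g\<^sub>0 B E" "g\<^sub>0 \<cdot> x = d \<cdot> f" "e \<cdot> g\<^sub>0 = y"
    using triangle_lift[OF t t'' f, of "Ident X C"] by auto
  obtain f' where f': "arr X f' A D" "g\<^sub>0 \<cdot> x = d \<cdot> f'" "Emap X (Ident X C) f' \<delta> = Emap X (Ident X C) f \<delta>"
    "\<And>P i1 i2 p1 p2. biproduct X D B P i1 i2 p1 p2 \<Longrightarrow>
      triangle X A (i1 \<cdot> (\<ominus>\<^bsub>Hom X A D\<^esub> f') \<oplus>\<^bsub>Hom X A P\<^esub> i2 \<cdot> x)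
        P (d \<cdot> p1 \<oplus>\<^bsub>Hom X P E\<^esub> g\<^sub>0 \<cdot> p2) E (Emap X e (Ident X A) \<delta>)"
    by (rule ET4_5_E[OF assms t t'' g0(1,3)]) blast
  note [simp] = arrD[OF g0(1)] arrD[OF f'(1)]
  have k: "arr X (f \<oplus>\<^bsub>Hom X A D\<^esub> \<ominus>\<^bsub>Hom X A D\<^esub> f') A D"
    "Emap X (Ident X C) (f \<oplus>\<^bsub>Hom X A D\<^esub> \<ominus>\<^bsub>Hom X A D\<^esub> f') \<delta> = \<zero>\<^bsub>Ext X C D\<^esub>"
    by (simp_all add: f'(3))
  obtain v where v: "arr X v B D" "f \<oplus>\<^bsub>Hom X A D\<^esub> \<ominus>\<^bsub>Hom X A D\<^esub> f' = v \<cdot> x"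
    using extend_along_inflation[OF t k] .
  note [simp] = arrD[OF v(1)]
  have fv: "f = f' \<oplus>\<^bsub>Hom X A D\<^esub> v \<cdot> x"
    by (rule hom_diff_eq[OF v(2)]) simp_all
  let ?g = "g\<^sub>0 \<oplus>\<^bsub>Hom X B E\<^esub> d \<cdot> v"
  have "?g \<cdot> x = d \<cdot> f"
    unfolding fv by (simp add: f'(2))
  moreover have "e \<cdot> ?g = y"
    using comp_reassoc[OF triangle_comp_zero[OF t''], of v] by (simp add: g0(3))
  ultimately have "triangle_morphism X A x B y C \<delta> D d E e C (push X C f \<delta>) f ?g (Ident X C)"
    unfolding triangle_morphism_def using t t' by (simp add: push_def pull_def del: comp_add)
  moreover have "triangle X A (i1 \<cdot> (\<ominus>\<^bsub>Hom X A D\<^esub> f) \<oplus>\<^bsub>Hom X A P\<^esub> i2 \<cdot> x)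
      P (d \<cdot> p1 \<oplus>\<^bsub>Hom X P E\<^esub> ?g \<cdot> p2) E (pull X A e \<delta>)"
    if "biproduct X D B P i1 i2 p1 p2" for P i1 i2 p1 p2
    using triangle_shear[OF f'(4) triangleD(1)[OF t] triangleD(1)[OF t''] f'(1) g0(1) v(1) that]
    unfolding fv[symmetric] pull_def by blast
  ultimately show "\<exists>g. triangle_morphism X A x B y C \<delta> D d E e C (push X C f \<delta>) f g (Ident X C) \<and>
      (\<forall>P i1 i2 p1 p2. biproduct X D B P i1 i2 p1 p2 \<longrightarrow>
        triangle X A (i1 \<cdot> (\<ominus>\<^bsub>Hom X A D\<^esub> f) \<oplus>\<^bsub>Hom X A P\<^esub> i2 \<cdot> x)
          P (d \<cdot> p1 \<oplus>\<^bsub>Hom X P E\<^esub> g \<cdot> p2) E (pull X A e \<delta>))"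
    by blast
qed

section \<open>From homotopy cartesian squares to octahedra of deflations\<close>

text \<open>
  The inclusion of the summand \<open>C\<close> lifts along the deflation, so \<open>\<epsilon>\<close> vanishes on \<open>C\<close> and is pulled back
  from its restriction \<open>\<theta>\<close> to \<open>D\<close> along the projection.  Hence a realization of \<open>\<theta>\<close> maps to the
  given triangle and back, and it can be compared with the summand \<open>F \<rightarrow> E \<rightarrow> D\<close>.
\<close>

lemma triangle_cancel_summand:
  assumes b: "biproduct X E C Q a1 a2 b1 b2" and b': "biproduct X D C P i1 i2 p1 p2"
    and a: "arr X u F E" "arr X k E D"
    and t: "triangle X F (a1 \<cdot> u) Q (i1 \<cdot> (k \<cdot> b1) \<oplus>\<^bsub>Hom X Q P\<^esub> i2 \<cdot> b2) P \<epsilon>"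
  shows "triangle X F u E k D (Emap X i1 (Ident X F) \<epsilon>)"
proof -
  let ?y = "i1 \<cdot> (k \<cdot> b1) \<oplus>\<^bsub>Hom X Q P\<^esub> i2 \<cdot> b2"
  note [simp] = biproduct_simps[OF b] biproduct_simps[OF b'] a[THEN arrD]
  have \<epsilon> [simp]: "\<epsilon> \<in> carrier (Ext X P F)" using triangle_simps[OF t] by simp
  have "Emap X i2 (Ident X F) \<epsilon> = Emap X a2 (Ident X F) (Emap X ?y (Ident X F) \<epsilon>)" by (simp del: emap_add)
  also have "\<dots> = \<zero>\<^bsub>Ext X C F\<^esub>" by (simp only: triangle_pull_zero[OF t]) simp
  finally have i2: "Emap X i2 (Ident X F) \<epsilon> = \<zero>\<^bsub>Ext X C F\<^esub>" .
  define \<theta> where "\<theta> = Emap X i1 (Ident X F) \<epsilon>"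
  have \<theta> [simp]: "\<theta> \<in> carrier (Ext X D F)" unfolding \<theta>_def by simp
  have "\<epsilon> = Emap X (i1 \<cdot> p1 \<oplus>\<^bsub>Hom X P P\<^esub> i2 \<cdot> p2) (Ident X F) \<epsilon>" by (simp del: emap_add)
  also have "\<dots> = Emap X p1 (Ident X F) (Emap X i1 (Ident X F) \<epsilon>) \<oplus>\<^bsub>Ext X P F\<^esub>
      Emap X p2 (Ident X F) (Emap X i2 (Ident X F) \<epsilon>)"
    using emap_add(2)[of "i1 \<cdot> p1" "Ident X F" "i2 \<cdot> p2" P P \<epsilon>] by (simp del: biproduct_simps emap_add)
  also have "\<dots> = Emap X p1 (Ident X F) \<theta>" unfolding i2 \<theta>_def by simp
  finally have \<epsilon>\<theta>: "\<epsilon> = Emap X p1 (Ident X F) \<theta>" .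
  obtain u' E' k' where t': "triangle X F u' E' k' D \<theta>"
    using ex_triangle[of D F \<theta>] by auto
  note [simp] = triangle_simps[OF t']
  obtain \<beta> where \<beta>: "arr X \<beta> E' Q" "\<beta> \<cdot> u' = (a1 \<cdot> u) \<cdot> Ident X F" "?y \<cdot> \<beta> = i1 \<cdot> k'"
    by (rule triangle_lift[OF t' t, of "Ident X F" i1]) (simp_all add: \<theta>_def)
  obtain \<gamma> where \<gamma>: "arr X \<gamma> Q E'" "\<gamma> \<cdot> (a1 \<cdot> u) = u' \<cdot> Ident X F" "k' \<cdot> \<gamma> = p1 \<cdot> ?y"
    by (rule triangle_lift[OF t t', of "Ident X F" p1]) (simp_all add: \<epsilon>\<theta>)
  note [simp] = arrD[OF \<beta>(1)] arrD[OF \<gamma>(1)]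
  show ?thesis
    unfolding \<theta>_def[symmetric]
  proof (rule triangle_recognition[OF t', of "b1 \<cdot> \<beta>" E "\<gamma> \<cdot> a1"])
    show "b1 \<cdot> \<beta> \<cdot> u' = u" by (simp add: \<beta>(2))
    show "\<gamma> \<cdot> a1 \<cdot> u = u'" using \<gamma>(2) by simp
    show "k' \<cdot> (\<gamma> \<cdot> a1) = k" by (simp add: comp_reassoc[OF \<gamma>(3)])
    have "p1 \<cdot> (?y \<cdot> \<beta>) = k'" by (simp only: \<beta>(3)) simp
    then show "k \<cdot> (b1 \<cdot> \<beta>) = k'" by simp
    show "\<exists>w. arr X w E F \<and> s = u \<cdot> w" if s: "arr X s E E" "k \<cdot> s = \<zero>\<^bsub>Hom X E D\<^esub>" for s
    proof -
      note [simp] = arrD[OF s(1)]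
      have s': "arr X (a1 \<cdot> s) E Q" "?y \<cdot> (a1 \<cdot> s) = \<zero>\<^bsub>Hom X E P\<^esub>" by (simp_all add: s(2))
      obtain w where w: "arr X w E F" "a1 \<cdot> s = (a1 \<cdot> u) \<cdot> w"
        using factor_through_inflation[OF t s'] .
      note [simp] = arrD[OF w(1)]
      have "s = b1 \<cdot> (a1 \<cdot> s)" by simp
      also have "\<dots> = u \<cdot> w" unfolding w(2) by simp
      finally show ?thesis using w(1) by blast
    qed
  qed simp_all
qed

text \<open>
  The octahedron sought has rows \<open>D \<rightarrow> B \<rightarrow> A\<close> and \<open>E \<rightarrow> C \<rightarrow> A\<close> and the kernel \<open>F\<close> of \<open>g\<close>.
  The map \<open>u: F \<rightarrow> E\<close> and the triangle on \<open>F \<rightarrow> E \<oplus> C \<rightarrow> D \<oplus> C\<close> both come from a second use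
  of \<open>ET4_5\<close>, with the inclusion of \<open>C\<close> into \<open>D \<oplus> C\<close> as the map over \<open>B\<close>.
\<close>

lemma ET4_opposite_if_ET4_5:
  assumes "ET0_op X" "ET4_5 X"
  shows "ET4 (opposite X)"
  unfolding ET4_def triangle_opposite push_opposite pull_opposite opposite_simps
proof (intro allI impI, elim conjE)
  fix A f B f' D \<delta> g C g' F \<delta>'
  assume tf: "triangle X D f' B f A \<delta>" and tg: "triangle X F g' C g B \<delta>'"
  note [simp] = triangle_simps[OF tf] triangle_simps[OF tg]
  have "deflation X (f \<cdot> g)"
    using assms(1) tf tg triangleD(2)[OF tf] triangleD(2)[OF tg] unfolding ET0_op_def deflation_def by blast
  then obtain E h' C' A' \<delta>'' where t: "triangle X E h' C' (f \<cdot> g) A' \<delta>''"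
    unfolding deflation_def by blast
  have "A' = A" "C' = C" using triangle_simps[OF t] by simp_all
  then have t: "triangle X E h' C (f \<cdot> g) A \<delta>''" using t by simp
  note [simp] = triangle_simps[OF t]
  obtain P i1 i2 p1 p2 where bP: "biproduct X D C P i1 i2 p1 p2" using ex_biproduct[of D C] by auto
  obtain Q a1 a2 b1 b2 where bQ: "biproduct X E C Q a1 a2 b1 b2" using ex_biproduct[of E C] by auto
  note [simp] = biproduct_simps[OF bP] biproduct_simps[OF bQ]
  obtain k where k: "arr X k E D" "g \<cdot> h' = f' \<cdot> k" "Emap X (Ident X A) k \<delta>'' = \<delta>"
    and kP: "triangle X E (i1 \<cdot> (\<ominus>\<^bsub>Hom X E D\<^esub> k) \<oplus>\<^bsub>Hom X E P\<^esub> i2 \<cdot> h')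
      P (f' \<cdot> p1 \<oplus>\<^bsub>Hom X P B\<^esub> g \<cdot> p2) B (Emap X f (Ident X E) \<delta>'')"
    using ET4_5_E[OF assms(2) t tf triangleD(2)[OF tg]] bP by (metis (no_types, lifting))
  note [simp] = arrD[OF k(1)]
  let ?\<kappa> = "i1 \<cdot> (\<ominus>\<^bsub>Hom X E D\<^esub> k) \<oplus>\<^bsub>Hom X E P\<^esub> i2 \<cdot> h'"
  let ?\<pi> = "f' \<cdot> p1 \<oplus>\<^bsub>Hom X P B\<^esub> g \<cdot> p2"
  have i2g: "arr X i2 C P" "?\<pi> \<cdot> i2 = g" by simp_all
  obtain u where u: "arr X u F E" "i2 \<cdot> g' = ?\<kappa> \<cdot> u" "Emap X (Ident X B) u \<delta>' = Emap X f (Ident X E) \<delta>''"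
    and uQ: "triangle X F (a1 \<cdot> (\<ominus>\<^bsub>Hom X F E\<^esub> u) \<oplus>\<^bsub>Hom X F Q\<^esub> a2 \<cdot> g')
      Q (?\<kappa> \<cdot> b1 \<oplus>\<^bsub>Hom X Q P\<^esub> i2 \<cdot> b2) P (Emap X ?\<pi> (Ident X F) \<delta>')"
    using ET4_5_E[OF assms(2) tg kP i2g] bQ by (metis (no_types, lifting))
  note [simp] = arrD[OF u(1)]
  have hu: "h' \<cdot> u = g'"
  proof -
    have "p2 \<cdot> (i2 \<cdot> g') = p2 \<cdot> (?\<kappa> \<cdot> u)" by (simp only: u(2))
    then show ?thesis by simp
  qed
  \<comment> \<open>Since \<open>h' u = g'\<close>, shearing \<open>E \<oplus> C\<close> by \<open>h'\<close> makes both maps of the last triangle diagonal.\<close>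
  have bQ': "biproduct X E C Q (a1 \<oplus>\<^bsub>Hom X E Q\<^esub> \<ominus>\<^bsub>Hom X E Q\<^esub> (a2 \<cdot> h')) a2 b1 (b2 \<oplus>\<^bsub>Hom X Q C\<^esub> h' \<cdot> b1)"
    using biproduct_swap[OF biproduct_shear[OF biproduct_swap[OF bQ], of h']] by simp
  have e1: "a1 \<cdot> (\<ominus>\<^bsub>Hom X F E\<^esub> u) \<oplus>\<^bsub>Hom X F Q\<^esub> a2 \<cdot> g'
      = (a1 \<oplus>\<^bsub>Hom X E Q\<^esub> \<ominus>\<^bsub>Hom X E Q\<^esub> (a2 \<cdot> h')) \<cdot> (\<ominus>\<^bsub>Hom X F E\<^esub> u)"
    by (simp add: hu)
  have e2: "?\<kappa> \<cdot> b1 \<oplus>\<^bsub>Hom X Q P\<^esub> i2 \<cdot> b2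
      = i1 \<cdot> ((\<ominus>\<^bsub>Hom X E D\<^esub> k) \<cdot> b1) \<oplus>\<^bsub>Hom X Q P\<^esub> i2 \<cdot> (b2 \<oplus>\<^bsub>Hom X Q C\<^esub> h' \<cdot> b1)"
    by (simp add: hom_add_ac)
  have "triangle X F (\<ominus>\<^bsub>Hom X F E\<^esub> u) E (\<ominus>\<^bsub>Hom X E D\<^esub> k) D (Emap X i1 (Ident X F) (Emap X ?\<pi> (Ident X F) \<delta>'))"
    by (rule triangle_cancel_summand[OF bQ' bP _ _ uQ[unfolded e1 e2]]) simp_all
  moreover have "Emap X i1 (Ident X F) (Emap X ?\<pi> (Ident X F) \<delta>') = Emap X f' (Ident X F) \<delta>'"
    by (simp del: emap_add)
  ultimately have "triangle X F (\<ominus>\<^bsub>Hom X F E\<^esub> u) E (\<ominus>\<^bsub>Hom X E D\<^esub> k) D (Emap X f' (Ident X F) \<delta>')" by simp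
  \<comment> \<open>Both maps carry a sign; the automorphism \<open>-1\<close> of \<open>E\<close> removes the two at once.\<close>
  moreover have "iso_arr X (\<ominus>\<^bsub>Hom X E E\<^esub> (Ident X E)) E E"
    by (rule iso_arrI[of _ _ _ "\<ominus>\<^bsub>Hom X E E\<^esub> (Ident X E)" "\<ominus>\<^bsub>Hom X E E\<^esub> (Ident X E)"]) simp_all
  ultimately have "triangle X F u E k D (Emap X f' (Ident X F) \<delta>')"
    by (rule triangle_iso_middle) simp_all
  then show "\<exists>E h h' \<delta>'' d e. triangle X E h' C h A \<delta>'' \<and> triangle X F e E d D (pull X F f' \<delta>') \<and>
      h = f \<cdot> g \<and> f' \<cdot> d = g \<cdot> h' \<and> h' \<cdot> e = g' \<and> push X A d \<delta>'' = \<delta> \<and> pull X E f \<delta>'' = push X B e \<delta>'"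
    using t k(2,3) u(3) hu unfolding push_def pull_def by metis
qed

end

context pre_extriangulated
begin

section \<open>Octahedra on a factorized deflation\<close>

lemma ET4_3_opposite_E:
  assumes "ET4_3 (opposite X)" "triangle X D f' B f A \<delta>f" "triangle X F g' C g B \<delta>g"
    "triangle X E\<^sub>0 h\<^sub>0 C (f \<cdot> g) A \<delta>h"
  obtains d\<^sub>0 e\<^sub>0 where "f' \<cdot> d\<^sub>0 = g \<cdot> h\<^sub>0" "h\<^sub>0 \<cdot> e\<^sub>0 = g'"
    "triangle X F e\<^sub>0 E\<^sub>0 d\<^sub>0 D (Emap X f' (Ident X F) \<delta>g)"
    "Emap X (Ident X A) d\<^sub>0 \<delta>h = \<delta>f" "Emap X f (Ident X E\<^sub>0) \<delta>h = Emap X (Ident X B) e\<^sub>0 \<delta>g"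
  using assms unfolding ET4_3_def triangle_opposite push_opposite pull_opposite opposite_simps push_def pull_def
  by metis

lemma ET4_4_E:
  assumes "ET4_4 X" "triangle X D f A f' C \<delta>f" "triangle X A g B g' F \<delta>g" "triangle X E h B h' C \<delta>h"
    "h' \<cdot> g = f'"
  obtains d e \<theta> where "triangle X D d E e F \<theta>" "h \<cdot> d = g \<cdot> f" "g' \<cdot> h = e"
    "Emap X (Ident X C) d \<delta>f = \<delta>h" "Emap X (Ident X F) f \<theta> = \<delta>g"
    "Emap X g' (Ident X D) \<theta> \<oplus>\<^bsub>Ext X B D\<^esub> Emap X h' (Ident X D) \<delta>f = \<zero>\<^bsub>Ext X B D\<^esub>"
  using assms unfolding ET4_4_def push_def pull_def by metis

text \<open>
  Let \<open>G\<close> be the cone of \<open>g f\<close>.  The triangle \<open>C \<rightarrow> G \<rightarrow> F\<close> realizes \<open>f'\<^sub>* \<delta>g\<close>, which vanishes as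
  \<open>f' = h' g\<close>.  So it splits, and there is a retraction \<open>r'\<close> with \<open>r' q = h'\<close>.  The factorization
  \<open>h' = r' q\<close> into deflations then has an octahedron in the opposite category, whose remaining triangle
  is \<open>D \<rightarrow> E \<rightarrow> F\<close>.
\<close>

lemma ET4_4_if_octahedra:
  assumes "ET4 X" "ET4_3 (opposite X)"
  shows "ET4_4 X"
  unfolding ET4_4_def
proof (intro allI impI, elim conjE)
  fix D f A f' C \<delta>f g B g' F \<delta>g E h h' \<delta>h
  assume tf: "triangle X D f A f' C \<delta>f" and tg: "triangle X A g B g' F \<delta>g"
    and th: "triangle X E h B h' C \<delta>h" and hg: "h' \<cdot> g = f'"
  obtain G q \<delta> c e\<^sub>0 where t: "triangle X D (g \<cdot> f) B q G \<delta>"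
    and t0: "triangle X C c G e\<^sub>0 F (Emap X (Ident X F) f' \<delta>g)"
    and o: "c \<cdot> f' = q \<cdot> g" "e\<^sub>0 \<cdot> q = g'" "Emap X c (Ident X D) \<delta> = \<delta>f"
      "Emap X (Ident X G) f \<delta> = Emap X e\<^sub>0 (Ident X A) \<delta>g"
    using ET4_E[OF assms(1) tf tg] .
  note [simp] = triangle_simps[OF tf] triangle_simps[OF tg] triangle_simps[OF th] triangle_simps[OF t]
    triangle_simps[OF t0]
  have "Emap X (Ident X F) f' \<delta>g = Emap X (Ident X F) h' (Emap X (Ident X F) g \<delta>g)"
    by (simp add: hg)
  also have "\<dots> = \<zero>\<^bsub>Ext X F C\<^esub>" by (simp only: triangle_push_zero[OF tg]) simp
  finally have z: "Emap X (Ident X F) f' \<delta>g = \<zero>\<^bsub>Ext X F C\<^esub>" .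
  have idC: "arr X (Ident X C) C C"
    "Emap X (Ident X F) (Ident X C) (Emap X (Ident X F) f' \<delta>g) = \<zero>\<^bsub>Ext X F C\<^esub>"
    by (simp_all add: z)
  obtain r where r: "arr X r G C" "Ident X C = r \<cdot> c"
    using extend_along_inflation[OF t0 idC] .
  note [simp] = arrD[OF r(1)] r(2)[symmetric]
  let ?k = "r \<cdot> q \<oplus>\<^bsub>Hom X B C\<^esub> \<ominus>\<^bsub>Hom X B C\<^esub> h'"
  have k: "arr X ?k B C" "?k \<cdot> g = \<zero>\<^bsub>Hom X A C\<^esub>"
    by (simp_all add: hg o(1)[symmetric] comp_reassoc[OF r(2)[symmetric]])
  obtain s where s: "arr X s F C" "?k = s \<cdot> g'"
    using factor_through_deflation[OF tg k] .
  note [simp] = arrD[OF s(1)]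
  have rq: "r \<cdot> q = h' \<oplus>\<^bsub>Hom X B C\<^esub> s \<cdot> g'"
    by (rule hom_diff_eq[OF s(2)]) simp_all
  \<comment> \<open>The retraction \<open>r\<close> satisfies \<open>r q = h'\<close> only on the image of \<open>g\<close>; the defect \<open>s g' = s e0 q\<close> is subtracted.\<close>
  define r' where "r' = r \<oplus>\<^bsub>Hom X G C\<^esub> \<ominus>\<^bsub>Hom X G C\<^esub> (s \<cdot> e\<^sub>0)"
  have r': "arr X r' G C" "r' \<cdot> c = Ident X C" "r' \<cdot> q = h'"
    unfolding r'_def by (simp_all add: triangle_comp_zero[OF t0] o(2) rq)
  obtain \<sigma> where b: "biproduct X C F G c \<sigma> r' e\<^sub>0"
    using biproduct_if_retraction[OF t0 r'(1,2)] .
  note [simp] = biproduct_simps[OF b]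
  obtain e d where de: "\<sigma> \<cdot> e = q \<cdot> h" "h \<cdot> d = g \<cdot> f"
    and td: "triangle X D d E e F (Emap X \<sigma> (Ident X D) \<delta>)"
    and ee: "Emap X r' (Ident X E) \<delta>h = Emap X (Ident X G) d \<delta>"
    using ET4_3_opposite_E[OF assms(2) triangle_biproduct[OF biproduct_swap[OF b]] t th[folded r'(3)]] .
  note [simp] = triangle_simps[OF td]
  have "g' \<cdot> h = e\<^sub>0 \<cdot> (q \<cdot> h)" by (simp add: comp_reassoc[OF o(2)])
  also have "\<dots> = e" unfolding de(1)[symmetric] by simp
  finally have "g' \<cdot> h = e" .
  moreover have "push X C d \<delta>f = \<delta>h"
  proof -
    have "push X C d \<delta>f = Emap X c (Ident X E) (Emap X (Ident X G) d \<delta>)"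
      unfolding push_def o(3)[symmetric] by simp
    also have "\<dots> = \<delta>h" unfolding ee[symmetric] by simp
    finally show ?thesis .
  qed
  moreover have "push X F f (Emap X \<sigma> (Ident X D) \<delta>) = \<delta>g"
  proof -
    have "push X F f (Emap X \<sigma> (Ident X D) \<delta>) = Emap X \<sigma> (Ident X A) (Emap X (Ident X G) f \<delta>)"
      unfolding push_def by simp
    also have "\<dots> = \<delta>g" unfolding o(4) by simp
    finally show ?thesis .
  qed
  moreover have "pull X D g' (Emap X \<sigma> (Ident X D) \<delta>) \<oplus>\<^bsub>Ext X B D\<^esub> pull X D h' \<delta>f = \<zero>\<^bsub>Ext X B D\<^esub>"
  proof -
    have "pull X D g' (Emap X \<sigma> (Ident X D) \<delta>) \<oplus>\<^bsub>Ext X B D\<^esub> pull X D h' \<delta>f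
        = Emap X (\<sigma> \<cdot> (e\<^sub>0 \<cdot> q)) (Ident X D) \<delta> \<oplus>\<^bsub>Ext X B D\<^esub> Emap X (c \<cdot> (r' \<cdot> q)) (Ident X D) \<delta>"
      unfolding pull_def o(2) r'(3) o(3)[symmetric] by simp
    also have "\<dots> = Emap X q (Ident X D) (Emap X (\<sigma> \<cdot> e\<^sub>0 \<oplus>\<^bsub>Hom X G G\<^esub> c \<cdot> r') (Ident X D) \<delta>)"
      by (simp del: biproduct_simps)
    also have "\<dots> = Emap X q (Ident X D) \<delta>"
      using biproduct_swap[OF b] by (simp add: biproduct_def del: emap_add)
    finally show ?thesis by (simp only: triangle_pull_zero[OF t])
  qed
  ultimately show "\<exists>d e \<theta>. triangle X D d E e F \<theta> \<and> h \<cdot> d = g \<cdot> f \<and> g' \<cdot> h = e \<and>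
      push X C d \<delta>f = \<delta>h \<and> push X F f \<theta> = \<delta>g \<and>
      pull X D g' \<theta> \<oplus>\<^bsub>Ext X B D\<^esub> pull X D h' \<delta>f = \<zero>\<^bsub>Ext X B D\<^esub>"
    using td de(2) by blast
qed

text \<open>
  Direct sum with the identity of \<open>D\<close>, obtained by comparison with a realization of \<open>l2\<^sup>* \<delta>\<close>.
  Maps to that realization from the summands \<open>B\<close> and \<open>D\<close> exist because \<open>k2\<^sup>* l2\<^sup>* \<delta> = \<delta>\<close> and
  \<open>k1\<^sup>* l2\<^sup>* \<delta> = 0\<close>.
\<close>

lemma triangle_add_summand:
  assumes t: "triangle X A x B y C \<delta>"
    and b: "biproduct X D B R j1 j2 q1 q2" and b': "biproduct X D C Q k1 k2 l1 l2"
  shows "triangle X A (j2 \<cdot> x) R (k1 \<cdot> q1 \<oplus>\<^bsub>Hom X R Q\<^esub> k2 \<cdot> (y \<cdot> q2)) Q (Emap X l2 (Ident X A) \<delta>)"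
proof -
  let ?y = "k1 \<cdot> q1 \<oplus>\<^bsub>Hom X R Q\<^esub> k2 \<cdot> (y \<cdot> q2)"
  note [simp] = triangle_simps[OF t] biproduct_simps[OF b] biproduct_simps[OF b']
  obtain u M k where t': "triangle X A u M k Q (Emap X l2 (Ident X A) \<delta>)"
    using ex_triangle[of Q A "Emap X l2 (Ident X A) \<delta>"] by auto
  note [simp] = triangle_simps[OF t']
  obtain \<beta> where \<beta>: "arr X \<beta> M B" "\<beta> \<cdot> u = x \<cdot> Ident X A" "y \<cdot> \<beta> = l2 \<cdot> k"
    by (rule triangle_lift[OF t' t, of "Ident X A" l2]) simp_all
  obtain \<gamma> where \<gamma>: "arr X \<gamma> B M" "\<gamma> \<cdot> x = u \<cdot> Ident X A" "k \<cdot> \<gamma> = k2 \<cdot> y"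
    by (rule triangle_lift[OF t t', of "Ident X A" k2]) simp_all
  have k1: "arr X k1 D Q" "Emap X k1 (Ident X A) (Emap X l2 (Ident X A) \<delta>) = \<zero>\<^bsub>Ext X D A\<^esub>"
    by simp_all
  obtain s where s: "arr X s D M" "k1 = k \<cdot> s"
    using lift_along_deflation[OF t' k1] .
  note [simp] = arrD[OF \<beta>(1)] arrD[OF \<gamma>(1)] arrD[OF s(1)]
  show ?thesis
  proof (rule triangle_recognition[OF t', of "j1 \<cdot> (l1 \<cdot> k) \<oplus>\<^bsub>Hom X M R\<^esub> j2 \<cdot> \<beta>" R "s \<cdot> q1 \<oplus>\<^bsub>Hom X R M\<^esub> \<gamma> \<cdot> q2"])
    show "(j1 \<cdot> (l1 \<cdot> k) \<oplus>\<^bsub>Hom X M R\<^esub> j2 \<cdot> \<beta>) \<cdot> u = j2 \<cdot> x"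
      by (simp add: \<beta>(2) triangle_comp_zero[OF t'])
    show "?y \<cdot> (j1 \<cdot> (l1 \<cdot> k) \<oplus>\<^bsub>Hom X M R\<^esub> j2 \<cdot> \<beta>) = k"
      using biproduct_decompose(1)[OF b', of k] by (simp add: \<beta>(3))
    show "(s \<cdot> q1 \<oplus>\<^bsub>Hom X R M\<^esub> \<gamma> \<cdot> q2) \<cdot> (j2 \<cdot> x) = u"
      by (simp add: \<gamma>(2))
    show "k \<cdot> (s \<cdot> q1 \<oplus>\<^bsub>Hom X R M\<^esub> \<gamma> \<cdot> q2) = ?y"
      using comp_reassoc[OF s(2)[symmetric], of q1] by (simp add: comp_reassoc[OF \<gamma>(3)])
    show "\<exists>w. arr X w R A \<and> v = j2 \<cdot> x \<cdot> w" if v: "arr X v R R" "?y \<cdot> v = \<zero>\<^bsub>Hom X R Q\<^esub>" for v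
    proof -
      note [simp] = arrD[OF v(1)]
      have "l1 \<cdot> (?y \<cdot> v) = \<zero>\<^bsub>Hom X R D\<^esub>" "l2 \<cdot> (?y \<cdot> v) = \<zero>\<^bsub>Hom X R C\<^esub>"
        by (simp_all only: v(2)) simp_all
      then have q: "q1 \<cdot> v = \<zero>\<^bsub>Hom X R D\<^esub>" "y \<cdot> (q2 \<cdot> v) = \<zero>\<^bsub>Hom X R C\<^esub>" by simp_all
      have q2: "arr X (q2 \<cdot> v) R B" by simp
      obtain w where w: "arr X w R A" "q2 \<cdot> v = x \<cdot> w"
        using factor_through_inflation[OF t q2 q(2)] .
      note [simp] = arrD[OF w(1)]
      have "v = j2 \<cdot> x \<cdot> w"
        using biproduct_decompose(1)[OF b, of v] by (simp add: q(1) w(2))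
      then show ?thesis using w(1) by blast
    qed
  qed simp_all
qed

text \<open>
  Write \<open>(-f, y)\<close> as the deflation \<open>1 \<oplus> y: D \<oplus> B \<rightarrow> D \<oplus> C\<close> followed by the split deflation
  \<open>(-f, 1): D \<oplus> C \<rightarrow> C\<close>.  The first factor of \<open>y = (-f, y) i2\<close> is a split inflation with cone \<open>D\<close>,
  so \<open>ET4_4\<close> gives a triangle \<open>A \<rightarrow> E1 \<rightarrow> D\<close>, where \<open>E1\<close> is the kernel of \<open>(-f, y)\<close>.  Restricted to
  \<open>D\<close>, the sign relation in \<open>ET4_4\<close> identifies its extension as \<open>f\<^sup>* \<delta>\<close>.
\<close>

lemma pullback_square_if_ET4_4:
  assumes ET0: "ET0_op X" and ET4_4: "ET4_4 X"
    and t: "triangle X A x B y C \<delta>" and f: "arr X f D C"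
    and t': "triangle X A d E e D (Emap X f (Ident X A) \<delta>)"
  obtains g where "arr X g E B" "y \<cdot> g = f \<cdot> e" "g \<cdot> d = x"
    "\<And>P i1 i2 p1 p2. biproduct X D B P i1 i2 p1 p2 \<Longrightarrow>
      triangle X E (i1 \<cdot> e \<oplus>\<^bsub>Hom X E P\<^esub> i2 \<cdot> g) P ((\<ominus>\<^bsub>Hom X D C\<^esub> f) \<cdot> p1 \<oplus>\<^bsub>Hom X P C\<^esub> y \<cdot> p2) C
        (Emap X (Ident X C) d \<delta>)"
proof -
  note [simp] = triangle_simps[OF t] triangle_simps[OF t'] arrD[OF f]
  obtain P i1 i2 p1 p2 where bP: "biproduct X D B P i1 i2 p1 p2" using ex_biproduct[of D B] by auto
  obtain Q k1 k2 l1 l2 where bQ: "biproduct X D C Q k1 k2 l1 l2" using ex_biproduct[of D C] by auto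
  note [simp] = biproduct_simps[OF bP] biproduct_simps[OF bQ]
  let ?\<pi> = "(\<ominus>\<^bsub>Hom X D C\<^esub> f) \<cdot> p1 \<oplus>\<^bsub>Hom X P C\<^esub> y \<cdot> p2"
  have "deflation X (k1 \<cdot> p1 \<oplus>\<^bsub>Hom X P Q\<^esub> k2 \<cdot> (y \<cdot> p2))"
    using triangle_add_summand[OF t bP bQ] unfolding deflation_def by blast
  moreover have "deflation X (l2 \<oplus>\<^bsub>Hom X Q C\<^esub> (\<ominus>\<^bsub>Hom X D C\<^esub> f) \<cdot> l1)"
    using triangle_biproduct[OF biproduct_swap[OF biproduct_shear[OF biproduct_swap[OF bQ],
          of "\<ominus>\<^bsub>Hom X D C\<^esub> f"]]]
    unfolding deflation_def by (simp del: comp_neg) blast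
  moreover have "(l2 \<oplus>\<^bsub>Hom X Q C\<^esub> (\<ominus>\<^bsub>Hom X D C\<^esub> f) \<cdot> l1) \<cdot> (k1 \<cdot> p1 \<oplus>\<^bsub>Hom X P Q\<^esub> k2 \<cdot> (y \<cdot> p2)) = ?\<pi>"
    by (simp add: hom_add_ac)
  moreover have "arr X (k1 \<cdot> p1 \<oplus>\<^bsub>Hom X P Q\<^esub> k2 \<cdot> (y \<cdot> p2)) P Q"
    "arr X (l2 \<oplus>\<^bsub>Hom X Q C\<^esub> (\<ominus>\<^bsub>Hom X D C\<^esub> f) \<cdot> l1) Q C"
    by simp_all
  ultimately have "deflation X ?\<pi>" using ET0 unfolding ET0_op_def by metis
  then obtain E\<^sub>1 \<kappa> P' C' \<delta>\<^sub>1 where t1: "triangle X E\<^sub>1 \<kappa> P' ?\<pi> C' \<delta>\<^sub>1"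
    unfolding deflation_def by blast
  have "P' = P" "C' = C" using triangle_simps(5,6)[OF t1] by (simp_all del: comp_neg)
  then have t1: "triangle X E\<^sub>1 \<kappa> P ?\<pi> C \<delta>\<^sub>1" using t1 by simp
  note [simp] = triangle_simps[OF t1]
  have \<pi>i2: "?\<pi> \<cdot> i2 = y" by simp
  obtain d\<^sub>1 e\<^sub>1 \<theta> where t2: "triangle X A d\<^sub>1 E\<^sub>1 e\<^sub>1 D \<theta>" and o: "\<kappa> \<cdot> d\<^sub>1 = i2 \<cdot> x" "p1 \<cdot> \<kappa> = e\<^sub>1"
    and \<delta>1: "Emap X (Ident X C) d\<^sub>1 \<delta> = \<delta>\<^sub>1"
    and sum: "Emap X p1 (Ident X A) \<theta> \<oplus>\<^bsub>Ext X P A\<^esub> Emap X ?\<pi> (Ident X A) \<delta> = \<zero>\<^bsub>Ext X P A\<^esub>"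
    using ET4_4_E[OF ET4_4 t triangle_biproduct[OF biproduct_swap[OF bP]] t1 \<pi>i2] .
  note [simp] = triangle_simps[OF t2]
  have "Emap X i1 (Ident X A) (Emap X p1 (Ident X A) \<theta> \<oplus>\<^bsub>Ext X P A\<^esub> Emap X ?\<pi> (Ident X A) \<delta>) = \<zero>\<^bsub>Ext X D A\<^esub>"
    unfolding sum by simp
  then have "\<theta> \<oplus>\<^bsub>Ext X D A\<^esub> \<ominus>\<^bsub>Ext X D A\<^esub> (Emap X f (Ident X A) \<delta>) = \<zero>\<^bsub>Ext X D A\<^esub>" by simp
  then have "\<theta> = \<ominus>\<^bsub>Ext X D A\<^esub> (\<ominus>\<^bsub>Ext X D A\<^esub> (Emap X f (Ident X A) \<delta>))"
    by (rule ext_negI) simp_all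
  then have \<theta>: "\<theta> = Emap X f (Ident X A) \<delta>" by simp
  obtain b where b: "iso_arr X b E\<^sub>1 E" "b \<cdot> d\<^sub>1 = d" "e \<cdot> b = e\<^sub>1"
    using triangle_unique[OF t2[unfolded \<theta>] t'] .
  obtain b' where b': "arr X b E\<^sub>1 E" "arr X b' E E\<^sub>1" "b' \<cdot> b = Ident X E\<^sub>1" "b \<cdot> b' = Ident X E"
    using iso_arrE[OF b(1)] by metis
  note [simp] = b'(1,2)[THEN arrD] b'(3,4)
  have t3: "triangle X E (\<kappa> \<cdot> b') P ?\<pi> C (Emap X (Ident X C) d \<delta>)"
  proof -
    have "Emap X (Ident X C) b \<delta>\<^sub>1 = Emap X (Ident X C) d \<delta>"
      unfolding \<delta>1[symmetric] b(2)[symmetric] by simp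
    then show ?thesis using triangle_iso_left[OF t1 b'] by simp
  qed
  define g where "g = p2 \<cdot> (\<kappa> \<cdot> b')"
  have g [simp]: "arr X g E B" "Arr g" "src g = E" "tgt g = B" unfolding g_def by simp_all
  have "p1 \<cdot> (\<kappa> \<cdot> b') = e"
    using comp_assoc'[of b' b e] b(3) by (simp add: comp_reassoc[OF o(2)])
  then have dec: "\<kappa> \<cdot> b' = i1 \<cdot> e \<oplus>\<^bsub>Hom X E P\<^esub> i2 \<cdot> g"
    using biproduct_decompose(1)[OF bP, of "\<kappa> \<cdot> b'"] unfolding g_def by simp
  show thesis
  proof (rule that[of g])
    show "arr X g E B" by (rule g)
    have "?\<pi> \<cdot> (i1 \<cdot> e \<oplus>\<^bsub>Hom X E P\<^esub> i2 \<cdot> g) = \<zero>\<^bsub>Hom X E C\<^esub>"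
      using triangle_comp_zero[OF t3] unfolding dec .
    then show "y \<cdot> g = f \<cdot> e"
      using hom_diff_zero[where f="y \<cdot> g" and g="f \<cdot> e" and A=E and B=C]
      by (simp add: hom_add_ac)
    have "g \<cdot> d = p2 \<cdot> (\<kappa> \<cdot> (b' \<cdot> (b \<cdot> d\<^sub>1)))" unfolding g_def b(2) by simp
    also have "\<dots> = x" by (simp add: comp_reassoc[OF b'(3)] o(1))
    finally show "g \<cdot> d = x" .
    show "triangle X E (j1 \<cdot> e \<oplus>\<^bsub>Hom X E P'\<^esub> j2 \<cdot> g) P' ((\<ominus>\<^bsub>Hom X D C\<^esub> f) \<cdot> q1 \<oplus>\<^bsub>Hom X P' C\<^esub> y \<cdot> q2) C
        (Emap X (Ident X C) d \<delta>)" if "biproduct X D B P' j1 j2 q1 q2" for P' j1 j2 q1 q2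
      by (rule triangle_change_biproduct[OF bP that _ _ _ _ t3[unfolded dec]]) simp_all
  qed
qed

lemma ET4_2_opposite_if_ET4_4:
  assumes "ET0_op X" "ET4_4 X"
  shows "ET4_2 (opposite X)"
  unfolding ET4_2_def triangle_opposite triangle_morphism_opposite push_opposite pull_opposite
    opposite_simps arr_opposite biproduct_opposite
proof (intro allI impI, elim conjE)
  fix A x B y C \<delta> f D d E e
  assume t: "triangle X C y B x A \<delta>" and f: "arr X f D A" and t': "triangle X C e E d D (pull X C f \<delta>)"
  note t'' = t'[unfolded pull_def]
  note [simp] = triangle_simps[OF t] triangle_simps[OF t''] arrD[OF f]
  obtain g where g: "arr X g E B" "x \<cdot> g = f \<cdot> d" "g \<cdot> e = y"
    and all: "\<And>P i1 i2 p1 p2. biproduct X D B P i1 i2 p1 p2 \<Longrightarrow>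
      triangle X E (i1 \<cdot> d \<oplus>\<^bsub>Hom X E P\<^esub> i2 \<cdot> g) P ((\<ominus>\<^bsub>Hom X D A\<^esub> f) \<cdot> p1 \<oplus>\<^bsub>Hom X P A\<^esub> x \<cdot> p2) A
        (Emap X (Ident X A) e \<delta>)"
    by (rule pullback_square_if_ET4_4[OF assms t f t'']) blast
  have "triangle_morphism X C e E d D (pull X C f \<delta>) C y B x A \<delta> (Ident X C) g f"
    unfolding triangle_morphism_def using t t' g f by (simp add: push_def pull_def)
  then show "\<exists>g. triangle_morphism X C e E d D (pull X C f \<delta>) C y B x A \<delta> (Ident X C) g f \<and>
      (\<forall>P i1 i2 p1 p2. biproduct X D B P p1 p2 i1 i2 \<longrightarrow>
        triangle X E (p1 \<cdot> d \<oplus>\<^bsub>Hom X E P\<^esub> p2 \<cdot> g) P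
          ((\<ominus>\<^bsub>Hom X D A\<^esub> f) \<cdot> i1 \<oplus>\<^bsub>Hom X P A\<^esub> x \<cdot> i2) A (push X A e \<delta>))"
    using all unfolding push_def by blast
qed

section \<open>The equivalences\<close>

lemma octahedral_implications:
  assumes "ET0 X" "ET0_op X"
  shows "ET4_3 X \<longleftrightarrow> ET4 X" "ET4 X \<Longrightarrow> ET4_1 X" "ET4_1 X \<Longrightarrow> ET4_5 X" "ET4_5 X \<longleftrightarrow> ET4_2 X"
    "ET4_5 X \<Longrightarrow> ET4 (opposite X)"
    "ET4 X \<Longrightarrow> ET4_3 (opposite X) \<Longrightarrow> ET4_4 X" "ET4_4 X \<Longrightarrow> ET4_2 (opposite X)"
  using assms ET4_3_if_ET4 ET4_if_ET4_3 ET4_1_if_ET4 ET4_5_if_ET4_1 ET4_5_if_ET4_2 ET4_2_if_ET4_5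
    ET4_opposite_if_ET4_5 ET4_4_if_octahedra ET4_2_opposite_if_ET4_4 by blast+

text \<open>
  The implications hold for \<open>X\<close> and for \<open>opposite X\<close>; the two chains together form one cycle.
\<close>

lemma octahedral_axioms_iff_ET4:
  assumes "ET0 X" "ET0_op X"
  shows "ET4 (opposite X) \<longleftrightarrow> ET4 X"
    "P \<in> {ET4, ET4_1, ET4_2, ET4_3, ET4_4, ET4_5} \<Longrightarrow> P X \<longleftrightarrow> ET4 X"
proof -
  interpret opp: pre_extriangulated "opposite X" by (rule pre_extriangulated_opposite)
  note c = octahedral_implications[OF assms]
  have "ET0 (opposite X)" "ET0_op (opposite X)" using assms ET0_opposite by blast+
  note c' = opp.octahedral_implications[OF this, unfolded opposite_opposite]
  show "ET4 (opposite X) \<longleftrightarrow> ET4 X" using c(2,3,5) c'(2,3,5) by blast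
  show "P X \<longleftrightarrow> ET4 X" if "P \<in> {ET4, ET4_1, ET4_2, ET4_3, ET4_4, ET4_5}"
    using that c c' by auto
qed

end

theorem theorem1p3:
  fixes X :: "('o, 'm, 'e) ext_cat"
  assumes "pre_extriangulated X" and "ET0 X" and "ET0_op X"
  shows "(\<forall>P \<in> {ET4, ET4_1, ET4_2, ET4_3, ET4_4, ET4_5}.
            \<forall>Q \<in> {ET4, ET4_1, ET4_2, ET4_3, ET4_4, ET4_5}. P X \<longleftrightarrow> Q X) \<and>
         (\<forall>P \<in> {ET4, ET4_1, ET4_2, ET4_3, ET4_4, ET4_5}. P X \<longleftrightarrow> P (opposite X))"
proof -
  interpret pre_extriangulated X by (rule assms(1))
  interpret opp: pre_extriangulated "opposite X" by (rule pre_extriangulated_opposite)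
  have "ET0 (opposite X)" "ET0_op (opposite X)" using assms(2,3) ET0_opposite by blast+
  then show ?thesis
    using octahedral_axioms_iff_ET4[OF assms(2,3)] opp.octahedral_axioms_iff_ET4 by blast
qed

end
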